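(* There is a universal constant $K$ such that for every $d,k\in\mathbb{N}$ and $C,r>0$ there is an algorithm which runs in time $(dk\log(C+2))^{O(1)}$ and has the following guarantee. Let $Z_1,\ldots,Z_k\in\mathbb{R}^d$. Suppose that $\mu\in\mathbb{R}^d$ is certifiably $(r,1/100)$-central with respect to $Z_1,\ldots,Z_k$, and suppose that at most $k/100$ of the vectors $Z_1,\ldots,Z_k$ have $\|Z_i-\mu\|>Cr$. Then, given $Z_1,\ldots,Z_k$, the algorithm returns a point $\hat\mu\in\mathbb{R}^d$ with $\|\mu-\hat\mu\|\leq Kr$.
   Context: Centrality SDP: given $Z_1,\ldots,Z_k,x\in\mathbb{R}^d$ and $r\geq 0$, it is the following semidefinite program over symmetric $(d+k+1)\times(d+k+1)$ matrices with block structure $$Y(B,W,U,b,u) = \begin{pmatrix} 1 & b^\top & u^\top\\ b & B & W\\ u & W^\top & U\end{pmatrix},\qquad B\in\mathbb{R}^{k\times k},\ W\in\mathbb{R}^{k\times d},\ U\in\mathbb{R}^{d\times d},\ b\in\mathbb{R}^k,\ u\in\mathbb{R}^d:$$ maximize $\frac1k\sum_{i=1}^k b_i$ subject to $B_{ii}\leq 1$ for $i=1,\ldots,k$; $\operatorname{Tr}U\leq 1$; $\langle Z_i - x, W_i\rangle \geq r\cdot b_i$ for $i=1,\ldots,k$, where $W_i$ is the $i$-th row of $W$; and $Y(B,W,U,b,u)\succeq 0$. Certifiable centrality: for $r>0$ and $p\in[0,1]$, $x\in\mathbb{R}^d$ is certifiably $(r,p)$-central with respect to $Z_1,\ldots,Z_k$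 if the optimum value of the centrality SDP with parameters $Z_1,\ldots,Z_k,x,r$ is at most $p$. The algorithm (called median-sdp in the paper) knows $d,k,C,r$ but not $\mu$. *)

theory Defs
  imports "Jordan_Normal_Form.Matrix" "HOL-Library.Extended_Real"
begin

section \<open>Certifiable centrality\<close>

text \<open>Points of \<open>\<real>\<^sup>d\<close> are elements of \<^term>\<open>carrier_vec d\<close>, and a \<open>k\<close>-tuple of points is
  a function on indices of which only the values at \<open>0, \<dots>, k - 1\<close> matter.\<close>

definition vnorm :: "real vec \<Rightarrow> real" where
  "vnorm v = sqrt (v \<bullet> v)"

definition mat_trace :: "real mat \<Rightarrow> real" where
  "mat_trace A = (\<Sum>i<dim_row A. A $$ (i, i))"

definition psd :: "nat \<Rightarrow> real mat \<Rightarrow> bool" where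
  "psd n A \<longleftrightarrow> A \<in> carrier_mat n n \<and> transpose_mat A = A \<and>
     (\<forall>v \<in> carrier_vec n. 0 \<le> v \<bullet> (A *\<^sub>v v))"

definition sdp_matrix ::
    "real mat \<Rightarrow> real mat \<Rightarrow> real mat \<Rightarrow> real vec \<Rightarrow> real vec \<Rightarrow> real mat" where
  "sdp_matrix B W U b u =
     four_block_mat
       (1\<^sub>m 1)                                 (mat_of_row (b @\<^sub>v u))
       (transpose_mat (mat_of_row (b @\<^sub>v u))) (four_block_mat B W (transpose_mat W) U)"

definition sdp_feasible :: "nat \<Rightarrow> nat \<Rightarrow> (nat \<Rightarrow> real vec) \<Rightarrow> real vec \<Rightarrow> real \<Rightarrow>
    real mat \<Rightarrow> real mat \<Rightarrow> real mat \<Rightarrow> real vec \<Rightarrow> real vec \<Rightarrow> bool" where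
  "sdp_feasible d k Z x r B W U b u \<longleftrightarrow>
     B \<in> carrier_mat k k \<and> W \<in> carrier_mat k d \<and> U \<in> carrier_mat d d \<and>
     b \<in> carrier_vec k \<and> u \<in> carrier_vec d \<and>
     (\<forall>i<k. B $$ (i, i) \<le> 1) \<and>
     mat_trace U \<le> 1 \<and>
     (\<forall>i<k. (Z i - x) \<bullet> row W i \<ge> r * b $ i) \<and>
     psd (d + k + 1) (sdp_matrix B W U b u)"

text \<open>The value is an extended real, so that the supremum carries no side condition.\<close>

definition sdp_value :: "nat \<Rightarrow> nat \<Rightarrow> (nat \<Rightarrow> real vec) \<Rightarrow> real vec \<Rightarrow> real \<Rightarrow> ereal" where
  "sdp_value d k Z x r =
     Sup {ereal (1 / real k * (\<Sum>i<k. b $ i)) | B W U b u. sdp_feasible d k Z x r B W U b u}"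

definition certifiably_central ::
    "nat \<Rightarrow> nat \<Rightarrow> (nat \<Rightarrow> real vec) \<Rightarrow> real \<Rightarrow> real \<Rightarrow> real vec \<Rightarrow> bool" where
  "certifiably_central d k Z r p x \<longleftrightarrow> sdp_value d k Z x r \<le> ereal p"

section \<open>Real-number algorithms and their running time\<close>

text \<open>Algorithms are programs of a real random-access machine with exact, unit-cost real
  arithmetic. A state consists of natural-number registers (for counting and addressing), real
  registers, and a real memory addressed through the natural-number registers. Each elementary
  step and each test costs one time unit. There is no
  rounding of reals, and natural-number registers admit only addition and truncated subtraction,
  since unit-cost rounding or integer multiplication would be unrealistically powerful. The
  only constants in a program are natural numbers, so that no information can be hidden in a real
  constant. Division of reals by zero gives \<open>0\<close>, as in HOL.\<close>

record state =
  idx :: "nat \<Rightarrow> nat"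
  reg :: "nat \<Rightarrow> real"
  mem :: "nat \<Rightarrow> real"

datatype instr =
    NConst nat nat
  | NAdd nat nat nat
  | NSub nat nat nat
  | RCast nat nat
  | RAdd nat nat nat
  | RSub nat nat nat
  | RMul nat nat nat
  | RDiv nat nat nat
  | RLoad nat nat
  | RStore nat nat

fun step :: "instr \<Rightarrow> state \<Rightarrow> state" where
  "step (NConst a n) s = s\<lparr>idx := (idx s)(a := n)\<rparr>"
| "step (NAdd a b c) s = s\<lparr>idx := (idx s)(a := idx s b + idx s c)\<rparr>"
| "step (NSub a b c) s = s\<lparr>idx := (idx s)(a := idx s b - idx s c)\<rparr>"
| "step (RCast a b) s = s\<lparr>reg := (reg s)(a := real (idx s b))\<rparr>"
| "step (RAdd a b c) s = s\<lparr>reg := (reg s)(a := reg s b + reg s c)\<rparr>"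
| "step (RSub a b c) s = s\<lparr>reg := (reg s)(a := reg s b - reg s c)\<rparr>"
| "step (RMul a b c) s = s\<lparr>reg := (reg s)(a := reg s b * reg s c)\<rparr>"
| "step (RDiv a b c) s = s\<lparr>reg := (reg s)(a := reg s b / reg s c)\<rparr>"
| "step (RLoad a b) s = s\<lparr>reg := (reg s)(a := mem s (idx s b))\<rparr>"
| "step (RStore a b) s = s\<lparr>mem := (mem s)(idx s a := reg s b)\<rparr>"

datatype test =
    NLess nat nat
  | NLe nat nat
  | RLess nat nat
  | RLe nat nat

fun holds :: "test \<Rightarrow> state \<Rightarrow> bool" where
  "holds (NLess a b) s \<longleftrightarrow> idx s a < idx s b"
| "holds (NLe a b) s \<longleftrightarrow> idx s a \<le> idx s b"
| "holds (RLess a b) s \<longleftrightarrow> reg s a < reg s b"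
| "holds (RLe a b) s \<longleftrightarrow> reg s a \<le> reg s b"

datatype program =
    Skip
  | Do instr
  | Seq program program
  | Cond test program program
  | Loop test program

text \<open>\<open>exec P s t s'\<close>: started in \<open>s\<close>, the program \<open>P\<close> halts in \<open>s'\<close> after exactly \<open>t\<close> time units.\<close>

inductive exec :: "program \<Rightarrow> state \<Rightarrow> nat \<Rightarrow> state \<Rightarrow> bool" where
  exec_Skip: "exec Skip s 1 s"
| exec_Do: "exec (Do i) s 1 (step i s)"
| exec_Seq: "exec P s t s' \<Longrightarrow> exec Q s' t' s'' \<Longrightarrow> exec (Seq P Q) s (t + t') s''"
| exec_Cond_True: "holds c s \<Longrightarrow> exec P s t s' \<Longrightarrow> exec (Cond c P Q) s (1 + t) s'"
| exec_Cond_False: "\<not> holds c s \<Longrightarrow> exec Q s t s' \<Longrightarrow> exec (Cond c P Q) s (1 + t) s'"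
| exec_Loop_False: "\<not> holds c s \<Longrightarrow> exec (Loop c P) s 1 s"
| exec_Loop_True: "holds c s \<Longrightarrow> exec P s t s' \<Longrightarrow> exec (Loop c P) s' t' s'' \<Longrightarrow>
    exec (Loop c P) s (1 + t + t') s''"

lemma exec_deterministic:
  "exec P s t s' \<Longrightarrow> exec P s u s'' \<Longrightarrow> u = t \<and> s'' = s'"
proof (induction arbitrary: u s'' rule: exec.induct)
  case (exec_Skip s)
  then show ?case by cases simp
next
  case (exec_Do i s)
  then show ?case by cases simp
next
  case (exec_Seq P s t s' Q t' s1)
  from exec_Seq.prems show ?case
    by cases (metis exec_Seq.IH)
next
  case (exec_Cond_True c s P t s' Q)
  from exec_Cond_True.prems exec_Cond_True.hyps(1) show ?case
    by cases (simp_all add: exec_Cond_True.IH)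
next
  case (exec_Cond_False c s Q t s' P)
  from exec_Cond_False.prems exec_Cond_False.hyps(1) show ?case
    by cases (simp_all add: exec_Cond_False.IH)
next
  case (exec_Loop_False c s P)
  from exec_Loop_False.prems exec_Loop_False.hyps(1) show ?case
    by cases simp_all
next
  case (exec_Loop_True c s P t s' t' s1)
  from exec_Loop_True.prems show ?case
  proof cases
    case exec_Loop_False
    with exec_Loop_True.hyps(1) show ?thesis by simp
  next
    case (exec_Loop_True v s2 w)
    then show ?thesis using exec_Loop_True.IH by metis
  qed
qed

text \<open>The parameters \<open>d, k\<close> and \<open>C, r\<close> are handed over in registers, the points row by row in the
  memory; the output is the initial segment of length \<open>d\<close> of the final memory.\<close>

definition input_state ::
    "nat \<Rightarrow> nat \<Rightarrow> real \<Rightarrow> real \<Rightarrow> (nat \<Rightarrow> real vec) \<Rightarrow> state" where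
  "input_state d k C r Z =
     \<lparr>idx = (\<lambda>_. 0)(0 := d, 1 := k),
      reg = (\<lambda>_. 0)(0 := C, 1 := r),
      mem = (\<lambda>n. if n < k * d then Z (n div d) $ (n mod d) else 0)\<rparr>"

definition output_point :: "nat \<Rightarrow> state \<Rightarrow> real vec" where
  "output_point d s = vec d (mem s)"

end

theory Submission
  imports Defs
begin

text \<open>
  The algorithm is a spectral filter. Certifiable centrality enters through the analysis of the filter,
  by way of feasible points of the semidefinite program, whose value it bounds.

  \<^bold>\<open>What centrality gives.\<close> Let \<open>Q\<close> be a positive semidefinite form on \<open>\<real>\<^sup>d\<close> of trace at most \<open>1\<close>, and let
  \<open>S\<close> be the set of all \<open>i\<close> with \<open>Q (Z\<^sub>i - \<mu>) \<ge> r\<^sup>2\<close>. In the inner product \<open>Q\<close>, scale the vectors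
  \<open>Z\<^sub>i - \<mu>\<close>, \<open>i \<in> S\<close>, to a common length and add to each a multiple of one further orthogonal unit
  vector. Their Gram matrix is a feasible point of value proportional to \<open>card S / k\<close>, so
  \<open>card S \<le> k / 60\<close>: with respect to every such form almost all points are close to \<open>\<mu>\<close>
  (\<open>central_imp_few_far_points\<close>).

  \<^bold>\<open>The filter.\<close> Every point carries a weight, initially \<open>1\<close>. A round translates the weighted mean to
  \<open>0\<close>, forms the scatter operator \<open>A x = (\<Sum>i. w\<^sub>i \<langle>z\<^sub>i, x\<rangle> z\<^sub>i)\<close> and uses the form \<open>Q\<close> of
  \<open>A\<^sup>d / tr A\<^sup>d\<close>. This form replaces a leading eigenvector, needs only rational operations, and is accurate
  enough because \<open>d\<close> is smaller than \<open>2\<^sup>d\<close>. If the weighted average of \<open>Q z\<^sub>i\<close> is larger than \<open>100 r\<^sup>2\<close>,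
  then \<open>w\<^sub>i\<close> is multiplied by \<open>1 - Q z\<^sub>i / M\<close>, where \<open>M\<close> is the largest \<open>Q z\<^sub>i\<close> over the positive weights;
  otherwise nothing changes. The sum of the translations is the output.

  \<^bold>\<open>Why little weight is lost.\<close> By a minimax argument there are fixed weights \<open>g\<^sub>i \<in> [0, 1]\<close>, of total
  at least \<open>(1 - 1/60) k\<close>, for which \<open>(\<Sum>i. g\<^sub>i Q (Z\<^sub>i - \<mu>)) \<le> 2 k r\<^sup>2\<close> holds for all forms that occur
  in the run simultaneously (\<open>simultaneous_inlier_weights\<close>); here the first step is applied to
  mixtures of these forms. When the weighted average of \<open>Q z\<^sub>i\<close> is large, at most half of it comes
  from the \<open>g\<close>-part of the weights (\<open>outliers_dominate\<close>). So a round takes away at least as much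
  from the complement of \<open>g\<close>, whose mass is at most \<open>k / 60\<close>, as from \<open>g\<close>, and altogether at most \<open>k / 30\<close>
  is ever removed. Each effective round sets a positive weight to \<open>0\<close>; if all \<open>k\<close> rounds were
  effective, no weight would remain, in contradiction to the bound. So some round leaves the weights
  unchanged, and from then on the state is constant.

  \<^bold>\<open>Why the output is close to \<open>\<mu>\<close>.\<close> The traces of the powers of \<open>A\<close> form a log-convex sequence, and so
  do the values \<open>\<langle>v, A\<^sup>j v\<rangle>\<close>. Hence a small ratio \<open>tr A\<^bsup>d+1\<^esup> / tr A\<^sup>d\<close> bounds \<open>\<langle>v, A v\<rangle>\<close> for every
  unit vector (\<open>trace_ratio_bounds_variance\<close>): in the direction from the weighted mean to \<open>\<mu>\<close> most
  of the weight is within \<open>O(r)\<close> of the mean. Most points are within \<open>r\<close> of \<open>\<mu>\<close> in this direction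
  too, so the mean and \<open>\<mu>\<close> are \<open>O(r)\<close> apart (\<open>centre_of_concentrated_weights\<close>).

  \<^bold>\<open>Running time.\<close> The form \<open>A\<^sup>d\<close> is evaluated at \<open>z\<^sub>i\<close> by applying \<open>A\<close> to the vector \<open>z\<^sub>i\<close> repeatedly, at
  cost \<open>O(k d)\<close> each. A round costs \<open>O(k\<^sup>2 d\<^sup>2)\<close>, and the whole run is within \<open>1000 (d k)\<^sup>3\<close> steps. As
  \<open>ln (C + 2) \<ge> ln 2\<close>, this is of the required form.

  Vectors are functions \<^typ>\<open>nat \<Rightarrow> real\<close> of which only the first \<open>d\<close> values enter, so that the
  dimension can vary and the memory of the machine can be read off as a family of vectors.
\<close>

section \<open>Positive semidefinite forms\<close>

definition ip :: "nat \<Rightarrow> (nat \<Rightarrow> real) \<Rightarrow> (nat \<Rightarrow> real) \<Rightarrow> real" where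
  "ip d x y = (\<Sum>j<d. x j * y j)"

definition axis :: "nat \<Rightarrow> nat \<Rightarrow> real" where
  "axis a = (\<lambda>j. if j = a then 1 else 0)"

text \<open>The discriminant criterion. It gives Cauchy-Schwarz inequalities for single forms and, after
  summation over a basis, for traces.\<close>

lemma square_le_of_nonneg_quadratic:
  fixes a b c :: real
  assumes "\<And>l. 0 \<le> a * l\<^sup>2 + 2 * b * l + c"
  shows "b\<^sup>2 \<le> a * c"
proof (cases "a = 0")
  case True
  have "b = 0"
  proof (rule ccontr)
    assume "b \<noteq> 0"
    then show False
      using assms[of "- (c + 1) / (2 * b)"] True by simp
  qed
  then show ?thesis using True by simp
next
  case False
  have "a \<ge> 0"
  proof (rule ccontr)
    assume "\<not> a \<ge> 0"
    then have a: "a < 0" by simp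
    define l where "l = (2 * \<bar>b\<bar> + \<bar>c\<bar> + 1) / (- a) + 1"
    have l1: "l \<ge> 1" using a unfolding l_def by (simp add: divide_nonneg_neg)
    have al: "a * l = - (2 * \<bar>b\<bar> + \<bar>c\<bar> + 1) + a" using a unfolding l_def by (simp add: field_simps)
    have "a * l\<^sup>2 + 2 * b * l + c \<le> (a * l) * l + 2 * \<bar>b\<bar> * l + \<bar>c\<bar> * l"
    proof -
      have "b * l \<le> \<bar>b\<bar> * l" using l1 by (intro mult_right_mono) auto
      moreover have "c \<le> \<bar>c\<bar> * l" using l1
        using mult_left_mono[OF l1, of "\<bar>c\<bar>"] by simp
      ultimately show ?thesis by (simp add: power2_eq_square)
    qed
    also have "\<dots> = (a - 1) * l" unfolding al by (simp add: algebra_simps)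
    also have "\<dots> < 0" using a l1 by (simp add: mult_neg_pos)
    finally show False using assms[of l] by simp
  qed
  with False have a: "a > 0" by simp
  have "0 \<le> a * (a * (- b / a)\<^sup>2 + 2 * b * (- b / a) + c)"
    using assms[of "- b / a"] a by (intro mult_nonneg_nonneg) auto
  also have "\<dots> = a * c - b\<^sup>2" using a by (simp add: field_simps power2_eq_square)
  finally show ?thesis by simp
qed

text \<open>The forms are abstract bilinear maps and not matrices: the inner product, the powers of the scatter
  operator, rank-one forms and mixtures of forms are all instances. The congruence axiom is what ties
  a form to dimension \<open>d\<close>.\<close>

locale psd_bilinear =
  fixes d :: nat and Q :: "(nat \<Rightarrow> real) \<Rightarrow> (nat \<Rightarrow> real) \<Rightarrow> real"
  assumes add: "Q (\<lambda>j. x j + y j) z = Q x z + Q y z"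
    and scale: "Q (\<lambda>j. c * x j) z = c * Q x z"
    and sym: "Q x y = Q y x"
    and nonneg: "0 \<le> Q x x"
    and cong: "(\<And>j. j < d \<Longrightarrow> x j = y j) \<Longrightarrow> Q x z = Q y z"
begin

lemma add2: "Q z (\<lambda>j. x j + y j) = Q z x + Q z y"
  by (metis add sym)

lemma scale2: "Q z (\<lambda>j. c * x j) = c * Q z x"
  by (metis scale sym)

lemma sum_left: "finite I \<Longrightarrow> Q (\<lambda>j. \<Sum>i\<in>I. c i * x i j) z = (\<Sum>i\<in>I. c i * Q (x i) z)"
proof (induction I rule: finite_induct)
  case empty
  show ?case using scale[of 0 "\<lambda>_. 0" z] by simp
next
  case (insert i I)
  then show ?case by (simp add: add scale)
qed

lemma sum_right: "finite I \<Longrightarrow> Q z (\<lambda>j. \<Sum>i\<in>I. c i * x i j) = (\<Sum>i\<in>I. c i * Q z (x i))"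
  using sum_left[of I c x z] by (simp add: sym)

lemma add_square: "Q (\<lambda>j. x j + y j) (\<lambda>j. x j + y j) = Q x x + 2 * Q x y + Q y y"
  by (simp add: add add2 sym[of y x])

lemma add_square_le: "Q (\<lambda>j. x j + y j) (\<lambda>j. x j + y j) \<le> 2 * Q x x + 2 * Q y y"
proof -
  have "0 \<le> Q (\<lambda>j. x j + (-1) * y j) (\<lambda>j. x j + (-1) * y j)" by (rule nonneg)
  then show ?thesis unfolding add_square by (simp only: scale scale2)
qed

text \<open>Jensen's inequality for the convex function \<open>x \<mapsto> Q x x\<close> with unnormalised weights: expand the
  weighted sum of the squares of \<open>C x\<^sub>i - X\<close>, where \<open>C\<close> is the total weight and \<open>X\<close> the weighted sum
  of the vectors.\<close>

lemma sum_square_le: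
  assumes "finite I" "\<And>i. i \<in> I \<Longrightarrow> 0 \<le> c i"
  shows "Q (\<lambda>j. \<Sum>i\<in>I. c i * x i j) (\<lambda>j. \<Sum>i\<in>I. c i * x i j)
    \<le> (\<Sum>i\<in>I. c i) * (\<Sum>i\<in>I. c i * Q (x i) (x i))"
proof (cases "(\<Sum>i\<in>I. c i) = 0")
  case True
  then have "\<forall>i\<in>I. c i = 0" using assms by (simp add: sum_nonneg_eq_0_iff)
  then show ?thesis
      using assms(1) scale[of 0 "\<lambda>_. 0" "\<lambda>_. 0"] by simp
next
  case False
  define C where "C = (\<Sum>i\<in>I. c i)"
  define X where "X = (\<lambda>j. \<Sum>i\<in>I. c i * x i j)"
  have C: "C > 0" using False assms by (simp add: C_def sum_nonneg less_le)
  have QX: "(\<Sum>i\<in>I. c i * Q (x i) X) = Q X X"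
    unfolding X_def using sum_left[OF assms(1)] by metis
  have "0 \<le> (\<Sum>i\<in>I. c i * Q (\<lambda>j. C * x i j + (-1) * X j) (\<lambda>j. C * x i j + (-1) * X j))"
    by (intro sum_nonneg mult_nonneg_nonneg assms nonneg)
  also have "\<dots> = (\<Sum>i\<in>I. C\<^sup>2 * (c i * Q (x i) (x i)) - 2 * C * (c i * Q (x i) X) + c i * Q X X)"
    by (rule sum.cong[OF refl], simp only: add_square)
       (simp only: scale scale2, simp add: algebra_simps power2_eq_square)
  also have "\<dots> = C\<^sup>2 * (\<Sum>i\<in>I. c i * Q (x i) (x i)) - 2 * C * Q X X + C * Q X X"
    by (simp add: sum.distrib sum_subtractf QX C_def flip: sum_distrib_left sum_distrib_right)
  also have "\<dots> = C * (C * (\<Sum>i\<in>I. c i * Q (x i) (x i)) - Q X X)"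
    by (simp add: algebra_simps power2_eq_square)
  finally have "0 \<le> C * (\<Sum>i\<in>I. c i * Q (x i) (x i)) - Q X X"
    using C by (simp add: zero_le_mult_iff)
  then show ?thesis by (simp add: C_def X_def)
qed

lemma expand: "Q x y = (\<Sum>a<d. x a * Q (axis a) y)"
proof -
  have "Q x y = Q (\<lambda>j. \<Sum>a<d. x a * axis a j) y"
  proof (rule cong)
    fix j assume "j < d"
    then show "x j = (\<Sum>a<d. x a * axis a j)"
      by (simp add: axis_def if_distrib[of "\<lambda>u. _ * u"] sum.delta cong: if_cong)
  qed
  then show ?thesis by (simp add: sum_left)
qed

definition trace :: real where
  "trace = (\<Sum>a<d. Q (axis a) (axis a))"

lemma trace_nonneg: "0 \<le> trace"
  unfolding trace_def by (intro sum_nonneg nonneg)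

text \<open>Jensen's inequality for the decomposition
  \<open>x = (\<Sum>a. x\<^sub>a\<^sup>2 (e\<^sub>a / x\<^sub>a))\<close>, in which the coordinates equal to \<open>0\<close> drop out because \<open>x / 0 = 0\<close>.\<close>

lemma le_trace: "Q x x \<le> trace * ip d x x"
proof -
  define y where "y = (\<lambda>a. \<lambda>j. (1 / x a) * axis a j)"
  have eq: "Q x z = Q (\<lambda>j. \<Sum>a<d. (x a)\<^sup>2 * y a j) z" for z
  proof (rule cong)
    fix j assume "j < d"
    have "(\<Sum>a<d. (x a)\<^sup>2 * y a j) = (\<Sum>a<d. if a = j then x a else 0)"
      by (rule sum.cong) (auto simp: y_def axis_def power2_eq_square)
    then show "x j = (\<Sum>a<d. (x a)\<^sup>2 * y a j)" using \<open>j < d\<close> by simp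
  qed
  have "Q x x = Q (\<lambda>j. \<Sum>a<d. (x a)\<^sup>2 * y a j) (\<lambda>j. \<Sum>a<d. (x a)\<^sup>2 * y a j)"
    using eq sym by metis
  also have "\<dots> \<le> (\<Sum>a<d. (x a)\<^sup>2) * (\<Sum>a<d. (x a)\<^sup>2 * Q (y a) (y a))"
    by (rule sum_square_le) auto
  also have "\<dots> \<le> (\<Sum>a<d. (x a)\<^sup>2) * (\<Sum>a<d. Q (axis a) (axis a))"
  proof (intro mult_left_mono sum_mono)
    fix a
    show "(x a)\<^sup>2 * Q (y a) (y a) \<le> Q (axis a) (axis a)"
      unfolding y_def scale scale2 using nonneg[of "axis a"]
      by (cases "x a = 0") (auto simp: power2_eq_square)
  qed (auto intro: sum_nonneg)
  finally show ?thesis by (simp add: trace_def ip_def power2_eq_square mult.commute)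
qed

end

lemma (in psd_bilinear) zero_left [simp]: "Q (\<lambda>_. 0) y = 0"
  using scale[of 0 "\<lambda>_. 0" y] by simp

lemma (in psd_bilinear) zero_right [simp]: "Q y (\<lambda>_. 0) = 0"
  using sym[of y "\<lambda>_. 0"] by simp

lemma psd_bilinear_ip: "psd_bilinear d (ip d)"
  by unfold_locales
     (auto simp: ip_def algebra_simps sum.distrib sum_distrib_left intro!: sum_nonneg sum.cong)

lemma ip_axis: "a < d \<Longrightarrow> ip d (axis a) x = x a"
  by (simp add: ip_def axis_def if_distrib[of "\<lambda>u. u * _"] sum.delta cong: if_cong)

lemma psd_bilinear_combination:
  assumes "finite I" "\<And>i. i \<in> I \<Longrightarrow> psd_bilinear d (Q i)" "\<And>i. i \<in> I \<Longrightarrow> 0 \<le> c i"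
  shows "psd_bilinear d (\<lambda>x y. \<Sum>i\<in>I. c i * Q i x y)"
proof
  fix x y z :: "nat \<Rightarrow> real" and b :: real
  show "(\<Sum>i\<in>I. c i * Q i (\<lambda>j. x j + y j) z) = (\<Sum>i\<in>I. c i * Q i x z) + (\<Sum>i\<in>I. c i * Q i y z)"
    using psd_bilinear.add[OF assms(2)] by (simp add: algebra_simps sum.distrib)
  show "(\<Sum>i\<in>I. c i * Q i (\<lambda>j. b * x j) z) = b * (\<Sum>i\<in>I. c i * Q i x z)"
    using psd_bilinear.scale[OF assms(2)] by (simp add: algebra_simps sum_distrib_left)
  show "(\<Sum>i\<in>I. c i * Q i x y) = (\<Sum>i\<in>I. c i * Q i y x)"
    using psd_bilinear.sym[OF assms(2)] by (intro sum.cong) auto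
  show "0 \<le> (\<Sum>i\<in>I. c i * Q i x x)"
    using psd_bilinear.nonneg[OF assms(2)] assms(3) by (intro sum_nonneg) auto
  show "(\<Sum>i\<in>I. c i * Q i x z) = (\<Sum>i\<in>I. c i * Q i y z)" if "\<And>j. j < d \<Longrightarrow> x j = y j"
    using psd_bilinear.cong[OF assms(2) that] by (intro sum.cong) auto
qed

lemma trace_combination:
  assumes "finite I" "\<And>i. i \<in> I \<Longrightarrow> psd_bilinear d (Q i)" "\<And>i. i \<in> I \<Longrightarrow> 0 \<le> c i"
  shows "psd_bilinear.trace d (\<lambda>x y. \<Sum>i\<in>I. c i * Q i x y)
    = (\<Sum>i\<in>I. c i * psd_bilinear.trace d (Q i))"
proof -
  have "(\<Sum>i\<in>I. c i * psd_bilinear.trace d (Q i)) = (\<Sum>i\<in>I. c i * (\<Sum>a<d. Q i (axis a) (axis a)))"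
    using assms(2) by (intro sum.cong) (auto simp: psd_bilinear.trace_def)
  also have "\<dots> = (\<Sum>a<d. \<Sum>i\<in>I. c i * Q i (axis a) (axis a))"
    by (simp add: sum_distrib_left sum.swap[of _ "{..<d}"])
  finally show ?thesis
    by (simp add: psd_bilinear.trace_def[OF psd_bilinear_combination[OF assms]])
qed

section \<open>Forms tested by a certifiably central point\<close>

text \<open>The entries are the inner products of the vectors \<open>(f\<^sub>p, G\<^sub>p)\<close> in the orthogonal sum of \<open>\<real>\<close> and the
  space with the inner product \<open>Q\<close>.\<close>

lemma (in psd_bilinear) gram_psd:
  fixes f :: "nat \<Rightarrow> real" and G :: "nat \<Rightarrow> nat \<Rightarrow> real"
  shows "psd n (mat n n (\<lambda>(p, q). f p * f q + Q (G p) (G q)))" (is "psd n ?Y")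
  unfolding psd_def
proof (intro conjI ballI)
  show "?Y\<^sup>T = ?Y" by (rule eq_matI) (simp_all add: sym mult.commute)
  fix v :: "real vec" assume v: "v \<in> carrier_vec n"
  have "v \<bullet> (?Y *\<^sub>v v) = (\<Sum>p<n. v $ p * (\<Sum>q<n. (f p * f q + Q (G p) (G q)) * v $ q))"
    using v by (simp add: scalar_prod_def lessThan_atLeast0)
  also have "\<dots> = (\<Sum>p<n. v $ p * f p * (\<Sum>q<n. v $ q * f q)) + (\<Sum>p<n. v $ p * (\<Sum>q<n. v $ q * Q (G p) (G q)))"
    by (simp add: sum_distrib_left algebra_simps flip: sum.distrib)
  also have "(\<Sum>p<n. v $ p * f p * (\<Sum>q<n. v $ q * f q)) = (\<Sum>p<n. v $ p * f p)\<^sup>2"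
    by (simp add: power2_eq_square sum_distrib_right)
  also have "(\<Sum>p<n. v $ p * (\<Sum>q<n. v $ q * Q (G p) (G q)))
      = Q (\<lambda>j. \<Sum>p<n. v $ p * G p j) (\<lambda>j. \<Sum>q<n. v $ q * G q j)"
    by (simp add: sum_left sum_right)
  also have "0 \<le> (\<Sum>p<n. v $ p * f p)\<^sup>2 + \<dots>" by (intro add_nonneg_nonneg nonneg) simp
  finally show "0 \<le> v \<bullet> (?Y *\<^sub>v v)" .
qed simp

text \<open>The optimum of the program bounds the number of far points, since these yield a feasible point: the
  vector of the point \<open>i \<in> S\<close> has the component \<open>3/5\<close> along the vector of the constant \<open>1\<close> and a component
  of \<open>Q\<close>-length \<open>4/5\<close> in the direction of \<open>Z\<^sub>i - \<mu>\<close>, so it has length \<open>1\<close>. Its correlation with \<open>Z\<^sub>i - \<mu>\<close>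
  is \<open>4/5\<close> times the \<open>Q\<close>-length of \<open>Z\<^sub>i - \<mu>\<close>, hence at least \<open>r\<close> times \<open>3/5\<close>. The value is
  \<open>3/5 (card S / k)\<close>.\<close>

lemma central_imp_few_far_points:
  assumes central: "certifiably_central d k Z r (1/100) \<mu>"
    and k: "1 \<le> k" and r: "0 < r"
    and Z: "\<forall>i<k. Z i \<in> carrier_vec d" and \<mu>: "\<mu> \<in> carrier_vec d"
    and "psd_bilinear d Q" and trace: "psd_bilinear.trace d Q \<le> 1"
    and h: "\<And>i j. i < k \<Longrightarrow> j < d \<Longrightarrow> h i j = Z i $ j - \<mu> $ j"
  shows "60 * card {i. i < k \<and> r\<^sup>2 \<le> Q (h i) (h i)} \<le> k"
proof -
  interpret psd_bilinear d Q by fact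
  define S where "S = {i. i < k \<and> r\<^sup>2 \<le> Q (h i) (h i)}"
  define n where "n i = sqrt (Q (h i) (h i))" for i
  define \<beta> where "\<beta> i = (if i \<in> S then 3/5 else 0 :: real)" for i
  define \<gamma> where "\<gamma> i = (if i \<in> S then 4/5 / n i else 0)" for i
  define g where "g i = (\<lambda>j. \<gamma> i * h i j)" for i
  define B where "B = mat k k (\<lambda>(i, j). \<beta> i * \<beta> j + Q (g i) (g j))"
  define W where "W = mat k d (\<lambda>(i, a). Q (axis a) (g i))"
  define U where "U = mat d d (\<lambda>(a, b). Q (axis a) (axis b))"
  define f where "f p = (if p = 0 then 1 else if p < k + 1 then \<beta> (p - 1) else 0)" for p
  define G where "G p = (if p = 0 then (\<lambda>_. 0) else if p < k + 1 then g (p - 1) else axis (p - (k + 1)))" for p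
  have n: "n i \<ge> r" "n i > 0" "n i * n i = Q (h i) (h i)" if "i \<in> S" for i
  proof -
    show "n i \<ge> r" using that r by (auto simp: n_def S_def real_le_rsqrt)
    then show "n i > 0" using r by simp
    show "n i * n i = Q (h i) (h i)" by (simp add: n_def nonneg)
  qed
  have \<gamma>: "\<gamma> i * Q (h i) (h i) = 4/5 * n i" "\<gamma> i * (\<gamma> i * Q (h i) (h i)) = 16/25" if "i \<in> S" for i
    using n(2)[OF that] that by (simp_all add: \<gamma>_def n(3)[OF that, symmetric])
  have \<gamma>0: "\<gamma> i = 0" "\<beta> i = 0" if "i \<notin> S" for i
    using that by (simp_all add: \<gamma>_def \<beta>_def)
  have \<beta>: "\<beta> i = 3/5" if "i \<in> S" for i
    using that by (simp add: \<beta>_def)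
  \<comment> \<open>The three blocks of indices belong to the constant 1, the points and the coordinates.\<close>
  have Y: "sdp_matrix B W U (vec k \<beta>) (0\<^sub>v d) = mat (d + k + 1) (d + k + 1) (\<lambda>(p, q). f p * f q + Q (G p) (G q))"
    unfolding sdp_matrix_def
  proof (rule eq_matI)
    fix p q assume "p < dim_row (mat (d + k + 1) (d + k + 1) (\<lambda>(p, q). f p * f q + Q (G p) (G q)))"
      and "q < dim_col (mat (d + k + 1) (d + k + 1) (\<lambda>(p, q). f p * f q + Q (G p) (G q)))"
    then have pq: "p < d + k + 1" "q < d + k + 1" by auto
    have cases: "p = 0 \<or> (\<exists>i<k. p = Suc i) \<or> (\<exists>a<d. p = Suc (k + a))" if "p < d + k + 1" for p
    proof -
      have "p = 0 \<or> (p - 1 < k \<and> p = Suc (p - 1)) \<or> (p - 1 - k < d \<and> p = Suc (k + (p - 1 - k)))"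
        using that by linarith
      then show ?thesis by blast
    qed
    have sg: "Q (g i) (axis a) = Q (axis a) (g i)" for i a by (rule sym)
    have f: "f 0 = 1" "i < k \<Longrightarrow> f (Suc i) = \<beta> i" "f (Suc (k + i)) = 0" for i
      by (simp_all add: f_def)
    have G: "G 0 = (\<lambda>_. 0)" "i < k \<Longrightarrow> G (Suc i) = g i" "G (Suc (k + i)) = axis i" for i
      by (simp_all add: G_def)
    show "four_block_mat (1\<^sub>m 1) (mat_of_row (vec k \<beta> @\<^sub>v 0\<^sub>v d))
        (mat_of_row (vec k \<beta> @\<^sub>v 0\<^sub>v d))\<^sup>T (four_block_mat B W W\<^sup>T U) $$ (p, q)
      = mat (d + k + 1) (d + k + 1) (\<lambda>(p, q). f p * f q + Q (G p) (G q)) $$ (p, q)"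
      using cases[OF pq(1)] cases[OF pq(2)] pq
      by (elim disjE exE conjE; simp add: B_def W_def U_def f G mat_of_row_def sg)
  qed (simp_all add: B_def W_def U_def)
  have "sdp_feasible d k Z \<mu> r B W U (vec k \<beta>) (0\<^sub>v d)"
    unfolding sdp_feasible_def
  proof (intro conjI allI impI)
    show "psd (d + k + 1) (sdp_matrix B W U (vec k \<beta>) (0\<^sub>v d))"
      unfolding Y by (rule gram_psd)
    show "mat_trace U \<le> 1"
      using trace by (simp add: mat_trace_def U_def trace_def)
    fix i assume i: "i < k"
    have Bii: "B $$ (i, i) = \<beta> i * \<beta> i + \<gamma> i * (\<gamma> i * Q (h i) (h i))"
      using i by (simp add: B_def g_def scale scale2)
    show "B $$ (i, i) \<le> 1"
    proof (cases "i \<in> S")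
      case True
      show ?thesis unfolding Bii \<gamma>(2)[OF True] \<beta>[OF True] by simp
    next
      case False
      show ?thesis unfolding Bii \<gamma>0[OF False] by simp
    qed
    have "(Z i - \<mu>) \<bullet> row W i = (\<Sum>a<d. h i a * Q (axis a) (g i))"
      using i Z \<mu> by (auto simp: scalar_prod_def W_def h lessThan_atLeast0 intro!: sum.cong)
    also have "\<dots> = Q (h i) (g i)" by (simp flip: expand)
    also have "\<dots> = (if i \<in> S then 4/5 * n i else 0)"
      unfolding g_def scale2 by (simp add: \<gamma> \<gamma>0)
    also have "\<dots> \<ge> r * (vec k \<beta> $ i)"
    proof (cases "i \<in> S")
      case True
      then show ?thesis using i n(1)[OF True] r by (simp add: \<beta>)
    qed (use i in \<open>simp add: \<gamma>0\<close>)
    finally show "(Z i - \<mu>) \<bullet> row W i \<ge> r * (vec k \<beta> $ i)" .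
  qed (simp_all add: B_def W_def U_def)
  then have "ereal (1 / real k * (\<Sum>i<k. vec k \<beta> $ i)) \<le> sdp_value d k Z \<mu> r"
    unfolding sdp_value_def by (intro Sup_upper) blast
  also have "\<dots> \<le> ereal (1/100)" using central by (simp add: certifiably_central_def)
  finally have "(\<Sum>i<k. \<beta> i) \<le> k / 100" using k by (simp add: field_simps)
  moreover have "(\<Sum>i<k. \<beta> i) = 3/5 * card S"
  proof -
    have "(\<Sum>i<k. \<beta> i) = (\<Sum>i\<in>S. 3/5)"
      by (rule sum.mono_neutral_cong_right) (auto simp: \<beta>_def S_def)
    then show ?thesis by simp
  qed
  ultimately have "60 * card S \<le> k" by linarith
  then show ?thesis by (simp add: S_def)
qed

section \<open>Weights that are good for finitely many forms\<close>

text \<open>If every mixture of finitely many nonnegative losses is below \<open>R\<close> at all but at most \<open>\<delta>\<close> points,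
  then one choice of weights works for all losses at once. This is a minimax statement, proved by
  minimising the total squared excess \<open>F\<close> over the convex set \<open>S\<close> of weights: if \<open>F w > 0\<close>, the mixture
  in proportion to the excesses at \<open>w\<close> yields 0/1 weights \<open>u\<close> with a smaller loss, and a move from \<open>w\<close>
  towards \<open>u\<close> decreases \<open>F\<close>. The quantitative form of this decrease forces the infimum
  to be \<open>0\<close>, and the factor \<open>2\<close> in the conclusion pays for an approximate minimiser.\<close>

lemma simultaneous_inlier_weights:
  fixes a :: "nat \<Rightarrow> nat \<Rightarrow> real" and R \<delta> :: real
  assumes a: "\<And>t i. t < T \<Longrightarrow> i < k \<Longrightarrow> 0 \<le> a t i" and R: "0 < R" and k: "1 \<le> k" and "0 \<le> \<delta>"
    and mixture: "\<And>c. (\<And>t. t < T \<Longrightarrow> 0 \<le> c t) \<Longrightarrow> (\<Sum>t<T. c t) = 1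
      \<Longrightarrow> card {i. i < k \<and> R \<le> (\<Sum>t<T. c t * a t i)} \<le> \<delta>"
  shows "\<exists>w. (\<forall>i<k. 0 \<le> w i \<and> w i \<le> 1) \<and> (\<Sum>i<k. 1 - w i) \<le> \<delta> \<and> (\<forall>t<T. (\<Sum>i<k. w i * a t i) \<le> 2 * (k * R))"
proof -
  define S where "S = {w. (\<forall>i<k. 0 \<le> w i \<and> w i \<le> (1::real)) \<and> (\<Sum>i<k. 1 - w i) \<le> \<delta>}"
  define L where "L w t = (\<Sum>i<k. w i * a t i)" for w t
  define e where "e w t = max 0 (L w t - k * R)" for w t
  define F where "F w = (\<Sum>t<T. (e w t)\<^sup>2)" for w
  define H where "H = (\<Sum>t<T. (\<Sum>i<k. a t i)\<^sup>2)"
  have F_nonneg: "0 \<le> F w" for w by (simp add: F_def sum_nonneg)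
  have H_nonneg: "0 \<le> H" by (simp add: H_def sum_nonneg)
  have S1: "(\<lambda>_. 1) \<in> S" using \<open>0 \<le> \<delta>\<close> by (simp add: S_def)
  \<comment> \<open>H bounds the second-order term of F along the segment from w to u.\<close>
  have descent: "\<exists>w'\<in>S. F w' \<le> F w * (1 - 2 * s) + s\<^sup>2 * H" if w: "w \<in> S" and s: "0 \<le> s" "s \<le> 1" for w s
  proof (cases "(\<Sum>t<T. e w t) = 0")
    case True
    then have "\<forall>t<T. e w t = 0" by (subst (asm) sum_nonneg_eq_0_iff) (auto simp: e_def)
    then have "F w = 0" by (simp add: F_def)
    then show ?thesis using w H_nonneg by (intro bexI[of _ w]) auto
  next
    case False
    define C where "C = (\<Sum>t<T. e w t)"
    have e_nonneg: "0 \<le> e w t" for t by (simp add: e_def)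
    have C: "0 < C" using False by (simp add: C_def less_le sum_nonneg e_nonneg)
    define c where "c t = e w t / C" for t
    have e_c: "e w t = C * c t" for t using C by (simp add: c_def)
    define far where "far = {i. i < k \<and> R \<le> (\<Sum>t<T. c t * a t i)}"
    define u where "u i = (if i \<in> far then 0 else 1 :: real)" for i
    define w' where "w' i = w i + s * (u i - w i)" for i
    have "(\<Sum>t<T. c t) = C / C" unfolding c_def C_def by (rule sum_divide_distrib[symmetric])
    then have "(\<Sum>t<T. c t) = 1" using C by simp
    then have "card far \<le> \<delta>" unfolding far_def
      using C e_nonneg by (intro mixture) (simp_all add: c_def)
    moreover have "(\<Sum>i<k. 1 - u i) = card far"
    proof -
      have "(\<Sum>i<k. 1 - u i) = (\<Sum>i\<in>far. 1)"
        by (rule sum.mono_neutral_cong_right) (auto simp: u_def far_def)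
      then show ?thesis by simp
    qed
    ultimately have u: "(\<Sum>i<k. 1 - u i) \<le> \<delta>" by simp
    have w01: "0 \<le> w i" "w i \<le> 1" if "i < k" for i using w that by (auto simp: S_def)
    have "w' \<in> S" unfolding S_def
    proof (intro CollectI conjI allI impI)
      fix i assume i: "i < k"
      have eq: "w' i = (1 - s) * w i + s * u i" by (simp add: w'_def algebra_simps)
      have "(1 - s) * w i + s * u i \<le> (1 - s) * 1 + s * 1"
        using w01[OF i] s by (intro add_mono mult_left_mono) (auto simp: u_def)
      then show "w' i \<le> 1" unfolding eq by simp
      show "0 \<le> w' i" unfolding eq using w01[OF i] s
        by (intro add_nonneg_nonneg mult_nonneg_nonneg) (auto simp: u_def)
    next
      have "(\<Sum>i<k. 1 - w' i) = (1 - s) * (\<Sum>i<k. 1 - w i) + s * (\<Sum>i<k. 1 - u i)"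
        unfolding sum_distrib_left sum.distrib[symmetric]
        by (intro sum.cong refl) (simp add: w'_def algebra_simps)
      also have "\<dots> \<le> (1 - s) * \<delta> + s * \<delta>"
        using u w s by (intro add_mono mult_left_mono) (auto simp: S_def)
      finally show "(\<Sum>i<k. 1 - w' i) \<le> \<delta>" by (simp add: algebra_simps)
    qed
    moreover have "F w' \<le> F w * (1 - 2 * s) + s\<^sup>2 * H"
    proof -
      have Lw': "L w' t = L w t + s * (L u t - L w t)" for t
      proof -
        have "L w' t = (\<Sum>i<k. w i * a t i + s * (u i * a t i - w i * a t i))"
          unfolding L_def by (intro sum.cong refl) (simp add: w'_def algebra_simps)
        then show ?thesis by (simp only: L_def sum.distrib sum_distrib_left[symmetric] sum_subtractf)
      qed
      have "(\<Sum>t<T. e w t * L u t) = (\<Sum>t<T. \<Sum>i<k. C * (u i * (c t * a t i)))"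
        unfolding L_def sum_distrib_left e_c by (simp only: mult.assoc mult.left_commute)
      also have "\<dots> = C * (\<Sum>i<k. u i * (\<Sum>t<T. c t * a t i))"
        unfolding sum_distrib_left by (rule sum.swap)
      also have "\<dots> \<le> C * (\<Sum>i<k. R)"
        using C R by (intro mult_left_mono sum_mono) (auto simp: u_def far_def)
      finally have eu: "(\<Sum>t<T. e w t * L u t) \<le> C * (k * R)" by simp
      \<comment> \<open>This holds for all t, as both sides vanish where there is no excess.\<close>
      have "e w t * L w t = (e w t)\<^sup>2 + e w t * (k * R)" for t
        by (auto simp: e_def max_def power2_eq_square algebra_simps)
      then have ew: "(\<Sum>t<T. e w t * L w t) = F w + C * (k * R)"
        by (simp only: F_def C_def sum_distrib_right sum.distrib)
      have "F w' \<le> (\<Sum>t<T. (e w t)\<^sup>2 + 2 * s * (e w t * L u t - e w t * L w t) + s\<^sup>2 * (L u t - L w t)\<^sup>2)"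
        unfolding F_def
      proof (intro sum_mono)
        fix t
        have "\<bar>e w' t\<bar> \<le> \<bar>e w t + s * (L u t - L w t)\<bar>"
          unfolding e_def Lw' by (auto simp: max_def)
        then have "(e w' t)\<^sup>2 \<le> (e w t + s * (L u t - L w t))\<^sup>2"
          by (simp only: abs_le_square_iff)
        then show "(e w' t)\<^sup>2 \<le> (e w t)\<^sup>2 + 2 * s * (e w t * L u t - e w t * L w t) + s\<^sup>2 * (L u t - L w t)\<^sup>2"
          by (simp add: power2_eq_square algebra_simps)
      qed
      also have "\<dots> = F w + 2 * s * ((\<Sum>t<T. e w t * L u t) - (\<Sum>t<T. e w t * L w t)) + s\<^sup>2 * (\<Sum>t<T. (L u t - L w t)\<^sup>2)"
        by (simp only: F_def sum.distrib sum_subtractf sum_distrib_left[symmetric])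
      also have "\<dots> \<le> F w + 2 * s * (- F w) + s\<^sup>2 * H"
      proof (intro add_mono mult_left_mono order.refl)
        show "(\<Sum>t<T. e w t * L u t) - (\<Sum>t<T. e w t * L w t) \<le> - F w" using eu ew by simp
        show "(\<Sum>t<T. (L u t - L w t)\<^sup>2) \<le> H" unfolding H_def
        proof (intro sum_mono)
          fix t assume t: "t \<in> {..<T}"
          have "\<bar>L u t - L w t\<bar> = \<bar>\<Sum>i<k. (u i - w i) * a t i\<bar>"
            by (simp add: L_def sum_subtractf left_diff_distrib)
          also have "\<dots> \<le> (\<Sum>i<k. \<bar>(u i - w i) * a t i\<bar>)" by (rule sum_abs)
          also have "\<dots> \<le> (\<Sum>i<k. 1 * a t i)"
            unfolding abs_mult
          proof (intro sum_mono mult_mono)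
            fix i assume i: "i \<in> {..<k}"
            show "\<bar>u i - w i\<bar> \<le> 1" using w01[of i] i by (auto simp: u_def)
            show "\<bar>a t i\<bar> \<le> a t i" using a[of t i] i t by simp
          qed auto
          finally have "\<bar>L u t - L w t\<bar> \<le> \<bar>\<Sum>i<k. a t i\<bar>" by simp
          then show "(L u t - L w t)\<^sup>2 \<le> (\<Sum>i<k. a t i)\<^sup>2"
            by (simp only: abs_le_square_iff)
        qed
      qed (use s in auto)
      finally show ?thesis by (simp add: algebra_simps)
    qed
    ultimately show ?thesis by blast
  qed
  define m where "m = Inf (F ` S)"
  have bdd: "bdd_below (F ` S)" using F_nonneg by (auto simp: bdd_below_def)
  have m_le: "m \<le> F w" if "w \<in> S" for w unfolding m_def using bdd that by (rule cINF_lower)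
  have m_sup: "c \<le> m" if "\<And>w. w \<in> S \<Longrightarrow> c \<le> F w" for c
    unfolding m_def using that S1 by (intro cINF_greatest) auto
  have m_s: "m \<le> s * H / 2" if s: "0 < s" "s < 1/2" for s
  proof -
    have "(m - s\<^sup>2 * H) / (1 - 2 * s) \<le> m"
    proof (rule m_sup)
      fix w assume w: "w \<in> S"
      obtain w' where "w' \<in> S" "F w' \<le> F w * (1 - 2 * s) + s\<^sup>2 * H"
        using descent[OF w, of s] s by auto
      with m_le[of w'] have "m - s\<^sup>2 * H \<le> F w * (1 - 2 * s)" by simp
      then show "(m - s\<^sup>2 * H) / (1 - 2 * s) \<le> F w" using s by (simp add: pos_divide_le_eq)
    qed
    then have "m - s\<^sup>2 * H \<le> m * (1 - 2 * s)" using s by (simp add: pos_divide_le_eq)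
    then have "s * (2 * m) \<le> s * (s * H)" by (simp add: algebra_simps power2_eq_square)
    then show ?thesis using s by simp
  qed
  have kR: "0 < (k * R)\<^sup>2" using R k by simp
  have "m < (k * R)\<^sup>2"
  proof -
    define s where "s = min (1/4) ((k * R)\<^sup>2 / (H + 1))"
    have s: "0 < s" "s < 1/2" "s \<le> (k * R)\<^sup>2 / (H + 1)" using kR H_nonneg by (auto simp: s_def)
    have "m \<le> s * H / 2" using m_s s by simp
    also have "\<dots> < s * (H + 1)"
    proof -
      have "0 \<le> s * H" using s H_nonneg by simp
      then show ?thesis unfolding distrib_left using s by linarith
    qed
    also have "\<dots> \<le> (k * R)\<^sup>2" using s H_nonneg by (simp add: pos_le_divide_eq)
    finally show ?thesis .
  qed
  then have "\<not> (\<forall>w\<in>S. (k * R)\<^sup>2 \<le> F w)"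
    using m_sup[of "(k * R)\<^sup>2"] by auto
  then obtain w where w: "w \<in> S" "F w < (k * R)\<^sup>2"
    by (auto simp: not_le)
  have "L w t \<le> 2 * (k * R)" if t: "t < T" for t
  proof -
    have "(e w t)\<^sup>2 \<le> F w" unfolding F_def by (rule member_le_sum) (use t in simp_all)
    then have "(e w t)\<^sup>2 \<le> (k * R)\<^sup>2" using w by simp
    then have "e w t \<le> k * R" by (rule power2_le_imp_le) (use R in simp)
    moreover have "L w t - k * R \<le> e w t" by (simp add: e_def)
    ultimately show ?thesis by linarith
  qed
  then have "\<forall>t<T. (\<Sum>i<k. w i * a t i) \<le> 2 * (k * R)" by (simp only: L_def) blast
  moreover have "(\<forall>i<k. 0 \<le> w i \<and> w i \<le> 1) \<and> (\<Sum>i<k. 1 - w i) \<le> \<delta>"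
    using w(1) unfolding S_def by blast
  ultimately show ?thesis by blast
qed

section \<open>Powers of the scatter operator\<close>

text \<open>By log-convexity the ratios \<open>s\<^sub>n\<^sub>+\<^sub>1 / s\<^sub>n\<close> increase, so a bound on the last one bounds all of them.\<close>

lemma log_convex_le_geometric:
  fixes s :: "nat \<Rightarrow> real"
  assumes nonneg: "\<And>n. 0 \<le> s n" and lc: "\<And>n. (s (Suc n))\<^sup>2 \<le> s n * s (Suc (Suc n))"
    and X: "0 \<le> X" and last: "s (Suc p) \<le> X * s p"
  shows "s (Suc p) \<le> s 0 * X ^ Suc p"
  using last
proof (induction p)
  case 0 then show ?case by (simp add: mult.commute)
next
  case (Suc p)
  have "s (Suc p) \<le> X * s p"
  proof (cases "s (Suc p) = 0")
    case False
    then have pos: "s (Suc p) > 0" using nonneg[of "Suc p"] by linarith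
    have "s (Suc p) * s (Suc p) \<le> s p * (X * s (Suc p))"
      using lc[of p] mult_left_mono[OF Suc.prems nonneg[of p]] by (simp add: power2_eq_square)
    then show ?thesis using pos by (simp add: mult.commute mult.left_commute)
  qed (use X nonneg in simp)
  then have "s (Suc p) \<le> s 0 * X ^ Suc p" by (rule Suc.IH)
  then have "X * s (Suc p) \<le> X * (s 0 * X ^ Suc p)" by (intro mult_left_mono X)
  then show ?case using Suc.prems by (simp add: mult.left_commute)
qed

text \<open>The increasing ratios \<open>t\<^sub>n\<^sub>+\<^sub>1 / t\<^sub>n\<close> start at \<open>t\<^sub>1\<close>.\<close>

lemma power_le_log_convex:
  fixes t :: "nat \<Rightarrow> real"
  assumes nonneg: "\<And>n. 0 \<le> t n" and lc: "\<And>n. (t (Suc n))\<^sup>2 \<le> t n * t (Suc (Suc n))"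
    and t0: "t 0 = 1"
  shows "t (Suc 0) ^ Suc p \<le> t (Suc p)"
proof (cases "t (Suc 0) = 0")
  case True then show ?thesis using nonneg by simp
next
  case False
  then have t1: "t (Suc 0) > 0" using nonneg[of 1] by simp
  have "t (Suc 0) * t p \<le> t (Suc p) \<and> 0 < t (Suc p)" for p
  proof (induction p)
    case 0 then show ?case using t0 t1 by simp
  next
    case (Suc p)
    have "t (Suc 0) * t (Suc p) * t p \<le> t (Suc p) * t (Suc p)" using Suc by (simp add: mult_right_mono algebra_simps)
    also have "\<dots> \<le> t p * t (Suc (Suc p))" using lc[of p] by (simp add: power2_eq_square)
    finally have *: "t p * (t (Suc 0) * t (Suc p)) \<le> t p * t (Suc (Suc p))" by (simp add: algebra_simps)
    have "t p > 0"
    proof -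
      have "0 < t (Suc p) ^ 2" using Suc by simp
      then show ?thesis using lc[of p] nonneg[of p] by (cases "t p = 0") auto
    qed
    with * have "t (Suc 0) * t (Suc p) \<le> t (Suc (Suc p))" by simp
    moreover have "0 < t (Suc 0) * t (Suc p)" using t1 Suc by simp
    ultimately show ?case by linarith
  qed
  then have step: "t (Suc 0) * t p \<le> t (Suc p)" for p by blast
  show ?thesis
  proof (induction p)
    case (Suc p)
    have "t (Suc 0) ^ Suc (Suc p) \<le> t (Suc 0) * t (Suc p)" using Suc t1 by (simp add: mult_left_mono)
    then show ?case using step[of "Suc p"] by linarith
  qed simp
qed

locale weighted_points =
  fixes d k :: nat and w :: "nat \<Rightarrow> real" and z :: "nat \<Rightarrow> nat \<Rightarrow> real"
  assumes w_nonneg: "i < k \<Longrightarrow> 0 \<le> w i"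

text \<open>The matrix \<open>(\<Sum>l. w\<^sub>l z\<^sub>l z\<^sub>l\<^sup>T)\<close> as an operator, in the way in which it is evaluated by the program.\<close>

definition scatter :: "nat \<Rightarrow> nat \<Rightarrow> (nat \<Rightarrow> real) \<Rightarrow> (nat \<Rightarrow> nat \<Rightarrow> real) \<Rightarrow> (nat \<Rightarrow> real) \<Rightarrow> nat \<Rightarrow> real" where
  "scatter d k w z u = (\<lambda>j. \<Sum>l<k. w l * ip d (z l) u * z l j)"

definition scatter_form :: "nat \<Rightarrow> nat \<Rightarrow> (nat \<Rightarrow> real) \<Rightarrow> (nat \<Rightarrow> nat \<Rightarrow> real) \<Rightarrow> nat
    \<Rightarrow> (nat \<Rightarrow> real) \<Rightarrow> (nat \<Rightarrow> real) \<Rightarrow> real" where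
  "scatter_form d k w z p x y = ip d x ((scatter d k w z ^^ p) y)"

context weighted_points begin

interpretation ip: psd_bilinear d "ip d" by (rule psd_bilinear_ip)

abbreviation "A \<equiv> scatter d k w z"
abbreviation "P \<equiv> scatter_form d k w z"

lemma ip_scatter: "ip d x (A y) = (\<Sum>l<k. w l * ip d (z l) y * ip d x (z l))"
  unfolding scatter_def by (rule ip.sum_right) simp

lemma ip_scatter_swap: "ip d x (A y) = ip d (A x) y"
  unfolding ip.sym[of "A x"] ip_scatter by (simp add: mult.commute mult.left_commute ip.sym)

lemma ip_power_swap: "ip d x ((A ^^ p) y) = ip d ((A ^^ p) x) y"
proof (induction p arbitrary: x y)
  case (Suc p)
  have "ip d x ((A ^^ Suc p) y) = ip d (A x) ((A ^^ p) y)" by (simp add: ip_scatter_swap)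
  also have "\<dots> = ip d ((A ^^ Suc p) x) y" by (simp add: Suc funpow_swap1)
  finally show ?case .
qed simp

lemma form_Suc: "P (Suc p) x y = (\<Sum>l<k. w l * ip d (z l) y * P p x (z l))"
  unfolding scatter_form_def
  by (simp add: ip_power_swap ip_scatter funpow_swap1 flip: ip_scatter_swap)

lemma form_1: "P (Suc 0) x x = (\<Sum>l<k. w l * (ip d (z l) x)\<^sup>2)"
  unfolding form_Suc
  by (simp add: scatter_form_def power2_eq_square ip.sym mult.assoc)

lemma form_shift: "P (Suc p) x y = P p x (A y)"
  by (simp add: scatter_form_def funpow_swap1)

lemma form_shift2: "P (Suc (Suc p)) x y = P p (A x) (A y)"
  by (simp only: scatter_form_def ip_scatter_swap[symmetric] funpow.simps o_apply funpow_swap1)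

text \<open>Positivity for the exponent \<open>p + 2\<close> reduces to the exponent \<open>p\<close> at the vector \<open>A x\<close>.\<close>

lemma psd_form: "psd_bilinear d (P p)"
proof
  fix x y z' :: "nat \<Rightarrow> real" and c :: real
  show "P p (\<lambda>j. x j + y j) z' = P p x z' + P p y z'"
    by (simp add: scatter_form_def ip.add)
  show "P p (\<lambda>j. c * x j) z' = c * P p x z'"
    by (simp add: scatter_form_def ip.scale)
  show "P p x y = P p y x"
    by (metis scatter_form_def ip_power_swap ip.sym)
  show "P p x z' = P p y z'" if "\<And>j. j < d \<Longrightarrow> x j = y j"
    using ip.cong[OF that] by (simp add: scatter_form_def)
  show "0 \<le> P p x x"
  proof (induction p arbitrary: x rule: induct_nat_012)
    case 0 then show ?case by (simp add: scatter_form_def ip.nonneg)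
  next
    case 1
    show ?case unfolding One_nat_def form_1
      by (intro sum_nonneg mult_nonneg_nonneg w_nonneg) auto
  next
    case (ge2 p) then show ?case by (simp add: form_shift2)
  qed
qed

text \<open>The trace of \<open>A\<^bsup>p+1\<^esup>\<close> is a weighted sum of values of the form of \<open>A\<^sup>p\<close>. In this way the program
  obtains traces without forming a matrix.\<close>

lemma trace_Suc: "psd_bilinear.trace d (P (Suc p)) = (\<Sum>l<k. w l * P p (z l) (z l))"
proof -
  interpret Pp: psd_bilinear d "P p" by (rule psd_form)
  have "psd_bilinear.trace d (P (Suc p)) = (\<Sum>a<d. \<Sum>l<k. w l * ip d (z l) (axis a) * P p (axis a) (z l))"
    by (simp add: psd_bilinear.trace_def[OF psd_form] form_Suc)
  also have "\<dots> = (\<Sum>a<d. \<Sum>l<k. w l * (z l a * P p (axis a) (z l)))"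
    by (intro sum.cong refl) (simp add: ip.sym[of _ "axis _"] ip_axis)
  also have "\<dots> = (\<Sum>l<k. w l * (\<Sum>a<d. z l a * P p (axis a) (z l)))"
    by (simp add: sum_distrib_left sum.swap[of _ "{..<k}"])
  finally show ?thesis by (simp flip: Pp.expand)
qed

lemma trace_0: "psd_bilinear.trace d (P 0) = d"
  by (simp add: psd_bilinear.trace_def[OF psd_form] scatter_form_def ip_axis) (simp add: axis_def)

text \<open>The form of \<open>A\<^sup>p\<close> at the vector \<open>l x + A x\<close>; being nonnegative for all \<open>l\<close>, it yields log-convexity of the
  moments \<open>\<langle>x, A\<^sup>p x\<rangle>\<close> and, summed over a basis, of the traces.\<close>

lemma quadratic_nonneg: "0 \<le> P p x x * l\<^sup>2 + 2 * P (Suc p) x x * l + P (Suc (Suc p)) x x"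
proof -
  interpret Pp: psd_bilinear d "P p" by (rule psd_form)
  have "0 \<le> P p (\<lambda>j. l * x j + A x j) (\<lambda>j. l * x j + A x j)" by (rule Pp.nonneg)
  also have "\<dots> = P p x x * l\<^sup>2 + 2 * P (Suc p) x x * l + P (Suc (Suc p)) x x"
    unfolding Pp.add_square Pp.scale Pp.scale2 form_shift2 unfolding form_shift by (simp add: power2_eq_square)
  finally show ?thesis .
qed

lemma form_log_convex: "(P (Suc p) x x)\<^sup>2 \<le> P p x x * P (Suc (Suc p)) x x"
  by (rule square_le_of_nonneg_quadratic) (rule quadratic_nonneg)

lemma trace_log_convex: "(psd_bilinear.trace d (P (Suc p)))\<^sup>2
    \<le> psd_bilinear.trace d (P p) * psd_bilinear.trace d (P (Suc (Suc p)))"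
proof (rule square_le_of_nonneg_quadratic)
  fix l
  have "0 \<le> (\<Sum>a<d. P p (axis a) (axis a) * l\<^sup>2 + 2 * P (Suc p) (axis a) (axis a) * l + P (Suc (Suc p)) (axis a) (axis a))"
    by (intro sum_nonneg quadratic_nonneg)
  then show "0 \<le> psd_bilinear.trace d (P p) * l\<^sup>2 + 2 * psd_bilinear.trace d (P (Suc p)) * l
      + psd_bilinear.trace d (P (Suc (Suc p)))"
    by (simp add: psd_bilinear.trace_def[OF psd_form] sum.distrib sum_distrib_left sum_distrib_right)
qed

text \<open>For a unit vector \<open>v\<close> log-convexity gives
  \<open>\<langle>v, A v\<rangle>\<^bsup>d+1\<^esup> \<le> \<langle>v, A\<^bsup>d+1\<^esup> v\<rangle> \<le> tr A\<^bsup>d+1\<^esup> \<le> d X\<^bsup>d+1\<^esup> \<le> (2 X)\<^bsup>d+1\<^esup>\<close>.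
  The factor \<open>d\<close> is the trace of \<open>A\<^sup>0\<close>; the exponent is chosen large enough to make its root at most \<open>2\<close>.\<close>

lemma trace_ratio_bounds_variance:
  assumes d: "1 \<le> d" and X: "0 < X"
    and small: "psd_bilinear.trace d (P (Suc d)) \<le> X * psd_bilinear.trace d (P d)"
  shows "(\<Sum>i<k. w i * (ip d (z i) v)\<^sup>2) \<le> 2 * X * ip d v v"
proof -
  have le2: "real d \<le> 2 * 2 ^ d"
  proof -
    have "real d < 2 ^ d" by (rule of_nat_less_two_power)
    then show ?thesis by linarith
  qed
  have unit: "P (Suc 0) v v \<le> 2 * X" if v: "ip d v v = 1" for v
  proof -
    have "psd_bilinear.trace d (P (Suc d)) \<le> psd_bilinear.trace d (P 0) * X ^ Suc d"
      using small X psd_bilinear.trace_nonneg[OF psd_form] trace_log_convex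
      by (intro log_convex_le_geometric) auto
    also have "\<dots> \<le> 2 ^ Suc d * X ^ Suc d" using X d
      by (intro mult_right_mono) (simp_all add: trace_0 le2)
    finally have "psd_bilinear.trace d (P (Suc d)) \<le> (2 * X) ^ Suc d"
      by (simp only: power_mult_distrib)
    moreover have "P (Suc d) v v \<le> psd_bilinear.trace d (P (Suc d))"
      using psd_bilinear.le_trace[OF psd_form, of "Suc d" v] v by simp
    moreover have "P (Suc 0) v v ^ Suc d \<le> P (Suc d) v v"
      using psd_bilinear.nonneg[OF psd_form] form_log_convex v
      by (intro power_le_log_convex[of "\<lambda>n. P n v v"]) (auto simp: scatter_form_def)
    ultimately have "P (Suc 0) v v ^ Suc d \<le> (2 * X) ^ Suc d" by linarith
    then show ?thesis using X power_le_imp_le_base[of "P (Suc 0) v v" d "2 * X"] by simp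
  qed
  interpret P1: psd_bilinear d "P (Suc 0)" by (rule psd_form)
  show ?thesis
  proof (cases "ip d v v = 0")
    case True
    then have "P (Suc 0) v v \<le> 0" using P1.le_trace[of v] by simp
    then show ?thesis using True form_1 by simp
  next
    case False
    then have pos: "0 < ip d v v" using ip.nonneg[of v] by linarith
    define c where "c = 1 / sqrt (ip d v v)"
    have c: "c * c * ip d v v = 1" using pos by (simp add: c_def)
    have "P (Suc 0) (\<lambda>j. c * v j) (\<lambda>j. c * v j) \<le> 2 * X"
      using c by (intro unit) (simp only: ip.scale ip.scale2 mult.assoc)
    then have "c * c * P (Suc 0) v v \<le> 2 * X" by (simp only: P1.scale P1.scale2 mult.assoc)
    then have "c * c * P (Suc 0) v v * ip d v v \<le> 2 * X * ip d v v" using pos by (simp add: mult_right_mono)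
    moreover have "c * c * P (Suc 0) v v * ip d v v = P (Suc 0) v v" using c by (simp only: mult.commute mult.left_commute) simp
    ultimately show ?thesis by (simp only: form_1)
  qed
qed

end

section \<open>The filter\<close>

definition mean :: "nat \<Rightarrow> (nat \<Rightarrow> real) \<Rightarrow> (nat \<Rightarrow> nat \<Rightarrow> real) \<Rightarrow> nat \<Rightarrow> real" where
  "mean k w z = (\<lambda>j. 1 / (\<Sum>i<k. w i) * (\<Sum>i<k. w i * z i j))"

text \<open>The value at \<open>z\<^sub>i\<close> of the form of \<open>A\<^sup>d\<close>. Division by the trace, as in the form \<open>Q\<close> of the overview, would
  rescale all leverages alike and is left out.\<close>

definition leverage :: "nat \<Rightarrow> nat \<Rightarrow> (nat \<Rightarrow> real) \<Rightarrow> (nat \<Rightarrow> nat \<Rightarrow> real) \<Rightarrow> nat \<Rightarrow> real" where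
  "leverage d k w z i = scatter_form d k w z d (z i) (z i)"

text \<open>The inserted \<open>0\<close> is the initial value of the running maximum in the program.\<close>

definition max_leverage :: "nat \<Rightarrow> nat \<Rightarrow> (nat \<Rightarrow> real) \<Rightarrow> (nat \<Rightarrow> nat \<Rightarrow> real) \<Rightarrow> nat \<Rightarrow> real" where
  "max_leverage d k w z n = Max (insert 0 (leverage d k w z ` {i. i < n \<and> 0 < w i}))"

text \<open>The test \<open>R (\<Sum>i. w\<^sub>i) tr A\<^sup>d < tr A\<^bsup>d+1\<^esup>\<close>, with both traces written as the sums that the program
  computes; for \<open>d \<ge> 1\<close> see \<open>spread_out_iff\<close> below.\<close>

definition spread_out :: "nat \<Rightarrow> nat \<Rightarrow> real \<Rightarrow> (nat \<Rightarrow> real) \<Rightarrow> (nat \<Rightarrow> nat \<Rightarrow> real) \<Rightarrow> bool" where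
  "spread_out d k R w z \<longleftrightarrow>
     R * (\<Sum>i<k. w i) * (\<Sum>i<k. w i * scatter_form d k w z (d - 1) (z i) (z i))
       < (\<Sum>i<k. w i * leverage d k w z i)"

definition downweight :: "nat \<Rightarrow> nat \<Rightarrow> real \<Rightarrow> (nat \<Rightarrow> real) \<Rightarrow> (nat \<Rightarrow> nat \<Rightarrow> real) \<Rightarrow> nat \<Rightarrow> real" where
  "downweight d k R w z = (if spread_out d k R w z
     then (\<lambda>i. w i * (1 - leverage d k w z i / max_leverage d k w z k)) else w)"

text \<open>The state consists of the weights, the translated points and the sum of the translations so far.\<close>

fun filter_step :: "nat \<Rightarrow> nat \<Rightarrow> real \<Rightarrow>
    (nat \<Rightarrow> real) \<times> (nat \<Rightarrow> nat \<Rightarrow> real) \<times> (nat \<Rightarrow> real) \<Rightarrow>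
    (nat \<Rightarrow> real) \<times> (nat \<Rightarrow> nat \<Rightarrow> real) \<times> (nat \<Rightarrow> real)" where
  "filter_step d k R (w, z, c) =
     (let m = mean k w z; z' = (\<lambda>i j. z i j - m j)
      in (downweight d k R w z', z', \<lambda>j. c j + m j))"

text \<open>Since \<open>z\<^sub>i = (z\<^sub>i - \<nu>) + \<nu>\<close>, the \<open>g\<close>-part of the spread consists of the deviations of the inliers from
  \<open>\<nu>\<close>, which are small by assumption, and of \<open>P Q(\<nu>)\<close>, where \<open>P\<close> is the weight of the \<open>g\<close>-part. The
  vector \<open>\<nu>\<close> itself is small: as the weighted mean is \<open>0\<close>, the sum \<open>P \<nu>\<close> splits into deviations of inliers
  and a sum over the complement of \<open>g\<close>, which has weight at most \<open>k / 60\<close> and so by Jensen's inequality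
  contributes only a small fraction of the total spread \<open>D\<close>.\<close>

lemma (in psd_bilinear) outliers_dominate:
  fixes w g :: "nat \<Rightarrow> real" and z :: "nat \<Rightarrow> nat \<Rightarrow> real" and \<nu> :: "nat \<Rightarrow> real" and \<rho> :: real
  assumes k: "1 \<le> k" and \<rho>: "0 \<le> \<rho>"
    and w: "\<And>i. i < k \<Longrightarrow> 0 \<le> w i \<and> w i \<le> 1" and g: "\<And>i. i < k \<Longrightarrow> 0 \<le> g i \<and> g i \<le> 1"
    and g_mass: "(\<Sum>i<k. 1 - g i) \<le> real k / 60" and w_mass: "(\<Sum>i<k. 1 - w i) \<le> real k / 30"
    and inliers: "(\<Sum>i<k. g i * Q (\<lambda>j. z i j - \<nu> j) (\<lambda>j. z i j - \<nu> j)) \<le> 2 * (real k * \<rho>)"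
    and centred: "\<And>j. j < d \<Longrightarrow> (\<Sum>i<k. w i * z i j) = 0"
    and spread: "100 * \<rho> * (\<Sum>i<k. w i) \<le> (\<Sum>i<k. w i * Q (z i) (z i))"
  shows "2 * (\<Sum>i<k. g i * w i * Q (z i) (z i)) \<le> (\<Sum>i<k. w i * Q (z i) (z i))"
proof -
  have K: "0 < real k" using k by simp
  define D where "D = (\<Sum>i<k. w i * Q (z i) (z i))"
  define p where "p i = g i * w i" for i
  define b where "b i = (1 - g i) * w i" for i
  define P where "P = (\<Sum>i<k. p i)"
  define q where "q i = Q (\<lambda>j. z i j - \<nu> j) (\<lambda>j. z i j - \<nu> j)" for i
  define V where "V = Q \<nu> \<nu>"
  define E where "E = (\<Sum>i<k. p i * q i)"
  have p: "0 \<le> p i" "p i \<le> g i" "p i \<le> w i" and b: "0 \<le> b i" "b i \<le> 1 - g i" "b i \<le> w i" if "i < k" for i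
    using w[OF that] g[OF that] by (auto simp: p_def b_def mult_left_le mult_left_le_one_le mult_right_le_one_le)
  have D0: "0 \<le> D" unfolding D_def by (intro sum_nonneg mult_nonneg_nonneg nonneg) (use w in auto)
  have E: "E \<le> 2 * (real k * \<rho>)"
  proof -
    have "E \<le> (\<Sum>i<k. g i * q i)" unfolding E_def
      by (intro sum_mono mult_right_mono) (use p in \<open>auto simp: q_def nonneg\<close>)
    then show ?thesis using inliers by (simp add: q_def)
  qed
  have S: "29/30 * real k \<le> (\<Sum>i<k. w i)"
    using w_mass K by (simp add: sum_subtractf)
  have Pb: "P + (\<Sum>i<k. b i) = (\<Sum>i<k. w i)"
    unfolding P_def sum.distrib[symmetric] by (intro sum.cong refl) (simp add: p_def b_def algebra_simps)
  have B: "(\<Sum>i<k. b i) \<le> real k / 60"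
  proof -
    have "(\<Sum>i<k. b i) \<le> (\<Sum>i<k. 1 - g i)" by (intro sum_mono) (use b in auto)
    then show ?thesis using g_mass by simp
  qed
  have P: "57/60 * real k \<le> P" using S Pb B by simp
  then have P0: "0 < P" using K by simp
  have "(\<Sum>i<k. p i * Q (z i) (z i)) \<le> (\<Sum>i<k. 2 * (p i * q i) + p i * (2 * V))"
  proof (intro sum_mono)
    fix i assume i: "i \<in> {..<k}"
    have "Q (z i) (z i) \<le> 2 * q i + 2 * V"
      using add_square_le[of "\<lambda>j. z i j - \<nu> j" \<nu>] by (simp add: q_def V_def)
    then have "p i * Q (z i) (z i) \<le> p i * (2 * q i + 2 * V)"
      using p i by (intro mult_left_mono) auto
    then show "p i * Q (z i) (z i) \<le> 2 * (p i * q i) + p i * (2 * V)" by (simp add: algebra_simps)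
  qed
  also have "\<dots> = 2 * E + P * (2 * V)"
    by (simp only: sum.distrib E_def P_def sum_distrib_left sum_distrib_right)
  finally have main: "(\<Sum>i<k. p i * Q (z i) (z i)) \<le> 2 * E + 2 * (P * V)" by simp
  have "P * (P * V) = Q (\<lambda>j. P * \<nu> j) (\<lambda>j. P * \<nu> j)" by (simp add: scale scale2 V_def)
  also have "\<dots> = Q (\<lambda>j. (\<Sum>i<k. p i * ((-1) * (z i j - \<nu> j))) + (\<Sum>i<k. b i * ((-1) * z i j)))
      (\<lambda>j. (\<Sum>i<k. p i * ((-1) * (z i j - \<nu> j))) + (\<Sum>i<k. b i * ((-1) * z i j)))"
  proof -
    have eq: "P * \<nu> j = (\<Sum>i<k. p i * ((-1) * (z i j - \<nu> j))) + (\<Sum>i<k. b i * ((-1) * z i j))" if "j < d" for j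
    proof -
      have "(\<Sum>i<k. p i * ((-1) * (z i j - \<nu> j))) + (\<Sum>i<k. b i * ((-1) * z i j))
          = (\<Sum>i<k. p i * \<nu> j - w i * z i j)"
        unfolding sum.distrib[symmetric]
        by (intro sum.cong refl) (simp add: p_def b_def algebra_simps)
      then show ?thesis using centred[OF that] by (simp add: sum_subtractf P_def sum_distrib_right)
    qed
    show ?thesis by (rule trans[OF cong[OF eq]], assumption, subst sym, rule cong[OF eq])
  qed
  also have "\<dots> \<le> 2 * (P * E) + 2 * ((\<Sum>i<k. b i) * (\<Sum>i<k. b i * Q (z i) (z i)))"
  proof -
    have "Q (\<lambda>j. \<Sum>i<k. p i * ((-1) * (z i j - \<nu> j))) (\<lambda>j. \<Sum>i<k. p i * ((-1) * (z i j - \<nu> j)))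
        \<le> P * (\<Sum>i<k. p i * Q (\<lambda>j. (-1) * (z i j - \<nu> j)) (\<lambda>j. (-1) * (z i j - \<nu> j)))"
      unfolding P_def using p by (intro sum_square_le) auto
    moreover have "Q (\<lambda>j. \<Sum>i<k. b i * ((-1) * z i j)) (\<lambda>j. \<Sum>i<k. b i * ((-1) * z i j))
        \<le> (\<Sum>i<k. b i) * (\<Sum>i<k. b i * Q (\<lambda>j. (-1) * z i j) (\<lambda>j. (-1) * z i j))"
      using b by (intro sum_square_le) auto
    ultimately show ?thesis
      using add_square_le[of "\<lambda>j. \<Sum>i<k. p i * ((-1) * (z i j - \<nu> j))" "\<lambda>j. \<Sum>i<k. b i * ((-1) * z i j)"]
      unfolding scale scale2 E_def q_def by simp
  qed
  also have "\<dots> \<le> 2 * (P * E) + 2 * (real k / 60 * D)"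
  proof -
    have "(\<Sum>i<k. b i * Q (z i) (z i)) \<le> D" unfolding D_def
      by (intro sum_mono mult_right_mono nonneg) (use b in auto)
    then have "(\<Sum>i<k. b i) * (\<Sum>i<k. b i * Q (z i) (z i)) \<le> real k / 60 * D"
      using B b D0 K by (intro mult_mono sum_nonneg mult_nonneg_nonneg nonneg) auto
    then show ?thesis by linarith
  qed
  also have "\<dots> \<le> 2 * (P * E) + 2 * (P / 57 * D)"
    using P D0 by (intro add_left_mono mult_left_mono mult_right_mono) auto
  finally have "P * (P * V) \<le> P * (2 * E + 2 / 57 * D)" by (simp add: algebra_simps)
  then have PV: "P * V \<le> 2 * E + 2 / 57 * D" using P0 by simp
  have "100 * \<rho> * (29/30 * real k) \<le> 100 * \<rho> * (\<Sum>i<k. w i)" using S \<rho> by (intro mult_left_mono) auto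
  then have KD: "290/3 * (real k * \<rho>) \<le> D" using spread unfolding D_def by (simp add: algebra_simps)
  have "2 * (\<Sum>i<k. p i * Q (z i) (z i)) \<le> D"
    using main PV E KD D0 by linarith
  then show ?thesis by (simp add: p_def D_def)
qed

text \<open>Measured along \<open>v\<close>, all but \<open>k / 60\<close> of the \<open>z\<^sub>i\<close> are within \<open>r\<close> of \<open>v\<close>, by the assumption for the
  rank-one form of the direction of \<open>v\<close>. If \<open>v\<close> were longer than \<open>21 r\<close>, these points, which carry most
  of the weight, would have squared projections of at least \<open>400 r\<^sup>2\<close>, against a weighted average of at most
  \<open>200 r\<^sup>2\<close>.\<close>

lemma centre_of_concentrated_weights:
  fixes x z :: "nat \<Rightarrow> nat \<Rightarrow> real" and v w :: "nat \<Rightarrow> real"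
  assumes k: "1 \<le> k" and r: "0 < r"
    and far: "\<And>Q. psd_bilinear d Q \<Longrightarrow> psd_bilinear.trace d Q \<le> 1
      \<Longrightarrow> 60 * card {i. i < k \<and> r\<^sup>2 \<le> Q (x i) (x i)} \<le> k"
    and z: "\<And>i j. i < k \<Longrightarrow> j < d \<Longrightarrow> z i j = x i j + v j"
    and w: "\<And>i. i < k \<Longrightarrow> 0 \<le> w i \<and> w i \<le> 1" and w_mass: "(\<Sum>i<k. 1 - w i) \<le> k / 30"
    and variance: "(\<Sum>i<k. w i * (ip d (z i) v)\<^sup>2) \<le> 2 * (100 * r\<^sup>2 * (\<Sum>i<k. w i)) * ip d v v"
  shows "ip d v v \<le> (21 * r)\<^sup>2"
proof (rule ccontr)
  interpret ip: psd_bilinear d "ip d" by (rule psd_bilinear_ip)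
  define V where "V = ip d v v"
  assume "\<not> ip d v v \<le> (21 * r)\<^sup>2"
  then have V: "(21 * r)\<^sup>2 < V" by (simp add: V_def)
  then have V0: "0 < V" by (meson le_less_trans zero_le_power2)
  define s where "s = sqrt V"
  have s2: "s * s = V" using V0 by (simp add: s_def)
  have s: "21 * r < s" unfolding s_def using V r by (intro real_less_rsqrt) auto
  define Q where "Q a b = ip d a v * ip d b v / V" for a b
  have psdQ: "psd_bilinear d Q"
  proof
    show "0 \<le> Q a a" for a unfolding Q_def using V0 by simp
    show "Q a c = Q b c" if "\<And>j. j < d \<Longrightarrow> a j = b j" for a b c
      unfolding Q_def using ip.cong[OF that] by simp
  qed (simp_all add: Q_def ip.add ip.scale add_divide_distrib distrib_right)
  have trQ: "psd_bilinear.trace d Q \<le> 1"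
  proof -
    have "psd_bilinear.trace d Q = (\<Sum>a<d. v a * v a) / V"
      unfolding psd_bilinear.trace_def[OF psdQ] sum_divide_distrib
      by (intro sum.cong refl) (simp add: Q_def ip_axis)
    then show ?thesis using V0 by (simp add: V_def ip_def)
  qed
  have card: "60 * card {i. i < k \<and> r\<^sup>2 \<le> Q (x i) (x i)} \<le> k"
    by (rule far[OF psdQ trQ])
  define F where "F = {i. i < k \<and> r\<^sup>2 \<le> Q (x i) (x i)}"
  define S where "S = (\<Sum>i<k. w i)"
  have S: "29/30 * real k \<le> S" using w_mass by (simp add: S_def sum_subtractf)
  then have S0: "0 < S" using k by simp
  have "S = (\<Sum>i\<in>{..<k} - F. w i) + (\<Sum>i\<in>F. w i)"
    unfolding S_def by (rule sum.subset_diff) (auto simp: F_def)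
  moreover have "(\<Sum>i\<in>F. w i) \<le> (\<Sum>i\<in>F. 1)" by (intro sum_mono) (use w in \<open>auto simp: F_def\<close>)
  moreover have "(\<Sum>i\<in>F. 1) = real (card F)" by simp
  moreover have "60 * real (card F) \<le> real k" using card unfolding F_def by linarith
  ultimately have near: "3 / 4 * S \<le> (\<Sum>i\<in>{..<k} - F. w i)" using S by linarith
  have large: "400 * r\<^sup>2 * V \<le> (ip d (z i) v)\<^sup>2" if i: "i < k" "i \<notin> F" for i
  proof -
    have "(ip d (x i) v)\<^sup>2 / V < r\<^sup>2" using i by (simp add: F_def Q_def power2_eq_square)
    then have "(ip d (x i) v)\<^sup>2 < (r * s)\<^sup>2"
      using V0 by (simp add: power_mult_distrib power2_eq_square[of s] s2 pos_divide_less_eq)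
    then have "\<bar>ip d (x i) v\<bar> < \<bar>r * s\<bar>"
      using r s power2_less_imp_less[of "\<bar>ip d (x i) v\<bar>" "\<bar>r * s\<bar>"] by simp
    then have "\<bar>ip d (x i) v\<bar> < r * s" using r s by simp
    moreover have "ip d (z i) v = ip d (\<lambda>j. x i j + v j) v"
      by (rule ip.cong) (rule z[OF i(1)])
    then have "ip d (z i) v = ip d (x i) v + V" by (simp only: ip.add V_def)
    moreover have "21 * r * s \<le> V" unfolding s2[symmetric] using s r by (intro mult_right_mono) auto
    ultimately have "20 * r * s \<le> ip d (z i) v" by linarith
    then have "(20 * r * s)\<^sup>2 \<le> (ip d (z i) v)\<^sup>2" using r s by (intro power_mono) auto
    moreover have "(20 * r * s)\<^sup>2 = 400 * r\<^sup>2 * V" by (simp add: power_mult_distrib power2_eq_square[of s] s2)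
    ultimately show ?thesis by simp
  qed
  have "400 * r\<^sup>2 * V * (3 / 4 * S) \<le> 400 * r\<^sup>2 * V * (\<Sum>i\<in>{..<k} - F. w i)"
    using near V0 by (intro mult_left_mono) auto
  also have "\<dots> = (\<Sum>i\<in>{..<k} - F. w i * (400 * r\<^sup>2 * V))"
    unfolding sum_distrib_right[symmetric] by (rule mult.commute)
  also have "\<dots> \<le> (\<Sum>i\<in>{..<k} - F. w i * (ip d (z i) v)\<^sup>2)"
    using large w by (intro sum_mono mult_left_mono) auto
  also have "\<dots> \<le> (\<Sum>i<k. w i * (ip d (z i) v)\<^sup>2)"
    using w by (intro sum_mono2) auto
  also have "\<dots> \<le> 2 * (100 * r\<^sup>2 * S) * V" using variance by (simp add: S_def V_def)
  finally have "300 * (r\<^sup>2 * V * S) \<le> 200 * (r\<^sup>2 * V * S)" by (simp add: mult.commute mult.left_commute)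
  moreover have "0 < r\<^sup>2 * V * S" using r V0 S0 by simp
  ultimately show False by linarith
qed

context weighted_points begin

lemma spread_out_iff:
  assumes "1 \<le> d"
  shows "spread_out d k R w z \<longleftrightarrow>
    R * (\<Sum>i<k. w i) * psd_bilinear.trace d (P d) < psd_bilinear.trace d (P (Suc d))"
proof -
  have "P d = P (Suc (d - 1))" using assms by simp
  then have "psd_bilinear.trace d (P d) = (\<Sum>i<k. w i * P (d - 1) (z i) (z i))"
    by (simp only: trace_Suc)
  then show ?thesis by (simp add: spread_out_def leverage_def trace_Suc)
qed

lemma leverage_nonneg: "0 \<le> leverage d k w z i"
  unfolding leverage_def by (rule psd_bilinear.nonneg[OF psd_form])

lemma max_leverage_ge: "i < k \<Longrightarrow> 0 < w i \<Longrightarrow> leverage d k w z i \<le> max_leverage d k w z k"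
  unfolding max_leverage_def by (rule Max_ge) auto

lemma max_leverage_nonneg: "0 \<le> max_leverage d k w z k"
  unfolding max_leverage_def by (rule Max_ge) auto

lemma downweight_bounds:
  assumes "i < k"
  shows "0 \<le> downweight d k R w z i \<and> downweight d k R w z i \<le> w i"
proof (cases "0 < w i")
  case True
  define q where "q = leverage d k w z i / max_leverage d k w z k"
  have "q \<le> 1"
    unfolding q_def using max_leverage_ge[OF assms True] max_leverage_nonneg
    by (auto simp: divide_le_eq_1)
  moreover have "0 \<le> q"
    unfolding q_def using max_leverage_nonneg leverage_nonneg by simp
  ultimately have "0 \<le> w i * (1 - q) \<and> w i * (1 - q) \<le> w i"
    using True by (simp add: mult_left_le)
  then show ?thesis using True by (simp add: downweight_def q_def)
next
  case False
  then have "w i = 0" using w_nonneg[OF assms] by simp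
  then show ?thesis by (simp add: downweight_def)
qed

lemma spread_out_max_leverage:
  assumes "1 \<le> d" "0 \<le> R" "spread_out d k R w z"
  shows "0 < max_leverage d k w z k"
    and "\<exists>i<k. 0 < w i \<and> leverage d k w z i = max_leverage d k w z k"
proof -
  have "0 \<le> R * (\<Sum>i<k. w i) * psd_bilinear.trace d (P d)"
    using assms w_nonneg psd_bilinear.trace_nonneg[OF psd_form]
    by (intro mult_nonneg_nonneg sum_nonneg) auto
  then have pos: "0 < (\<Sum>i<k. w i * leverage d k w z i)"
    using assms by (simp add: spread_out_iff leverage_def trace_Suc)
  then obtain i where i: "i < k" "0 < w i * leverage d k w z i"
    by (metis (no_types, lifting) not_le lessThan_iff sum_nonpos)
  then have "0 < w i" "0 < leverage d k w z i"
    using w_nonneg[OF i(1)] leverage_nonneg[of i] by (auto simp: zero_less_mult_iff)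
  then show M: "0 < max_leverage d k w z k" using max_leverage_ge[OF i(1)] by linarith
  have "max_leverage d k w z k \<in> insert 0 (leverage d k w z ` {i. i < k \<and> 0 < w i})"
    unfolding max_leverage_def by (rule Max_in) auto
  then show "\<exists>i<k. 0 < w i \<and> leverage d k w z i = max_leverage d k w z k" using M by auto
qed

text \<open>The invariant of the filter and its progress. The loss of the weight \<open>i\<close> is proportional to
  \<open>w\<^sub>i\<close> times its leverage, so by \<open>outliers_dominate\<close> at most half of the total loss falls on \<open>g\<close>; the weight at which the maximal
  leverage is attained becomes \<open>0\<close>.\<close>

lemma downweight_step:
  fixes g \<nu> :: "nat \<Rightarrow> real" and r2 :: real
  assumes d: "1 \<le> d" and k: "1 \<le> k" and r2: "0 < r2" and spread: "spread_out d k (100 * r2) w z"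
    and w: "\<And>i. i < k \<Longrightarrow> w i \<le> 1" and g: "\<And>i. i < k \<Longrightarrow> 0 \<le> g i \<and> g i \<le> 1"
    and g_mass: "(\<Sum>i<k. 1 - g i) \<le> k / 60" and w_mass: "(\<Sum>i<k. 1 - w i) \<le> k / 30"
    and inliers: "(\<Sum>i<k. g i * P d (\<lambda>j. z i j - \<nu> j) (\<lambda>j. z i j - \<nu> j))
      \<le> 2 * (k * (r2 * psd_bilinear.trace d (P d)))"
    and centred: "\<And>j. j < d \<Longrightarrow> (\<Sum>i<k. w i * z i j) = 0"
    and inv: "(\<Sum>i<k. (1 - w i) * g i) \<le> (\<Sum>i<k. (1 - w i) * (1 - g i))"
  defines "w' \<equiv> downweight d k (100 * r2) w z"
  shows "(\<Sum>i<k. (1 - w' i) * g i) \<le> (\<Sum>i<k. (1 - w' i) * (1 - g i))"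
    and "card {i. i < k \<and> 0 < w' i} < card {i. i < k \<and> 0 < w i}"
proof -
  interpret Pd: psd_bilinear d "P d" by (rule psd_form)
  define \<tau> where "\<tau> = leverage d k w z"
  define M where "M = max_leverage d k w z k"
  have M: "0 < M" unfolding M_def using d r2 spread by (intro spread_out_max_leverage) auto
  have w': "w' i = w i - w i * \<tau> i / M" for i
    using spread by (simp add: w'_def downweight_def \<tau>_def M_def algebra_simps)
  have half: "2 * (\<Sum>i<k. g i * w i * \<tau> i) \<le> (\<Sum>i<k. w i * \<tau> i)"
    unfolding \<tau>_def leverage_def
  proof (rule Pd.outliers_dominate[where \<rho> = "r2 * Pd.trace" and \<nu> = \<nu>])
    show "100 * (r2 * Pd.trace) * (\<Sum>i<k. w i) \<le> (\<Sum>i<k. w i * P d (z i) (z i))"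
      using spread by (simp add: spread_out_iff[OF d] trace_Suc mult_ac)
  qed (use k r2 w w_nonneg g g_mass w_mass inliers centred psd_bilinear.trace_nonneg[OF psd_form] in auto)
  have "(\<Sum>i<k. (1 - w' i) * g i) = (\<Sum>i<k. (1 - w i) * g i) + (\<Sum>i<k. g i * w i * \<tau> i) / M"
    unfolding w' sum_divide_distrib sum.distrib[symmetric]
    by (intro sum.cong refl) (simp add: algebra_simps)
  moreover have "(\<Sum>i<k. (1 - w' i) * (1 - g i)) = (\<Sum>i<k. (1 - w i) * (1 - g i))
      + ((\<Sum>i<k. w i * \<tau> i) - (\<Sum>i<k. g i * w i * \<tau> i)) / M"
    unfolding w' sum_subtractf[symmetric] sum_divide_distrib sum.distrib[symmetric]
    by (intro sum.cong refl) (simp add: field_simps)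
  moreover have "(\<Sum>i<k. g i * w i * \<tau> i) / M \<le> ((\<Sum>i<k. w i * \<tau> i) - (\<Sum>i<k. g i * w i * \<tau> i)) / M"
    using half M by (intro divide_right_mono) auto
  ultimately show "(\<Sum>i<k. (1 - w' i) * g i) \<le> (\<Sum>i<k. (1 - w' i) * (1 - g i))" using inv by linarith
  obtain i where i: "i < k" "0 < w i" "\<tau> i = M"
    using spread_out_max_leverage(2)[OF d _ spread] r2 by (auto simp: \<tau>_def M_def)
  then have "w' i = 0" using M by (simp add: w')
  then have "i \<in> {i. i < k \<and> 0 < w i} - {i. i < k \<and> 0 < w' i}" using i by simp
  moreover have "w' j \<le> w j" if "j < k" for j
    unfolding w'_def using downweight_bounds[OF that] by blast
  then have "{i. i < k \<and> 0 < w' i} \<subseteq> {i. i < k \<and> 0 < w i}" by force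
  ultimately have "{i. i < k \<and> 0 < w' i} \<subset> {i. i < k \<and> 0 < w i}" by blast
  then show "card {i. i < k \<and> 0 < w' i} < card {i. i < k \<and> 0 < w i}" by (intro psubset_card_mono) auto
qed

end

text \<open>The forms that occur in the run do not depend on the good weights, so these can be chosen for all
  rounds together at the start of the analysis.\<close>

theorem filter_finds_centre:
  fixes y :: "nat \<Rightarrow> nat \<Rightarrow> real" and \<mu> :: "nat \<Rightarrow> real"
  assumes d: "1 \<le> d" and k: "1 \<le> k" and r: "0 < r"
    and far: "\<And>Q. psd_bilinear d Q \<Longrightarrow> psd_bilinear.trace d Q \<le> 1
      \<Longrightarrow> 60 * card {i. i < k \<and> r\<^sup>2 \<le> Q (\<lambda>j. y i j - \<mu> j) (\<lambda>j. y i j - \<mu> j)} \<le> k"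
    and run: "(filter_step d k (100 * r\<^sup>2) ^^ k) (\<lambda>_. 1, y, \<lambda>_. 0) = (w, z, c)"
  shows "ip d (\<lambda>j. \<mu> j - c j) (\<lambda>j. \<mu> j - c j) \<le> (21 * r)\<^sup>2"
proof -
  define step where "step = filter_step d k (100 * r\<^sup>2)"
  define st where "st t = (step ^^ t) (\<lambda>_. 1, y, \<lambda>_. 0)" for t
  define W where "W t = fst (st t)" for t
  define Z where "Z t = fst (snd (st t))" for t
  define X where "X t = snd (snd (st t))" for t
  define x where "x i = (\<lambda>j. y i j - \<mu> j)" for i
  have st_eq: "st t = (W t, Z t, X t)" for t by (simp add: W_def Z_def X_def)
  have st_Suc: "st (Suc t) = step (W t, Z t, X t)" for t using st_eq by (simp add: st_def)
  define m where "m t = mean k (W t) (Z t)" for t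
  have Z_Suc: "Z (Suc t) = (\<lambda>i j. Z t i j - m t j)"
    and X_Suc: "X (Suc t) = (\<lambda>j. X t j + m t j)"
    and W_Suc: "W (Suc t) = downweight d k (100 * r\<^sup>2) (W t) (Z (Suc t))" for t
    unfolding W_def[of "Suc t"] Z_def[of "Suc t"] X_def[of "Suc t"] st_Suc step_def m_def
    by (simp_all add: Let_def)
  have W0: "W 0 = (\<lambda>_. 1)" and Z0: "Z 0 = y" and X0: "X 0 = (\<lambda>_. 0)"
    by (simp_all add: W_def Z_def X_def st_def)
  have ZX: "Z t i j + X t j = y i j" for t i j
    by (induction t) (simp_all add: Z0 X0 Z_Suc X_Suc)
  have W01: "0 \<le> W t i \<and> W t i \<le> 1" if i: "i < k" for t i
    using i
  proof (induction t arbitrary: i)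
    case 0 then show ?case by (simp add: W0)
  next
    case (Suc t)
    have "weighted_points k (W t)" by unfold_locales (use Suc in blast)
    from weighted_points.downweight_bounds[OF this Suc.prems]
    have "0 \<le> W (Suc t) i \<and> W (Suc t) i \<le> W t i" unfolding W_Suc .
    then show ?case using Suc.IH[OF Suc.prems] by linarith
  qed
  have wp: "weighted_points k (W t)" for t by unfold_locales (use W01 in blast)
  define P where "P t = scatter_form d k (W t) (Z (Suc t)) d" for t
  have P: "psd_bilinear d (P t)" for t unfolding P_def by (rule weighted_points.psd_form[OF wp])
  define tr where "tr t = psd_bilinear.trace d (P t)" for t
  have tr: "0 \<le> tr t" for t unfolding tr_def by (rule psd_bilinear.trace_nonneg[OF P])
  have r2: "0 < r\<^sup>2" using r by simp
  have "\<exists>g. (\<forall>i<k. 0 \<le> g i \<and> g i \<le> 1) \<and> (\<Sum>i<k. 1 - g i) \<le> real k / 60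
      \<and> (\<forall>t<k. (\<Sum>i<k. g i * (1 / tr t * P t (x i) (x i))) \<le> 2 * (k * r\<^sup>2))"
  \<comment> \<open>A mixture of the normalised forms of the rounds is again a form of trace at most 1.
    A form of trace 0 is normalised to 0, since x / 0 = 0.\<close>
  proof (rule simultaneous_inlier_weights)
    show "0 \<le> 1 / tr t * P t (x i) (x i)" for t i
      using tr psd_bilinear.nonneg[OF P] by simp
    fix e :: "nat \<Rightarrow> real"
    assume e: "\<And>t. t < k \<Longrightarrow> 0 \<le> e t" and e1: "(\<Sum>t<k. e t) = 1"
    define Q where "Q a b = (\<Sum>t<k. (e t / tr t) * P t a b)" for a b
    have Q: "psd_bilinear d Q" unfolding Q_def
      using e tr by (intro psd_bilinear_combination P) auto
    have "psd_bilinear.trace d Q = (\<Sum>t<k. (e t / tr t) * tr t)"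
      unfolding Q_def tr_def using e tr by (intro trace_combination P) (auto simp: tr_def)
    also have "\<dots> \<le> (\<Sum>t<k. e t)" using e by (intro sum_mono) auto
    finally have "60 * card {i. i < k \<and> r\<^sup>2 \<le> Q (x i) (x i)} \<le> k"
      using far[OF Q] e1 by (simp add: x_def)
    moreover have "Q (x i) (x i) = (\<Sum>t<k. e t * (1 / tr t * P t (x i) (x i)))" for i
      by (simp add: Q_def)
    ultimately show "card {i. i < k \<and> r\<^sup>2 \<le> (\<Sum>t<k. e t * (1 / tr t * P t (x i) (x i)))} \<le> real k / 60"
      by simp
  qed (use r2 k in simp_all)
  then obtain g where g: "\<And>i. i < k \<Longrightarrow> 0 \<le> g i \<and> g i \<le> 1" and g_mass: "(\<Sum>i<k. 1 - g i) \<le> real k / 60"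
    and inlier: "\<And>t. t < k \<Longrightarrow> (\<Sum>i<k. g i * (1 / tr t * P t (x i) (x i))) \<le> 2 * (k * r\<^sup>2)"
    by blast
  \<comment> \<open>At least as much has been taken away from the complement of g as from g.\<close>
  define safe where "safe t \<longleftrightarrow> (\<Sum>i<k. (1 - W t i) * g i) \<le> (\<Sum>i<k. (1 - W t i) * (1 - g i))" for t
  have safe0: "safe 0" by (simp add: safe_def W0)
  have mass: "(\<Sum>i<k. 1 - W t i) \<le> real k / 30" if "safe t" for t
  proof -
    have "(\<Sum>i<k. 1 - W t i) = (\<Sum>i<k. (1 - W t i) * g i) + (\<Sum>i<k. (1 - W t i) * (1 - g i))"
      unfolding sum.distrib[symmetric] by (intro sum.cong refl) (simp add: algebra_simps)
    moreover have "(\<Sum>i<k. (1 - W t i) * (1 - g i)) \<le> (\<Sum>i<k. 1 * (1 - g i))"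
      by (intro sum_mono mult_right_mono) (use W01 g in auto)
    ultimately show ?thesis using that g_mass unfolding safe_def by simp
  qed
  have total: "0 < (\<Sum>i<k. W t i)" if "safe t" for t
    using mass[OF that] k by (simp add: sum_subtractf)
  have centred: "(\<Sum>i<k. W t i * Z (Suc t) i j) = 0" if "safe t" for t j
  proof -
    have "(\<Sum>i<k. W t i * Z (Suc t) i j) = (\<Sum>i<k. W t i * Z t i j) - (\<Sum>i<k. W t i) * m t j"
      unfolding Z_Suc sum_distrib_right sum_subtractf[symmetric]
      by (intro sum.cong refl) (simp add: algebra_simps)
    then show ?thesis using total[OF that] by (simp add: m_def mean_def)
  qed
  have x_Z: "(\<lambda>j. Z (Suc t) i j - (\<mu> j - X (Suc t) j)) = x i" for t i
    using ZX[of "Suc t" i] by (auto simp: x_def algebra_simps)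
  have progress: "safe (Suc t) \<and> card {i. i < k \<and> 0 < W (Suc t) i} < card {i. i < k \<and> 0 < W t i}"
    if t: "t < k" and i: "safe t" and spread: "spread_out d k (100 * r\<^sup>2) (W t) (Z (Suc t))" for t
  proof -
    interpret weighted_points d k "W t" "Z (Suc t)" by (rule wp)
    have "(\<Sum>i<k. g i * P t (x i) (x i)) \<le> tr t * (\<Sum>i<k. g i * (1 / tr t * P t (x i) (x i)))"
    proof (cases "tr t = 0")
      case True
      have "P t (x i) (x i) = 0" for i
        using psd_bilinear.le_trace[OF P, of t "x i"] psd_bilinear.nonneg[OF P, of t "x i"] True
        by (simp add: tr_def)
      then show ?thesis by simp
    qed (simp add: sum_distrib_left)
    also have "\<dots> \<le> tr t * (2 * (k * r\<^sup>2))" using inlier[OF t] tr by (intro mult_left_mono) auto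
    finally have "(\<Sum>i<k. g i * P t (x i) (x i)) \<le> 2 * (k * (r\<^sup>2 * tr t))" by (simp add: mult_ac)
    then have inliers: "(\<Sum>i<k. g i * P t (\<lambda>j. Z (Suc t) i j - (\<mu> j - X (Suc t) j))
        (\<lambda>j. Z (Suc t) i j - (\<mu> j - X (Suc t) j))) \<le> 2 * (k * (r\<^sup>2 * tr t))"
      unfolding x_Z .
    note * = downweight_step[OF d k r2 spread _ g g_mass mass[OF i]
        inliers[unfolded P_def tr_def] centred[OF i] i[unfolded safe_def], folded W_Suc]
    show ?thesis unfolding safe_def using *[OF conjunct2[OF W01]] by blast
  qed
  have "\<exists>t<k. safe t \<and> \<not> spread_out d k (100 * r\<^sup>2) (W t) (Z (Suc t))"
  proof (rule ccontr)
    assume *: "\<not> ?thesis"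
    have "t \<le> k \<Longrightarrow> safe t \<and> card {i. i < k \<and> 0 < W t i} + t \<le> k" for t
    proof (induction t)
      case 0
      have "card {i. i < k \<and> 0 < W 0 i} \<le> card {..<k}" by (intro card_mono) auto
      then show ?case using safe0 by simp
    next
      case (Suc t)
      then show ?case using progress[of t] * by fastforce
    qed
    from this[of k] have i: "safe k" and "card {i. i < k \<and> 0 < W k i} = 0" by auto
    then have "{i. i < k \<and> 0 < W k i} = {}" by (subst (asm) card_0_eq) auto
    then have "W k i \<le> 0" if "i < k" for i using that by (metis (no_types, lifting) empty_iff mem_Collect_eq not_le)
    then have "(\<Sum>i<k. W k i) \<le> 0" by (intro sum_nonpos) auto
    then show False using total[OF i] by simp
  qed
  then obtain t where t: "t < k" and i: "safe t"
    and stop: "\<not> spread_out d k (100 * r\<^sup>2) (W t) (Z (Suc t))" by blast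
  \<comment> \<open>After the first round t without effect the mean stays 0, so the state no longer changes.\<close>
  have W': "W (Suc t) = W t" using stop unfolding W_Suc by (simp add: downweight_def)
  have "m (Suc t) = (\<lambda>_. 0)" unfolding m_def mean_def W' using centred[OF i] by simp
  then have fixpoint: "st (Suc (Suc t)) = st (Suc t)"
    unfolding st_eq W_Suc[of "Suc t"] Z_Suc[of "Suc t"] X_Suc[of "Suc t"]
    using stop W' by (simp add: downweight_def)
  have stable: "st (Suc t + n) = st (Suc t)" for n
  proof (induction n)
    case (Suc n)
    have "st (Suc t + Suc n) = step (st (Suc t + n))" by (simp add: st_def)
    also have "\<dots> = st (Suc (Suc t))" unfolding Suc by (simp add: st_def)
    finally show ?case using fixpoint by simp
  qed simp
  have "st k = st (Suc t)" using stable[of "k - Suc t"] t by simp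
  moreover have "st k = (w, z, c)" using run by (simp only: st_def step_def)
  ultimately have "(w, z, c) = (W (Suc t), Z (Suc t), X (Suc t))" using st_eq[of "Suc t"] by simp
  then have c: "c = X (Suc t)" by simp
  interpret weighted_points d k "W t" "Z (Suc t)" by (rule wp)
  show ?thesis unfolding c
  proof (rule centre_of_concentrated_weights[OF k r])
    show "60 * card {i. i < k \<and> r\<^sup>2 \<le> Q (x i) (x i)} \<le> k"
      if "psd_bilinear d Q" "psd_bilinear.trace d Q \<le> 1" for Q
      using far[OF that] by (simp add: x_def)
    show "Z (Suc t) i j = x i j + (\<mu> j - X (Suc t) j)" for i j
      using fun_cong[OF x_Z[of t i], of j] by simp
    show "0 \<le> W t i \<and> W t i \<le> 1" if "i < k" for i by (rule W01[OF that])
    show "(\<Sum>i<k. 1 - W t i) \<le> real k / 30" by (rule mass[OF i])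
    show "(\<Sum>i<k. W t i * (ip d (Z (Suc t) i) (\<lambda>j. \<mu> j - X (Suc t) j))\<^sup>2)
        \<le> 2 * (100 * r\<^sup>2 * (\<Sum>i<k. W t i)) * ip d (\<lambda>j. \<mu> j - X (Suc t) j) (\<lambda>j. \<mu> j - X (Suc t) j)"
    proof (rule trace_ratio_bounds_variance[OF d])
      show "0 < 100 * r\<^sup>2 * (\<Sum>i<k. W t i)" using r2 total[OF i] by simp
      show "psd_bilinear.trace d (scatter_form d k (W t) (Z (Suc t)) (Suc d))
          \<le> 100 * r\<^sup>2 * (\<Sum>i<k. W t i) * psd_bilinear.trace d (scatter_form d k (W t) (Z (Suc t)) d)"
        using stop spread_out_iff[OF d] by (simp only: not_less)
    qed
  qed
qed

section \<open>Programs with postconditions and time bounds\<close>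

text \<open>Total correctness with a bound on the running time, for one initial state: a
  postcondition can refer to this state, and facts about it stay available.\<close>

definition runs :: "program \<Rightarrow> state \<Rightarrow> nat \<Rightarrow> (state \<Rightarrow> bool) \<Rightarrow> bool" where
  "runs P s T Q \<longleftrightarrow> (\<exists>t s'. exec P s t s' \<and> t \<le> T \<and> Q s')"

lemma runs_mono: "runs P s T Q \<Longrightarrow> T \<le> T' \<Longrightarrow> (\<And>s'. Q s' \<Longrightarrow> Q' s') \<Longrightarrow> runs P s T' Q'"
  unfolding runs_def by (meson le_trans)

lemma runs_Skip: "Q s \<Longrightarrow> 1 \<le> T \<Longrightarrow> runs Skip s T Q"
  unfolding runs_def using exec_Skip by blast

lemma runs_Seq:
  assumes "runs P s T Q'" "\<And>s'. Q' s' \<Longrightarrow> runs P' s' T' Q" "T + T' \<le> T''"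
  shows "runs (Seq P P') s T'' Q"
proof -
  obtain t s' where 1: "exec P s t s'" "t \<le> T" "Q' s'" using assms(1) by (auto simp: runs_def)
  obtain t' s'' where 2: "exec P' s' t' s''" "t' \<le> T'" "Q s''" using assms(2)[OF 1(3)] by (auto simp: runs_def)
  have "exec (Seq P P') s (t + t') s''" by (rule exec_Seq[OF 1(1) 2(1)])
  moreover have "t + t' \<le> T''" using 1 2 assms(3) by linarith
  ultimately show ?thesis using 2 by (auto simp: runs_def)
qed

lemma runs_Cond:
  assumes "holds c s \<Longrightarrow> runs P s T Q" "\<not> holds c s \<Longrightarrow> runs P' s T Q" "Suc T \<le> T'"
  shows "runs (Cond c P P') s T' Q"
proof (cases "holds c s")
  case True
  then obtain t s' where "exec P s t s'" "t \<le> T" "Q s'" using assms(1) by (auto simp: runs_def)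
  then show ?thesis using exec_Cond_True[OF True, of P t s' P'] assms(3)
    unfolding runs_def by (intro exI[of _ "1 + t"] exI[of _ s']) auto
next
  case False
  then obtain t s' where "exec P' s t s'" "t \<le> T" "Q s'" using assms(2) by (auto simp: runs_def)
  then show ?thesis using exec_Cond_False[OF False, of P' t s' P] assms(3)
    unfolding runs_def by (intro exI[of _ "1 + t"] exI[of _ s']) auto
qed

text \<open>A loop that is executed exactly \<open>n\<close> times; the invariant \<open>I i\<close> holds before round \<open>i\<close>.\<close>

lemma runs_Loop:
  assumes init: "I 0 s"
    and body: "\<And>i s. i < n \<Longrightarrow> I i s \<Longrightarrow> holds c s \<and> runs B s T (I (Suc i))"
    and exit: "\<And>s. I n s \<Longrightarrow> \<not> holds c s"
    and time: "n * (T + 1) + 1 \<le> T'"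
  shows "runs (Loop c B) s T' (I n)"
proof -
  have "runs (Loop c B) s (m * (T + 1) + 1) (I n)" if "I i s" "i + m = n" for i m s
    using that
  proof (induction m arbitrary: i s)
    case 0
    then have "\<not> holds c s" using exit by simp
    then show ?case using 0 exec_Loop_False unfolding runs_def by fastforce
  next
    case (Suc m)
    then have h: "holds c s" and "runs B s T (I (Suc i))" using body[of i s] by auto
    then obtain t s' where 1: "exec B s t s'" "t \<le> T" "I (Suc i) s'" by (auto simp: runs_def)
    then have "runs (Loop c B) s' (m * (T + 1) + 1) (I n)" using Suc by simp
    then obtain t' s'' where 2: "exec (Loop c B) s' t' s''" "t' \<le> m * (T + 1) + 1" "I n s''"
      by (auto simp: runs_def)
    have "exec (Loop c B) s (1 + t + t') s''" by (rule exec_Loop_True[OF h 1(1) 2(1)])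
    moreover have "1 + t + t' \<le> Suc m * (T + 1) + 1" using 1 2 by simp
    ultimately show ?case using 2 unfolding runs_def by blast
  qed
  then show ?thesis using init time by (meson add_0 runs_mono)
qed

fun block :: "instr list \<Rightarrow> program" where
  "block [] = Skip"
| "block (i # is) = Seq (Do i) (block is)"

lemma runs_block: "Q (fold step is s) \<Longrightarrow> length is + 1 \<le> T \<Longrightarrow> runs (block is) s T Q"
proof (induction "is" arbitrary: s T)
  case Nil
  then show ?case by (simp add: runs_Skip)
next
  case (Cons i "is")
  have "runs (Do i) s 1 (\<lambda>s'. s' = step i s)" unfolding runs_def using exec_Do by blast
  then show ?case unfolding block.simps
    by (rule runs_Seq[where T' = "length is + 1"]) (use Cons in auto)
qed

text \<open>The memory as a sequence of rows of length \<open>d\<close>. Points, weights and intermediate vectors occupy rows, and the index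
  registers contain multiples of \<open>d\<close>, so that no multiplication of indices is needed. A
  row is extended by \<open>0\<close> to a total function; then updates of rows are equations between functions.\<close>

definition memrow :: "nat \<Rightarrow> state \<Rightarrow> nat \<Rightarrow> nat \<Rightarrow> real" where
  "memrow d s n = (\<lambda>j. if j < d then mem s (n * d + j) else 0)"

lemma memrow_idx [simp]: "memrow d (s\<lparr>idx := f\<rparr>) = memrow d s"
  and memrow_reg [simp]: "memrow d (s\<lparr>reg := g\<rparr>) = memrow d s"
  by (simp_all add: memrow_def fun_eq_iff)

lemma address_eq_iff:
  fixes d :: nat
  assumes "j < d" "j' < d"
  shows "n * d + j = n' * d + j' \<longleftrightarrow> n = n' \<and> j = j'"
proof
  assume eq: "n * d + j = n' * d + j'"
  have "(n * d + j) div d = n" "(n' * d + j') div d = n'" using assms by auto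
  then have "n = n'" using eq by simp
  then show "n = n' \<and> j = j'" using eq by simp
qed simp

lemma memrow_store:
  assumes "a = n * d + j" "j < d"
  shows "memrow d (s\<lparr>mem := (mem t)(a := v)\<rparr>) = (memrow d t)(n := (memrow d t n)(j := v))"
proof (intro ext)
  fix n' j'
  show "memrow d (s\<lparr>mem := (mem t)(a := v)\<rparr>) n' j' = ((memrow d t)(n := (memrow d t n)(j := v))) n' j'"
    using assms address_eq_iff[of j' d j n' n] by (auto simp: memrow_def)
qed

lemma mem_memrow: "j < d \<Longrightarrow> mem s (n * d + j) = memrow d s n j"
  by (simp add: memrow_def)

definition frame :: "nat set \<Rightarrow> nat set \<Rightarrow> state \<Rightarrow> state \<Rightarrow> bool" where
  "frame I R s s' \<longleftrightarrow> (\<forall>a. a \<notin> I \<longrightarrow> idx s' a = idx s a) \<and> (\<forall>a. a \<notin> R \<longrightarrow> reg s' a = reg s a)"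

text \<open>The row at \<open>q\<close> becomes \<open>a\<close> times itself plus \<open>b\<close> times the row at \<open>p\<close>, with coefficients in real
  registers. Coefficients \<open>0\<close> and \<open>1\<close> make this also the way to clear and to copy a row.\<close>

definition axpy :: "nat \<Rightarrow> nat \<Rightarrow> nat \<Rightarrow> nat \<Rightarrow> program" where
  "axpy q p a b = Seq (block [NAdd 22 p 2, NAdd 23 q 2, NAdd 24 q 0])
    (Loop (NLess 23 24) (block [RLoad 22 22, RLoad 23 23, RMul 22 22 b, RMul 23 23 a,
       RAdd 23 23 22, RStore 23 23, NAdd 22 22 3, NAdd 23 23 3]))"

definition dot :: "nat \<Rightarrow> nat \<Rightarrow> program" where
  "dot p q = Seq (block [NAdd 22 p 2, NAdd 23 q 2, NAdd 24 q 0, RSub 24 24 24])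
    (Loop (NLess 23 24) (block [RLoad 22 22, RLoad 23 23, RMul 22 22 23, RAdd 24 24 22,
       NAdd 22 22 3, NAdd 23 23 3]))"

text \<open>The body is executed for the first \<open>k\<close> rows, with the address of the current row in the index register
  \<open>p\<close>.\<close>

definition rows :: "nat \<Rightarrow> program \<Rightarrow> program" where
  "rows p B = Seq (block [NAdd p 2 2]) (Loop (NLess p 4) (Seq B (block [NAdd p p 0])))"

locale ram =
  fixes d k :: nat and R :: real
  assumes d: "1 \<le> d" and k: "1 \<le> k"
begin

text \<open>The registers that are constant once they have been set up. With \<open>k\<close> points, rows \<open>0\<close> to
  \<open>k - 1\<close> hold the translated points, the next \<open>k\<close> rows the weights and the next \<open>k\<close> rows the leverages (in
  coordinate \<open>0\<close>); row \<open>3 k\<close> accumulates the translations, and rows \<open>3 k + 1\<close> and \<open>3 k + 2\<close> are vectors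
  for intermediate results.\<close>

definition env :: "state \<Rightarrow> bool" where
  "env s \<longleftrightarrow> idx s 0 = d \<and> idx s 1 = k \<and> idx s 2 = 0 \<and> idx s 3 = 1 \<and> idx s 4 = k * d
     \<and> idx s 5 = 3 * k * d \<and> idx s 6 = (3 * k + 1) * d \<and> idx s 7 = (3 * k + 2) * d
     \<and> reg s 2 = 1 \<and> reg s 3 = 0 \<and> reg s 4 = R"

lemma env_frame:
  assumes "env s" "frame I J s s'" "I \<inter> {0,1,2,3,4,5,6,7} = {}" "J \<inter> {2,3,4} = {}"
  shows "env s'"
proof -
  have "a \<notin> I" if "a \<in> {0,1,2,3,4,5,6,7}" for a using assms(3) that by blast
  moreover have "a \<notin> J" if "a \<in> {2,3,4}" for a using assms(4) that by blast
  ultimately show ?thesis using assms(1,2) unfolding env_def frame_def by simp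
qed

text \<open>Both entries are loaded before the result is stored, so the rows \<open>n\<close> and \<open>m\<close> may coincide.\<close>

lemma runs_axpy:
  assumes env: "env s" and q: "idx s q = n * d" and p: "idx s p = m * d"
    and regs: "q \<notin> {22,23,24}" "p \<notin> {22,23,24}" "a \<notin> {22,23}" "b \<notin> {22,23}"
  shows "runs (axpy q p a b) s (20 * d) (\<lambda>s'. frame {22,23,24} {22,23} s s'
    \<and> memrow d s' = (memrow d s)(n := (\<lambda>j. reg s a * memrow d s n j + reg s b * memrow d s m j)))"
  unfolding axpy_def
proof (rule runs_Seq)
  define I where "I i s' \<longleftrightarrow> frame {22,23,24} {22,23} s s' \<and> idx s' 22 = m * d + i \<and> idx s' 23 = n * d + i
    \<and> idx s' 24 = n * d + d
    \<and> memrow d s' = (memrow d s)(n := (\<lambda>j. if j < i then reg s a * memrow d s n j + reg s b * memrow d s m j else memrow d s n j))" for i s'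
  show "runs (block [NAdd 22 p 2, NAdd 23 q 2, NAdd 24 q 0]) s 4 (I 0)"
    by (rule runs_block) (use regs env q p in \<open>auto simp: I_def frame_def env_def\<close>)
  fix s1 assume "I 0 s1"
  then show "runs (Loop (NLess 23 24) (block [RLoad 22 22, RLoad 23 23, RMul 22 22 b, RMul 23 23 a,
       RAdd 23 23 22, RStore 23 23, NAdd 22 22 3, NAdd 23 23 3])) s1 (d * (9 + 1) + 1) (\<lambda>s'. frame {22,23,24} {22,23} s s'
    \<and> memrow d s' = (memrow d s)(n := (\<lambda>j. reg s a * memrow d s n j + reg s b * memrow d s m j)))"
  proof (rule runs_mono[OF runs_Loop[where I = I and n = d and T = 9, OF _ _ _ order.refl]])
    fix i s' assume i: "i < d" and I: "I i s'"
    have e: "env s'" by (rule env_frame[OF env]) (use I in \<open>auto simp: I_def\<close>)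
    have ab: "reg s' a = reg s a" "reg s' b = reg s b" using I regs by (auto simp: I_def frame_def)
    have vals: "mem s' (m * d + i) = memrow d s m i" "mem s' (n * d + i) = memrow d s n i"
      using I i by (auto simp: I_def mem_memrow)
    show "holds (NLess 23 24) s' \<and> runs (block [RLoad 22 22, RLoad 23 23, RMul 22 22 b, RMul 23 23 a,
       RAdd 23 23 22, RStore 23 23, NAdd 22 22 3, NAdd 23 23 3]) s' 9 (I (Suc i))"
    proof (intro conjI runs_block)
      show "holds (NLess 23 24) s'" using I i by (simp add: I_def)
      have fr: "frame {22,23,24} {22,23} s s'" and ix: "idx s' 22 = m * d + i" "idx s' 23 = n * d + i" "idx s' 24 = n * d + d"
        and rw: "memrow d s' = (memrow d s)(n := (\<lambda>j. if j < i then reg s a * memrow d s n j + reg s b * memrow d s m j else memrow d s n j))"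
        using I by (auto simp: I_def)
      have e3: "idx s' 3 = 1" using e by (simp add: env_def)
      show "I (Suc i) (fold step [RLoad 22 22, RLoad 23 23, RMul 22 22 b, RMul 23 23 a,
         RAdd 23 23 22, RStore 23 23, NAdd 22 22 3, NAdd 23 23 3] s')"
        unfolding I_def
        using fr regs by (auto simp: ix e3 vals ab memrow_store[OF refl i] rw frame_def fun_eq_iff less_Suc_eq)
    qed simp
  qed (auto simp: I_def memrow_def fun_eq_iff)
next
  show "4 + (d * (9 + 1) + 1) \<le> 20 * d" using d by simp
qed

lemma runs_dot:
  assumes env: "env s" and q: "idx s q = n * d" and p: "idx s p = m * d"
    and regs: "q \<notin> {22,23,24}" "p \<notin> {22,23,24}"
  shows "runs (dot p q) s (20 * d) (\<lambda>s'. frame {22,23,24} {22,23,24} s s'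
    \<and> memrow d s' = memrow d s \<and> reg s' 24 = ip d (memrow d s m) (memrow d s n))"
  unfolding dot_def
proof (rule runs_Seq)
  define I where "I i s' \<longleftrightarrow> frame {22,23,24} {22,23,24} s s' \<and> idx s' 22 = m * d + i \<and> idx s' 23 = n * d + i
    \<and> idx s' 24 = n * d + d \<and> memrow d s' = memrow d s \<and> reg s' 24 = ip i (memrow d s m) (memrow d s n)" for i s'
  show "runs (block [NAdd 22 p 2, NAdd 23 q 2, NAdd 24 q 0, RSub 24 24 24]) s 5 (I 0)"
    by (rule runs_block) (use regs env q p in \<open>auto simp: I_def frame_def env_def ip_def\<close>)
  fix s1 assume "I 0 s1"
  then show "runs (Loop (NLess 23 24) (block [RLoad 22 22, RLoad 23 23, RMul 22 22 23, RAdd 24 24 22,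
       NAdd 22 22 3, NAdd 23 23 3])) s1 (d * (7 + 1) + 1) (\<lambda>s'. frame {22,23,24} {22,23,24} s s'
    \<and> memrow d s' = memrow d s \<and> reg s' 24 = ip d (memrow d s m) (memrow d s n))"
  proof (rule runs_mono[OF runs_Loop[where I = I and n = d and T = 7, OF _ _ _ order.refl]])
    fix i s' assume i: "i < d" and I: "I i s'"
    have e: "env s'" by (rule env_frame[OF env]) (use I in \<open>auto simp: I_def\<close>)
    have vals: "mem s' (m * d + i) = memrow d s m i" "mem s' (n * d + i) = memrow d s n i"
      using I i by (auto simp: I_def mem_memrow)
    show "holds (NLess 23 24) s' \<and> runs (block [RLoad 22 22, RLoad 23 23, RMul 22 22 23, RAdd 24 24 22,
       NAdd 22 22 3, NAdd 23 23 3]) s' 7 (I (Suc i))"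
    proof (intro conjI runs_block)
      show "holds (NLess 23 24) s'" using I i by (simp add: I_def)
      show "I (Suc i) (fold step [RLoad 22 22, RLoad 23 23, RMul 22 22 23, RAdd 24 24 22,
       NAdd 22 22 3, NAdd 23 23 3] s')"
        using I e by (auto simp: I_def vals env_def frame_def ip_def)
    qed simp
  qed (auto simp: I_def)
next
  show "5 + (d * (7 + 1) + 1) \<le> 20 * d" using d by simp
qed

text \<open>The rule accounts for the loop register \<open>p\<close> itself; so the invariant \<open>J\<close> is demanded of the state in which
  this register already points to the next row.\<close>

lemma runs_rows:
  assumes env: "env s" and p: "7 < p"
    and init: "J 0 (s\<lparr>idx := (idx s)(p := 0)\<rparr>)"
    and body: "\<And>i s. i < k \<Longrightarrow> env s \<Longrightarrow> idx s p = i * d \<Longrightarrow> J i s \<Longrightarrow>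
      runs B s T (\<lambda>s'. env s' \<and> idx s' p = i * d \<and> J (Suc i) (s'\<lparr>idx := (idx s')(p := Suc i * d)\<rparr>))"
    and time: "k * (T + 3) + 3 \<le> T'"
  shows "runs (rows p B) s T' (\<lambda>s'. env s' \<and> J k s')"
  unfolding rows_def
proof (rule runs_Seq)
  define I where "I i s' \<longleftrightarrow> env s' \<and> idx s' p = i * d \<and> J i s'" for i s'
  have z: "idx s 2 = 0" using env by (simp add: env_def)
  show "runs (block [NAdd p 2 2]) s 2 (I 0)"
    by (rule runs_block) (use env p init in \<open>auto simp: I_def env_def\<close>)
  fix s1 assume "I 0 s1"
  then show "runs (Loop (NLess p 4) (Seq B (block [NAdd p p 0]))) s1 (k * (T + 2 + 1) + 1) (\<lambda>s'. env s' \<and> J k s')"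
  proof (rule runs_mono[OF runs_Loop[where I = I and n = k and T = "T + 2", OF _ _ _ order.refl]])
    fix i s assume i: "i < k" and I: "I i s"
    have "holds (NLess p 4) s" using I i d by (simp add: I_def env_def)
    moreover have "runs (Seq B (block [NAdd p p 0])) s (T + 2) (I (Suc i))"
    proof (rule runs_Seq[OF body[OF i]])
      show "env s" "idx s p = i * d" "J i s" using I by (auto simp: I_def)
      fix s' assume s': "env s' \<and> idx s' p = i * d \<and> J (Suc i) (s'\<lparr>idx := (idx s')(p := Suc i * d)\<rparr>)"
      show "runs (block [NAdd p p 0]) s' 2 (I (Suc i))"
        by (rule runs_block) (use s' p in \<open>auto simp: I_def env_def add.commute\<close>)
    qed simp
    ultimately show "holds (NLess p 4) s \<and> runs (Seq B (block [NAdd p p 0])) s (T + 2) (I (Suc i))" by simp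
  qed (auto simp: I_def env_def)
next
  show "2 + (k * (T + 2 + 1) + 1) \<le> T'" using time by (simp add: algebra_simps)
qed

end

section \<open>The filter as a program\<close>

text \<open>Translates the points by minus their weighted mean and leaves the total weight in real register 5.\<close>

definition recentre :: program where
  "recentre = Seq (block [RSub 5 5 5]) (Seq (axpy 6 6 3 3)
     (Seq (rows 9 (Seq (block [NAdd 10 9 4, RLoad 11 10, RAdd 5 5 11]) (axpy 6 9 2 11)))
     (Seq (block [RDiv 11 2 5, RSub 12 3 11]) (Seq (axpy 5 6 2 11) (rows 9 (axpy 9 6 2 12))))))"

text \<open>Replaces row \<open>3 k + 1\<close> by its image under the scatter operator, using row \<open>3 k + 2\<close> to collect the sum.\<close>

definition apply_scatter :: program where
  "apply_scatter = Seq (axpy 7 7 3 3)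
     (Seq (rows 12 (Seq (dot 12 6) (Seq (block [NAdd 13 12 4, RLoad 11 13, RMul 11 11 24]) (axpy 7 12 2 11))))
       (axpy 6 7 3 2))"

text \<open>Applies the scatter operator \<open>d\<close> times. Real register 9 is overwritten in every round with the inner
  product of \<open>z\<^sub>i\<close> and the current vector before that round, so that in the end it belongs to the
  exponent \<open>d - 1\<close>, as needed for the trace of \<open>A\<^sup>d\<close>.\<close>

definition apply_scatter_power :: program where
  "apply_scatter_power = Seq (block [NAdd 11 2 2])
     (Loop (NLess 11 0) (Seq (Seq (dot 9 6) (block [RAdd 9 24 3])) (Seq apply_scatter (block [NAdd 11 11 3]))))"

context ram begin

definition stores :: "(nat \<Rightarrow> real) \<Rightarrow> (nat \<Rightarrow> nat \<Rightarrow> real) \<Rightarrow> (nat \<Rightarrow> real) \<Rightarrow> state \<Rightarrow> bool" where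
  "stores w z c s \<longleftrightarrow> (\<forall>i<k. memrow d s i = z i) \<and> (\<forall>i<k. memrow d s (k + i) 0 = w i) \<and> memrow d s (3 * k) = c"

lemma mem_head: "mem s (n * d) = memrow d s n 0"
  using mem_memrow[of 0 d s n] d by simp

lemma memrow_store_head:
  "a = n * d \<Longrightarrow> memrow d (s\<lparr>mem := (mem t)(a := v)\<rparr>) = (memrow d t)(n := (memrow d t n)(0 := v))"
  using memrow_store[of a n d 0] d by simp

lemma le_kd: "1 \<le> k * d" "k \<le> k * d" "d \<le> k * d"
  using d k by (cases k; cases d; simp)+

lemma runs_apply_scatter:
  assumes env: "env s" and stores: "stores w z c s"
  shows "runs apply_scatter s (100 * (k * d)) (\<lambda>s'. frame {12,13,22,23,24} {11,22,23,24} s s'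
    \<and> memrow d s' = (memrow d s)(3 * k + 1 := scatter d k w z (memrow d s (3 * k + 1)),
         3 * k + 2 := scatter d k w z (memrow d s (3 * k + 1))))"
  unfolding apply_scatter_def
proof (rule runs_Seq)
  define u where "u = memrow d s (3 * k + 1)"
  define J where "J i s' \<longleftrightarrow> frame {12,13,22,23,24} {11,22,23,24} s s'
    \<and> memrow d s' = (memrow d s)(3 * k + 2 := (\<lambda>j. \<Sum>l<i. w l * ip d (z l) u * z l j))" for i s'
  show "runs (axpy 7 7 3 3) s (20 * d) (\<lambda>s'. frame {22,23,24} {22,23} s s' \<and> memrow d s' = (memrow d s)(3 * k + 2 := (\<lambda>_. 0)))"
    by (rule runs_mono[OF runs_axpy[OF env, where n = "3 * k + 2" and m = "3 * k + 2"]])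
       (use env in \<open>simp_all add: env_def\<close>)
  fix s1 assume s1: "frame {22,23,24} {22,23} s s1 \<and> memrow d s1 = (memrow d s)(3 * k + 2 := (\<lambda>_. 0))"
  have env1: "env s1" by (rule env_frame[OF env conjunct1[OF s1]]) auto
  show "runs (Seq (rows 12 (Seq (dot 12 6) (Seq (block [NAdd 13 12 4, RLoad 11 13, RMul 11 11 24]) (axpy 7 12 2 11))))
       (axpy 6 7 3 2)) s1 (80 * (k * d)) (\<lambda>s'. frame {12,13,22,23,24} {11,22,23,24} s s'
    \<and> memrow d s' = (memrow d s)(3 * k + 1 := scatter d k w z (memrow d s (3 * k + 1)),
         3 * k + 2 := scatter d k w z (memrow d s (3 * k + 1))))"
  proof (rule runs_Seq)
    show "runs (rows 12 (Seq (dot 12 6) (Seq (block [NAdd 13 12 4, RLoad 11 13, RMul 11 11 24]) (axpy 7 12 2 11))))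
      s1 (k * ((40 * d + 4) + 3) + 3) (\<lambda>s'. env s' \<and> J k s')"
    proof (rule runs_rows[OF env1, where J = J and T = "40 * d + 4"])
      show "J 0 (s1\<lparr>idx := (idx s1)(12 := 0)\<rparr>)"
        using s1 by (auto simp: J_def frame_def)
      fix i s2 assume i: "i < k" and e2: "env s2" and p: "idx s2 12 = i * d" and J2: "J i s2"
      have fr2: "frame {12,13,22,23,24} {11,22,23,24} s s2"
        and rw2: "memrow d s2 = (memrow d s)(3 * k + 2 := (\<lambda>j. \<Sum>l<i. w l * ip d (z l) u * z l j))"
        using J2 by (auto simp: J_def)
      have r2: "memrow d s2 i = z i" "memrow d s2 (k + i) 0 = w i" "memrow d s2 (3 * k + 1) = u"
        using stores i by (auto simp: rw2 stores_def u_def)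
      show "runs (Seq (dot 12 6) (Seq (block [NAdd 13 12 4, RLoad 11 13, RMul 11 11 24]) (axpy 7 12 2 11))) s2 (40 * d + 4)
        (\<lambda>s'. env s' \<and> idx s' 12 = i * d \<and> J (Suc i) (s'\<lparr>idx := (idx s')(12 := Suc i * d)\<rparr>))"
      proof (rule runs_Seq)
        show "runs (dot 12 6) s2 (20 * d) (\<lambda>s'. frame {22,23,24} {22,23,24} s2 s' \<and> memrow d s' = memrow d s2
            \<and> reg s' 24 = ip d (memrow d s2 i) (memrow d s2 (3 * k + 1)))"
          by (rule runs_dot[OF e2]) (use e2 p in \<open>simp_all add: env_def\<close>)
        fix s3 assume s3: "frame {22,23,24} {22,23,24} s2 s3 \<and> memrow d s3 = memrow d s2
            \<and> reg s3 24 = ip d (memrow d s2 i) (memrow d s2 (3 * k + 1))"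
        have e3: "env s3" by (rule env_frame[OF e2 conjunct1[OF s3]]) auto
        have p3: "idx s3 12 = i * d" using s3 p by (simp add: frame_def)
        show "runs (Seq (block [NAdd 13 12 4, RLoad 11 13, RMul 11 11 24]) (axpy 7 12 2 11)) s3 (20 * d + 4)
          (\<lambda>s'. env s' \<and> idx s' 12 = i * d \<and> J (Suc i) (s'\<lparr>idx := (idx s')(12 := Suc i * d)\<rparr>))"
        proof (rule runs_Seq)
          have "idx s3 12 + idx s3 4 = (k + i) * d" using e3 p3 by (simp add: env_def algebra_simps)
          then have w: "mem s3 (idx s3 12 + idx s3 4) = w i" using s3 r2 by (simp add: mem_head)
          show "runs (block [NAdd 13 12 4, RLoad 11 13, RMul 11 11 24]) s3 4 (\<lambda>s'. frame {13} {11} s3 s'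
              \<and> memrow d s' = memrow d s2 \<and> reg s' 11 = w i * ip d (z i) u)"
            by (rule runs_block) (use s3 r2 w in \<open>simp_all add: frame_def\<close>)
          fix s4 assume s4: "frame {13} {11} s3 s4 \<and> memrow d s4 = memrow d s2 \<and> reg s4 11 = w i * ip d (z i) u"
          have e4: "env s4" by (rule env_frame[OF e3 conjunct1[OF s4]]) auto
          have p4: "idx s4 12 = i * d" using s4 p3 by (simp add: frame_def)
          have "runs (axpy 7 12 2 11) s4 (20 * d) (\<lambda>s'. frame {22,23,24} {22,23} s4 s' \<and> memrow d s'
             = (memrow d s4)(3 * k + 2 := (\<lambda>j. reg s4 2 * memrow d s4 (3 * k + 2) j + reg s4 11 * memrow d s4 i j)))"
            by (rule runs_axpy[OF e4]) (use e4 p4 in \<open>simp_all add: env_def\<close>)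
          then show "runs (axpy 7 12 2 11) s4 (20 * d)
            (\<lambda>s'. env s' \<and> idx s' 12 = i * d \<and> J (Suc i) (s'\<lparr>idx := (idx s')(12 := Suc i * d)\<rparr>))"
          proof (rule runs_mono)
            fix s5 assume s5: "frame {22,23,24} {22,23} s4 s5 \<and> memrow d s5
             = (memrow d s4)(3 * k + 2 := (\<lambda>j. reg s4 2 * memrow d s4 (3 * k + 2) j + reg s4 11 * memrow d s4 i j))"
            have "env s5" by (rule env_frame[OF e4 conjunct1[OF s5]]) auto
            moreover have "idx s5 12 = i * d" using s5 p4 by (simp add: frame_def)
            moreover have "frame {12,13,22,23,24} {11,22,23,24} s s5"
              using fr2 s3 s4 s5 by (simp add: frame_def)
            moreover have "memrow d s5 = (memrow d s)(3 * k + 2 := (\<lambda>j. \<Sum>l<Suc i. w l * ip d (z l) u * z l j))"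
              using s5 s4 r2 e4 i by (simp add: env_def rw2 fun_eq_iff)
            ultimately show "env s5 \<and> idx s5 12 = i * d \<and> J (Suc i) (s5\<lparr>idx := (idx s5)(12 := Suc i * d)\<rparr>)"
              by (simp add: J_def) (simp add: frame_def)
          qed simp
        qed simp
      qed simp
    qed simp_all
    fix s2 assume s2: "env s2 \<and> J k s2"
    then have "runs (axpy 6 7 3 2) s2 (20 * d) (\<lambda>s'. frame {22,23,24} {22,23} s2 s' \<and> memrow d s'
             = (memrow d s2)(3 * k + 1 := (\<lambda>j. reg s2 3 * memrow d s2 (3 * k + 1) j + reg s2 2 * memrow d s2 (3 * k + 2) j)))"
      by (intro runs_axpy) (simp_all add: env_def)
    then show "runs (axpy 6 7 3 2) s2 (20 * d) (\<lambda>s'. frame {12,13,22,23,24} {11,22,23,24} s s'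
      \<and> memrow d s' = (memrow d s)(3 * k + 1 := scatter d k w z (memrow d s (3 * k + 1)),
         3 * k + 2 := scatter d k w z (memrow d s (3 * k + 1))))"
      by (rule runs_mono) (use s2 in \<open>simp_all add: J_def frame_def env_def scatter_def u_def fun_eq_iff\<close>)
  next
    have "k * (40 * d + 4 + 3) = 40 * (k * d) + 7 * k" by (simp add: algebra_simps)
    then show "k * (40 * d + 4 + 3) + 3 + 20 * d \<le> 80 * (k * d)" using le_kd by linarith
  qed
next
  show "20 * d + 80 * (k * d) \<le> 100 * (k * d)" using le_kd by linarith
qed

lemma runs_apply_scatter_power:
  assumes env: "env s" and stores: "stores w z c s" and p: "idx s 9 = i * d" and i: "i < k"
    and u: "memrow d s (3 * k + 1) = z i"
  shows "runs apply_scatter_power s (200 * (k * d * d))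
    (\<lambda>s'. frame {11,12,13,22,23,24} {9,11,22,23,24} s s'
      \<and> (\<forall>n. n \<noteq> 3 * k + 1 \<and> n \<noteq> 3 * k + 2 \<longrightarrow> memrow d s' n = memrow d s n)
      \<and> memrow d s' (3 * k + 1) = (scatter d k w z ^^ d) (z i)
      \<and> reg s' 9 = scatter_form d k w z (d - 1) (z i) (z i))"
  unfolding apply_scatter_power_def
proof (rule runs_Seq)
  define I where "I n s' \<longleftrightarrow> frame {11,12,13,22,23,24} {9,11,22,23,24} s s' \<and> idx s' 11 = n
      \<and> (\<forall>n. n \<noteq> 3 * k + 1 \<and> n \<noteq> 3 * k + 2 \<longrightarrow> memrow d s' n = memrow d s n)
      \<and> memrow d s' (3 * k + 1) = (scatter d k w z ^^ n) (z i)
      \<and> (0 < n \<longrightarrow> reg s' 9 = scatter_form d k w z (n - 1) (z i) (z i))" for n s'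
  show "runs (block [NAdd 11 2 2]) s 2 (I 0)"
    by (rule runs_block) (use env u in \<open>simp_all add: I_def frame_def env_def\<close>)
  fix s1 assume "I 0 s1"
  then show "runs (Loop (NLess 11 0) (Seq (Seq (dot 9 6) (block [RAdd 9 24 3])) (Seq apply_scatter (block [NAdd 11 11 3]))))
     s1 (d * ((20 * d + 4 + 100 * (k * d)) + 1) + 1) (\<lambda>s'. frame {11,12,13,22,23,24} {9,11,22,23,24} s s'
      \<and> (\<forall>n. n \<noteq> 3 * k + 1 \<and> n \<noteq> 3 * k + 2 \<longrightarrow> memrow d s' n = memrow d s n)
      \<and> memrow d s' (3 * k + 1) = (scatter d k w z ^^ d) (z i)
      \<and> reg s' 9 = scatter_form d k w z (d - 1) (z i) (z i))"
  proof (rule runs_mono[OF runs_Loop[where I = I and n = d, OF _ _ _ order.refl]])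
    fix n s2 assume n: "n < d" and I2: "I n s2"
    have fr2: "frame {11,12,13,22,23,24} {9,11,22,23,24} s s2" and n2: "idx s2 11 = n"
      and rw2: "\<And>n. n \<noteq> 3 * k + 1 \<Longrightarrow> n \<noteq> 3 * k + 2 \<Longrightarrow> memrow d s2 n = memrow d s n"
      and u2: "memrow d s2 (3 * k + 1) = (scatter d k w z ^^ n) (z i)"
      using I2 by (auto simp: I_def)
    have e2: "env s2" by (rule env_frame[OF env fr2]) auto
    have p2: "idx s2 9 = i * d" using fr2 p by (simp add: frame_def)
    have z2: "memrow d s2 i = z i" using stores i by (simp add: rw2 stores_def)
    have "runs (Seq (Seq (dot 9 6) (block [RAdd 9 24 3])) (Seq apply_scatter (block [NAdd 11 11 3]))) s2
      (20 * d + 4 + 100 * (k * d)) (I (Suc n))"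
    proof (rule runs_Seq)
      show "runs (Seq (dot 9 6) (block [RAdd 9 24 3])) s2 (20 * d + 2)
        (\<lambda>s'. frame {22,23,24} {9,22,23,24} s2 s' \<and> memrow d s' = memrow d s2
          \<and> reg s' 9 = scatter_form d k w z n (z i) (z i))"
      proof (rule runs_Seq)
        show "runs (dot 9 6) s2 (20 * d) (\<lambda>s'. frame {22,23,24} {22,23,24} s2 s' \<and> memrow d s' = memrow d s2
            \<and> reg s' 24 = ip d (memrow d s2 i) (memrow d s2 (3 * k + 1)))"
          by (rule runs_dot[OF e2]) (use e2 p2 in \<open>simp_all add: env_def\<close>)
        fix s3 assume s3: "frame {22,23,24} {22,23,24} s2 s3 \<and> memrow d s3 = memrow d s2
            \<and> reg s3 24 = ip d (memrow d s2 i) (memrow d s2 (3 * k + 1))"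
        show "runs (block [RAdd 9 24 3]) s3 2 (\<lambda>s'. frame {22,23,24} {9,22,23,24} s2 s' \<and> memrow d s' = memrow d s2
          \<and> reg s' 9 = scatter_form d k w z n (z i) (z i))"
          by (rule runs_block) (use s3 e2 u2 z2 in \<open>simp_all add: frame_def env_def scatter_form_def\<close>)
      qed simp
      fix s3 assume s3: "frame {22,23,24} {9,22,23,24} s2 s3 \<and> memrow d s3 = memrow d s2
          \<and> reg s3 9 = scatter_form d k w z n (z i) (z i)"
      have e3: "env s3" by (rule env_frame[OF e2 conjunct1[OF s3]]) auto
      have rep3: "stores w z c s3" using stores s3 by (simp add: stores_def rw2)
      show "runs (Seq apply_scatter (block [NAdd 11 11 3])) s3 (100 * (k * d) + 2) (I (Suc n))"
      proof (rule runs_Seq[OF runs_apply_scatter[OF e3 rep3]])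
        fix s4 assume s4: "frame {12,13,22,23,24} {11,22,23,24} s3 s4
          \<and> memrow d s4 = (memrow d s3)(3 * k + 1 := scatter d k w z (memrow d s3 (3 * k + 1)),
            3 * k + 2 := scatter d k w z (memrow d s3 (3 * k + 1)))"
        have "idx s4 11 = n" "idx s4 3 = 1" using s4 s3 n2 e2 by (simp_all add: frame_def env_def)
        moreover have "frame {11,12,13,22,23,24} {9,11,22,23,24} s s4"
          using fr2 s3 s4 by (simp add: frame_def)
        ultimately show "runs (block [NAdd 11 11 3]) s4 2 (I (Suc n))"
          by (intro runs_block) (use s3 s4 rw2 u2 in \<open>simp_all add: I_def frame_def\<close>)
      qed simp
    qed simp
    then show "holds (NLess 11 0) s2 \<and> runs (Seq (Seq (dot 9 6) (block [RAdd 9 24 3])) (Seq apply_scatter (block [NAdd 11 11 3]))) s2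
      (20 * d + 4 + 100 * (k * d)) (I (Suc n))"
      using n n2 e2 by (simp add: env_def)
  next
    fix s' assume "I d s'"
    then have "frame {11,12,13,22,23,24} {9,11,22,23,24} s s'" by (simp add: I_def)
    then have "env s'" by (rule env_frame[OF env]) auto
    with \<open>I d s'\<close> show "\<not> holds (NLess 11 0) s'" by (simp add: I_def env_def)
  qed (use d in \<open>simp_all add: I_def\<close>)
next
  have "d \<le> k * d * d" using mult_le_mono1[OF le_kd(1), of d] by simp
  moreover have "d * d \<le> k * d * d" using mult_le_mono1[OF le_kd(3), of d] by simp
  moreover note d
  moreover have "d * (20 * d + 4 + 100 * (k * d) + 1) = 20 * (d * d) + 100 * (k * d * d) + 5 * d"
    by (simp add: algebra_simps)
  ultimately show "2 + (d * (20 * d + 4 + 100 * (k * d) + 1) + 1) \<le> 200 * (k * d * d)" by linarith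
qed

lemma runs_recentre:
  assumes env: "env s" and stores: "stores w z c s"
  shows "runs recentre s (200 * (k * d)) (\<lambda>s'. frame {9,10,22,23,24} {5,11,12,22,23} s s'
    \<and> stores w (\<lambda>i j. z i j - mean k w z j) (\<lambda>j. c j + mean k w z j) s' \<and> reg s' 5 = (\<Sum>i<k. w i))"
  unfolding recentre_def
proof (rule runs_Seq)
  define J where "J i s' \<longleftrightarrow> frame {9,10,22,23,24} {5,11,12,22,23} s s' \<and> reg s' 5 = (\<Sum>l<i. w l)
    \<and> memrow d s' = (memrow d s)(3 * k + 1 := (\<lambda>j. \<Sum>l<i. w l * z l j))" for i s'
  define J' where "J' i s' \<longleftrightarrow> frame {9,10,22,23,24} {5,11,12,22,23} s s' \<and> reg s' 5 = (\<Sum>l<k. w l)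
    \<and> reg s' 12 = - 1 / (\<Sum>l<k. w l)
    \<and> memrow d s' = (\<lambda>n. if n < i then (\<lambda>j. z n j - mean k w z j) else
         ((memrow d s)(3 * k + 1 := (\<lambda>j. \<Sum>l<k. w l * z l j), 3 * k := (\<lambda>j. c j + mean k w z j))) n)" for i s'
  show "runs (block [RSub 5 5 5]) s 2 (\<lambda>s'. frame {} {5} s s' \<and> memrow d s' = memrow d s \<and> reg s' 5 = 0)"
    by (rule runs_block) (auto simp: frame_def)
  fix s1 assume s1: "frame {} {5} s s1 \<and> memrow d s1 = memrow d s \<and> reg s1 5 = 0"
  have e1: "env s1" by (rule env_frame[OF env conjunct1[OF s1]]) auto
  show "runs (Seq (axpy 6 6 3 3)
     (Seq (rows 9 (Seq (block [NAdd 10 9 4, RLoad 11 10, RAdd 5 5 11]) (axpy 6 9 2 11)))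
     (Seq (block [RDiv 11 2 5, RSub 12 3 11]) (Seq (axpy 5 6 2 11) (rows 9 (axpy 9 6 2 12)))))) s1 (190 * (k * d))
     (\<lambda>s'. frame {9,10,22,23,24} {5,11,12,22,23} s s'
    \<and> stores w (\<lambda>i j. z i j - mean k w z j) (\<lambda>j. c j + mean k w z j) s' \<and> reg s' 5 = (\<Sum>i<k. w i))"
  proof (rule runs_Seq)
    show "runs (axpy 6 6 3 3) s1 (20 * d) (\<lambda>s'. frame {22,23,24} {22,23} s1 s' \<and> memrow d s' = (memrow d s1)(3 * k + 1 := (\<lambda>_. 0)))"
      by (rule runs_mono[OF runs_axpy[OF e1, where n = "3 * k + 1" and m = "3 * k + 1"]])
         (use e1 in \<open>simp_all add: env_def\<close>)
    fix s2 assume s2: "frame {22,23,24} {22,23} s1 s2 \<and> memrow d s2 = (memrow d s1)(3 * k + 1 := (\<lambda>_. 0))"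
    have e2: "env s2" by (rule env_frame[OF e1 conjunct1[OF s2]]) auto
    show "runs (Seq (rows 9 (Seq (block [NAdd 10 9 4, RLoad 11 10, RAdd 5 5 11]) (axpy 6 9 2 11)))
     (Seq (block [RDiv 11 2 5, RSub 12 3 11]) (Seq (axpy 5 6 2 11) (rows 9 (axpy 9 6 2 12))))) s2 (170 * (k * d))
     (\<lambda>s'. frame {9,10,22,23,24} {5,11,12,22,23} s s'
       \<and> stores w (\<lambda>i j. z i j - mean k w z j) (\<lambda>j. c j + mean k w z j) s' \<and> reg s' 5 = (\<Sum>i<k. w i))"
    proof (rule runs_Seq)
      show "runs (rows 9 (Seq (block [NAdd 10 9 4, RLoad 11 10, RAdd 5 5 11]) (axpy 6 9 2 11))) s2
        (k * ((4 + 20 * d) + 3) + 3) (\<lambda>s'. env s' \<and> J k s')"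
      proof (rule runs_rows[OF e2, where J = J and T = "4 + 20 * d"])
        show "J 0 (s2\<lparr>idx := (idx s2)(9 := 0)\<rparr>)" using s1 s2 by (auto simp: J_def frame_def)
        fix i s3 assume i: "i < k" and e3: "env s3" and p3: "idx s3 9 = i * d" and J3: "J i s3"
        have fr3: "frame {9,10,22,23,24} {5,11,12,22,23} s s3" and S3: "reg s3 5 = (\<Sum>l<i. w l)"
          and rw3: "memrow d s3 = (memrow d s)(3 * k + 1 := (\<lambda>j. \<Sum>l<i. w l * z l j))"
          using J3 by (auto simp: J_def)
        have r3: "memrow d s3 i = z i" "memrow d s3 (k + i) 0 = w i" using stores i by (auto simp: rw3 stores_def)
        show "runs (Seq (block [NAdd 10 9 4, RLoad 11 10, RAdd 5 5 11]) (axpy 6 9 2 11)) s3 (4 + 20 * d)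
          (\<lambda>s'. env s' \<and> idx s' 9 = i * d \<and> J (Suc i) (s'\<lparr>idx := (idx s')(9 := Suc i * d)\<rparr>))"
        proof (rule runs_Seq)
          have "idx s3 9 + idx s3 4 = (k + i) * d" using e3 p3 by (simp add: env_def algebra_simps)
          then have wi: "mem s3 (idx s3 9 + idx s3 4) = w i" using r3 by (simp add: mem_head)
          show "runs (block [NAdd 10 9 4, RLoad 11 10, RAdd 5 5 11]) s3 4 (\<lambda>s'. frame {10} {5,11} s3 s'
             \<and> memrow d s' = memrow d s3 \<and> reg s' 5 = (\<Sum>l<Suc i. w l) \<and> reg s' 11 = w i)"
            by (rule runs_block) (use wi S3 in \<open>simp_all add: frame_def\<close>)
          fix s4 assume s4: "frame {10} {5,11} s3 s4
             \<and> memrow d s4 = memrow d s3 \<and> reg s4 5 = (\<Sum>l<Suc i. w l) \<and> reg s4 11 = w i"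
          have e4: "env s4" by (rule env_frame[OF e3 conjunct1[OF s4]]) auto
          have p4: "idx s4 9 = i * d" using s4 p3 by (simp add: frame_def)
          have "runs (axpy 6 9 2 11) s4 (20 * d) (\<lambda>s'. frame {22,23,24} {22,23} s4 s' \<and> memrow d s'
             = (memrow d s4)(3 * k + 1 := (\<lambda>j. reg s4 2 * memrow d s4 (3 * k + 1) j + reg s4 11 * memrow d s4 i j)))"
            by (rule runs_axpy[OF e4]) (use e4 p4 in \<open>simp_all add: env_def\<close>)
          then show "runs (axpy 6 9 2 11) s4 (20 * d)
            (\<lambda>s'. env s' \<and> idx s' 9 = i * d \<and> J (Suc i) (s'\<lparr>idx := (idx s')(9 := Suc i * d)\<rparr>))"
          proof (rule runs_mono)
            fix s5 assume s5: "frame {22,23,24} {22,23} s4 s5 \<and> memrow d s5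
             = (memrow d s4)(3 * k + 1 := (\<lambda>j. reg s4 2 * memrow d s4 (3 * k + 1) j + reg s4 11 * memrow d s4 i j))"
            have "env s5" by (rule env_frame[OF e4 conjunct1[OF s5]]) auto
            moreover have "idx s5 9 = i * d" using s5 p4 by (simp add: frame_def)
            moreover have "frame {9,10,22,23,24} {5,11,12,22,23} s s5" "reg s5 5 = (\<Sum>l<Suc i. w l)"
              using fr3 s4 s5 by (simp_all add: frame_def)
            moreover have "memrow d s5 = (memrow d s)(3 * k + 1 := (\<lambda>j. \<Sum>l<Suc i. w l * z l j))"
              using s5 s4 r3 e4 i by (simp add: env_def rw3 fun_eq_iff)
            ultimately show "env s5 \<and> idx s5 9 = i * d \<and> J (Suc i) (s5\<lparr>idx := (idx s5)(9 := Suc i * d)\<rparr>)"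
              by (simp add: J_def) (simp add: frame_def)
          qed simp
        qed simp
      qed simp_all
      fix s3 assume s3: "env s3 \<and> J k s3"
      show "runs (Seq (block [RDiv 11 2 5, RSub 12 3 11]) (Seq (axpy 5 6 2 11) (rows 9 (axpy 9 6 2 12)))) s3 (100 * (k * d))
        (\<lambda>s'. frame {9,10,22,23,24} {5,11,12,22,23} s s'
          \<and> stores w (\<lambda>i j. z i j - mean k w z j) (\<lambda>j. c j + mean k w z j) s' \<and> reg s' 5 = (\<Sum>i<k. w i))"
      proof (rule runs_Seq)
        show "runs (block [RDiv 11 2 5, RSub 12 3 11]) s3 3 (\<lambda>s'. env s' \<and> J k s' \<and> reg s' 11 = 1 / (\<Sum>l<k. w l)
           \<and> reg s' 12 = - 1 / (\<Sum>l<k. w l))"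
          by (rule runs_block) (use s3 in \<open>simp_all add: J_def frame_def env_def\<close>)
        fix s4 assume s4: "env s4 \<and> J k s4 \<and> reg s4 11 = 1 / (\<Sum>l<k. w l) \<and> reg s4 12 = - 1 / (\<Sum>l<k. w l)"
        show "runs (Seq (axpy 5 6 2 11) (rows 9 (axpy 9 6 2 12))) s4 (90 * (k * d))
          (\<lambda>s'. frame {9,10,22,23,24} {5,11,12,22,23} s s'
            \<and> stores w (\<lambda>i j. z i j - mean k w z j) (\<lambda>j. c j + mean k w z j) s' \<and> reg s' 5 = (\<Sum>i<k. w i))"
        proof (rule runs_Seq)
          show "runs (axpy 5 6 2 11) s4 (20 * d) (\<lambda>s'. frame {22,23,24} {22,23} s4 s' \<and> memrow d s'
             = (memrow d s4)(3 * k := (\<lambda>j. reg s4 2 * memrow d s4 (3 * k) j + reg s4 11 * memrow d s4 (3 * k + 1) j)))"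
            by (rule runs_axpy) (use s4 in \<open>simp_all add: env_def\<close>)
          fix s5 assume s5: "frame {22,23,24} {22,23} s4 s5 \<and> memrow d s5
             = (memrow d s4)(3 * k := (\<lambda>j. reg s4 2 * memrow d s4 (3 * k) j + reg s4 11 * memrow d s4 (3 * k + 1) j))"
          have e5: "env s5" by (rule env_frame[OF conjunct1[OF s4] conjunct1[OF s5]]) auto
          have J5: "J' 0 s5" using s4 s5 stores
            by (simp add: J'_def J_def frame_def env_def stores_def mean_def fun_eq_iff)
          show "runs (rows 9 (axpy 9 6 2 12)) s5 (60 * (k * d)) (\<lambda>s'. frame {9,10,22,23,24} {5,11,12,22,23} s s'
            \<and> stores w (\<lambda>i j. z i j - mean k w z j) (\<lambda>j. c j + mean k w z j) s' \<and> reg s' 5 = (\<Sum>i<k. w i))"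
          proof (rule runs_mono[OF runs_rows[OF e5, where J = J' and T = "20 * d", OF _ _ _ order.refl]])
            show "J' 0 (s5\<lparr>idx := (idx s5)(9 := 0)\<rparr>)" using J5 by (auto simp: J'_def frame_def)
            fix i s6 assume i: "i < k" and e6: "env s6" and p6: "idx s6 9 = i * d" and J6: "J' i s6"
            have "runs (axpy 9 6 2 12) s6 (20 * d) (\<lambda>s'. frame {22,23,24} {22,23} s6 s' \<and> memrow d s'
             = (memrow d s6)(i := (\<lambda>j. reg s6 2 * memrow d s6 i j + reg s6 12 * memrow d s6 (3 * k + 1) j)))"
              by (rule runs_axpy[OF e6]) (use e6 p6 in \<open>simp_all add: env_def\<close>)
            then show "runs (axpy 9 6 2 12) s6 (20 * d) (\<lambda>s'. env s' \<and> idx s' 9 = i * d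
              \<and> J' (Suc i) (s'\<lparr>idx := (idx s')(9 := Suc i * d)\<rparr>))"
            proof (rule runs_mono)
              fix s7 assume s7: "frame {22,23,24} {22,23} s6 s7 \<and> memrow d s7
                = (memrow d s6)(i := (\<lambda>j. reg s6 2 * memrow d s6 i j + reg s6 12 * memrow d s6 (3 * k + 1) j))"
              have "env s7" by (rule env_frame[OF e6 conjunct1[OF s7]]) auto
              moreover have "idx s7 9 = i * d" using s7 p6 by (simp add: frame_def)
              moreover have "frame {9,10,22,23,24} {5,11,12,22,23} s s7" "reg s7 5 = (\<Sum>l<k. w l)" "reg s7 12 = - 1 / (\<Sum>l<k. w l)"
                using J6 s7 by (simp_all add: J'_def frame_def)
              moreover have "memrow d s7 = (\<lambda>n. if n < Suc i then (\<lambda>j. z n j - mean k w z j) else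
                 ((memrow d s)(3 * k + 1 := (\<lambda>j. \<Sum>l<k. w l * z l j), 3 * k := (\<lambda>j. c j + mean k w z j))) n)"
              proof
                fix n
                show "memrow d s7 n = (if n < Suc i then (\<lambda>j. z n j - mean k w z j) else
                  ((memrow d s)(3 * k + 1 := (\<lambda>j. \<Sum>l<k. w l * z l j), 3 * k := (\<lambda>j. c j + mean k w z j))) n)"
                  using s7 J6 e6 i stores by (simp add: J'_def env_def stores_def mean_def fun_eq_iff)
              qed
              ultimately show "env s7 \<and> idx s7 9 = i * d \<and> J' (Suc i) (s7\<lparr>idx := (idx s7)(9 := Suc i * d)\<rparr>)"
                by (simp add: J'_def) (simp add: frame_def)
            qed simp
          next
            have "k * (20 * d + 3) = 20 * (k * d) + 3 * k" by (simp add: algebra_simps)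
            then show "k * (20 * d + 3) + 3 \<le> 60 * (k * d)" using le_kd by linarith
            show "frame {9,10,22,23,24} {5,11,12,22,23} s s'
              \<and> stores w (\<lambda>i j. z i j - mean k w z j) (\<lambda>j. c j + mean k w z j) s' \<and> reg s' 5 = (\<Sum>i<k. w i)"
              if "env s' \<and> J' k s'" for s'
              using that stores by (auto simp: J'_def stores_def)
          qed simp
        next
          show "20 * d + 60 * (k * d) \<le> 90 * (k * d)" using le_kd by linarith
        qed
      next
        show "3 + 90 * (k * d) \<le> 100 * (k * d)" using le_kd by linarith
      qed
    next
      have "k * (4 + 20 * d + 3) = 20 * (k * d) + 7 * k" by (simp add: algebra_simps)
      then show "k * (4 + 20 * d + 3) + 3 + 100 * (k * d) \<le> 170 * (k * d)" using le_kd by linarith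
    qed
  next
    show "20 * d + 170 * (k * d) \<le> 190 * (k * d)" using le_kd by linarith
  qed
next
  show "2 + 190 * (k * d) \<le> 200 * (k * d)" using le_kd by linarith
qed

end

text \<open>Accumulates the two sums of the test in real registers 6 and 7 and the running maximum of the leverages in
  real register 8.\<close>

definition score :: program where
  "score = Seq (block [RSub 6 6 6, RSub 7 7 7, RSub 8 8 8])
     (rows 9 (Seq (axpy 6 9 3 2) (Seq apply_scatter_power (Seq (dot 9 6)
       (Seq (block [RAdd 10 24 3, NAdd 10 9 4, RLoad 11 10, NAdd 10 10 4, RStore 10 10,
                    RMul 12 11 10, RAdd 6 6 12, RMul 12 11 9, RAdd 7 7 12])
         (Cond (RLess 3 11) (Cond (RLess 8 10) (block [RAdd 8 10 3]) Skip) Skip))))))"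

definition update :: program where
  "update = Seq (block [RMul 11 4 5, RMul 11 11 7])
     (Cond (RLess 11 6)
       (rows 9 (block [NAdd 10 9 4, RLoad 11 10, NAdd 12 10 4, RLoad 12 12, RDiv 12 12 8,
                       RSub 12 2 12, RMul 11 11 12, RStore 10 11]))
       Skip)"

definition iteration :: program where
  "iteration = Seq recentre (Seq score update)"

lemma max_leverage_0: "max_leverage d k w z 0 = 0"
  by (simp add: max_leverage_def)

lemma max_leverage_Suc: "max_leverage d k w z (Suc n) =
    (if 0 < w n \<and> max_leverage d k w z n < leverage d k w z n
     then leverage d k w z n else max_leverage d k w z n)"
proof (cases "0 < w n")
  case True
  then have "{i. i < Suc n \<and> 0 < w i} = insert n {i. i < n \<and> 0 < w i}" by (auto simp: less_Suc_eq)
  then have "max_leverage d k w z (Suc n)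
      = Max (insert (leverage d k w z n) (insert 0 (leverage d k w z ` {i. i < n \<and> 0 < w i})))"
    by (simp only: max_leverage_def image_insert insert_commute)
  also have "\<dots> = max (leverage d k w z n) (max_leverage d k w z n)"
    unfolding max_leverage_def by (rule Max_insert) auto
  finally show ?thesis using True by (simp add: max_def)
next
  case False
  then have "{i. i < Suc n \<and> 0 < w i} = {i. i < n \<and> 0 < w i}" by (auto simp: less_Suc_eq)
  then show ?thesis using False by (simp add: max_leverage_def)
qed

context ram begin

lemma le_kkdd: "1 \<le> k * k * d * d" "k * d \<le> k * k * d * d" "k \<le> k * k * d * d" "d \<le> k * k * d * d"
  "k * (k * d * d) = k * k * d * d" "k * d * d \<le> k * k * d * d"
proof -
  have eq: "k * k * d * d = (k * d) * (k * d)" by simp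
  show a: "k * d \<le> k * k * d * d" unfolding eq using mult_le_mono1[OF le_kd(1), of "k * d"] by simp
  show "1 \<le> k * k * d * d" "k \<le> k * k * d * d" "d \<le> k * k * d * d" using a le_kd by linarith+
  show b: "k * (k * d * d) = k * k * d * d" by simp
  show "k * d * d \<le> k * k * d * d" unfolding b[symmetric] using mult_le_mono1[OF k, of "k * d * d"] by simp
qed

lemma runs_score:
  assumes env: "env s" and stores: "stores w z c s"
  shows "runs score s (300 * (k * k * d * d)) (\<lambda>s'. frame {9,10,11,12,13,22,23,24} {6,7,8,9,10,11,12,22,23,24} s s'
    \<and> stores w z c s' \<and> (\<forall>l<k. memrow d s' (2 * k + l) 0 = leverage d k w z l)
    \<and> reg s' 6 = (\<Sum>i<k. w i * leverage d k w z i)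
    \<and> reg s' 7 = (\<Sum>i<k. w i * scatter_form d k w z (d - 1) (z i) (z i))
    \<and> reg s' 8 = max_leverage d k w z k)"
  unfolding score_def
proof (rule runs_Seq)
  define J where "J i s' \<longleftrightarrow> frame {9,10,11,12,13,22,23,24} {6,7,8,9,10,11,12,22,23,24} s s'
    \<and> stores w z c s' \<and> (\<forall>l<i. memrow d s' (2 * k + l) 0 = leverage d k w z l)
    \<and> reg s' 6 = (\<Sum>l<i. w l * leverage d k w z l)
    \<and> reg s' 7 = (\<Sum>l<i. w l * scatter_form d k w z (d - 1) (z l) (z l))
    \<and> reg s' 8 = max_leverage d k w z i" for i s'
  show "runs (block [RSub 6 6 6, RSub 7 7 7, RSub 8 8 8]) s 4 (\<lambda>s'. env s' \<and> J 0 s')"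
    by (rule runs_block) (use env stores in \<open>simp_all add: J_def frame_def env_def stores_def max_leverage_0\<close>)
  fix s1 assume s1: "env s1 \<and> J 0 s1"
  then have e1: "env s1" and J1: "J 0 s1" by auto
  let ?body = "Seq (axpy 6 9 3 2) (Seq apply_scatter_power (Seq (dot 9 6)
       (Seq (block [RAdd 10 24 3, NAdd 10 9 4, RLoad 11 10, NAdd 10 10 4, RStore 10 10,
                    RMul 12 11 10, RAdd 6 6 12, RMul 12 11 9, RAdd 7 7 12])
         (Cond (RLess 3 11) (Cond (RLess 8 10) (block [RAdd 8 10 3]) Skip) Skip))))"
  have "runs (rows 9 ?body) s1 (k * (240 * (k * d * d) + 14 + 3) + 3) (\<lambda>s'. env s' \<and> J k s')"
  proof (rule runs_rows[OF e1, where J = J and T = "240 * (k * d * d) + 14"])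
    show "J 0 (s1\<lparr>idx := (idx s1)(9 := 0)\<rparr>)" using J1 by (simp add: J_def frame_def stores_def)
    fix i s2 assume i: "i < k" and e2: "env s2" and p2: "idx s2 9 = i * d" and J2: "J i s2"
    have rep2: "stores w z c s2" using J2 by (simp add: J_def)
    have z2: "memrow d s2 i = z i" using rep2 i by (simp add: stores_def)
    show "runs ?body s2 (240 * (k * d * d) + 14)
      (\<lambda>s'. env s' \<and> idx s' 9 = i * d \<and> J (Suc i) (s'\<lparr>idx := (idx s')(9 := Suc i * d)\<rparr>))"
    proof (rule runs_Seq)
      show "runs (axpy 6 9 3 2) s2 (20 * d) (\<lambda>s'. frame {22,23,24} {22,23} s2 s'
         \<and> memrow d s' = (memrow d s2)(3 * k + 1 := z i))"
        by (rule runs_mono[OF runs_axpy[OF e2, where n = "3 * k + 1" and m = i]])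
           (use e2 p2 z2 in \<open>simp_all add: env_def\<close>)
      fix s3 assume s3: "frame {22,23,24} {22,23} s2 s3 \<and> memrow d s3 = (memrow d s2)(3 * k + 1 := z i)"
      have e3: "env s3" by (rule env_frame[OF e2 conjunct1[OF s3]]) auto
      have p3: "idx s3 9 = i * d" using s3 p2 by (simp add: frame_def)
      have rep3: "stores w z c s3" using rep2 s3 by (simp add: stores_def)
      have u3: "memrow d s3 (3 * k + 1) = z i" using s3 by simp
      show "runs (Seq apply_scatter_power (Seq (dot 9 6)
       (Seq (block [RAdd 10 24 3, NAdd 10 9 4, RLoad 11 10, NAdd 10 10 4, RStore 10 10,
                    RMul 12 11 10, RAdd 6 6 12, RMul 12 11 9, RAdd 7 7 12])
         (Cond (RLess 3 11) (Cond (RLess 8 10) (block [RAdd 8 10 3]) Skip) Skip)))) s3 (220 * (k * d * d) + 14)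
        (\<lambda>s'. env s' \<and> idx s' 9 = i * d \<and> J (Suc i) (s'\<lparr>idx := (idx s')(9 := Suc i * d)\<rparr>))"
      proof (rule runs_Seq[OF runs_apply_scatter_power[OF e3 rep3 p3 i u3]])
        fix s4 assume s4: "frame {11,12,13,22,23,24} {9,11,22,23,24} s3 s4
          \<and> (\<forall>n. n \<noteq> 3 * k + 1 \<and> n \<noteq> 3 * k + 2 \<longrightarrow> memrow d s4 n = memrow d s3 n)
          \<and> memrow d s4 (3 * k + 1) = (scatter d k w z ^^ d) (z i)
          \<and> reg s4 9 = scatter_form d k w z (d - 1) (z i) (z i)"
        have e4: "env s4" by (rule env_frame[OF e3 conjunct1[OF s4]]) auto
        have p4: "idx s4 9 = i * d" using s4 p3 by (simp add: frame_def)
        have rep4: "stores w z c s4" using rep3 s4 by (simp add: stores_def)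
        have z4: "memrow d s4 i = z i" using rep4 i by (simp add: stores_def)
        show "runs (Seq (dot 9 6)
         (Seq (block [RAdd 10 24 3, NAdd 10 9 4, RLoad 11 10, NAdd 10 10 4, RStore 10 10,
                    RMul 12 11 10, RAdd 6 6 12, RMul 12 11 9, RAdd 7 7 12])
         (Cond (RLess 3 11) (Cond (RLess 8 10) (block [RAdd 8 10 3]) Skip) Skip))) s4 (20 * d + 14)
          (\<lambda>s'. env s' \<and> idx s' 9 = i * d \<and> J (Suc i) (s'\<lparr>idx := (idx s')(9 := Suc i * d)\<rparr>))"
        proof (rule runs_Seq)
          show "runs (dot 9 6) s4 (20 * d) (\<lambda>s'. frame {22,23,24} {22,23,24} s4 s' \<and> memrow d s' = memrow d s4
            \<and> reg s' 24 = ip d (memrow d s4 i) (memrow d s4 (3 * k + 1)))"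
            by (rule runs_dot[OF e4]) (use e4 p4 in \<open>simp_all add: env_def\<close>)
          fix s5 assume s5: "frame {22,23,24} {22,23,24} s4 s5 \<and> memrow d s5 = memrow d s4
            \<and> reg s5 24 = ip d (memrow d s4 i) (memrow d s4 (3 * k + 1))"
          have e5: "env s5" by (rule env_frame[OF e4 conjunct1[OF s5]]) auto
          have p5: "idx s5 9 = i * d" using s5 p4 by (simp add: frame_def)
          have rep5: "stores w z c s5" using rep4 s5 by (simp add: stores_def)
          have \<tau>5: "reg s5 24 = leverage d k w z i"
            using s5 s4 z4 by (simp add: leverage_def scatter_form_def)
          have \<tau>'5: "reg s5 9 = scatter_form d k w z (d - 1) (z i) (z i)"
            using s5 s4 by (simp add: frame_def)
          have lev5: "memrow d s5 (2 * k + l) 0 = leverage d k w z l" if "l < i" for l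
          proof -
            have "memrow d s5 (2 * k + l) = memrow d s2 (2 * k + l)" using s3 s4 s5 that i by simp
            then show ?thesis using J2 that by (simp add: J_def)
          qed
          have fr5: "frame {9,10,11,12,13,22,23,24} {6,7,8,9,10,11,12,22,23,24} s s5"
            and acc5: "reg s5 6 = (\<Sum>l<i. w l * leverage d k w z l)"
              "reg s5 7 = (\<Sum>l<i. w l * scatter_form d k w z (d - 1) (z l) (z l))"
              "reg s5 8 = max_leverage d k w z i"
            using J2 s3 s4 s5 by (simp_all add: J_def frame_def)
          have a1: "idx s5 9 + idx s5 4 = (k + i) * d" and a2: "(k + i) * d + idx s5 4 = (2 * k + i) * d"
            using e5 p5 by (simp_all add: env_def algebra_simps)
          have wi: "mem s5 ((k + i) * d) = w i"
            using rep5 i unfolding mem_head by (simp add: stores_def)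
          have zero: "reg s5 3 = 0" using e5 by (simp add: env_def)
          show "runs (Seq (block [RAdd 10 24 3, NAdd 10 9 4, RLoad 11 10, NAdd 10 10 4, RStore 10 10,
                    RMul 12 11 10, RAdd 6 6 12, RMul 12 11 9, RAdd 7 7 12])
            (Cond (RLess 3 11) (Cond (RLess 8 10) (block [RAdd 8 10 3]) Skip) Skip)) s5 14
            (\<lambda>s'. env s' \<and> idx s' 9 = i * d \<and> J (Suc i) (s'\<lparr>idx := (idx s')(9 := Suc i * d)\<rparr>))"
          proof (rule runs_Seq)
            show "runs (block [RAdd 10 24 3, NAdd 10 9 4, RLoad 11 10, NAdd 10 10 4, RStore 10 10,
                    RMul 12 11 10, RAdd 6 6 12, RMul 12 11 9, RAdd 7 7 12]) s5 10
              (\<lambda>s'. frame {10} {6,7,10,11,12} s5 s'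
                \<and> memrow d s' = (memrow d s5)(2 * k + i := (memrow d s5 (2 * k + i))(0 := leverage d k w z i))
                \<and> reg s' 10 = leverage d k w z i \<and> reg s' 11 = w i
                \<and> reg s' 6 = reg s5 6 + w i * leverage d k w z i
                \<and> reg s' 7 = reg s5 7 + w i * scatter_form d k w z (d - 1) (z i) (z i))"
              by (rule runs_block)
                 (simp_all add: frame_def a1 a2 wi zero \<tau>5 \<tau>'5 memrow_store_head[OF refl])
            fix s6 assume s6: "frame {10} {6,7,10,11,12} s5 s6
                \<and> memrow d s6 = (memrow d s5)(2 * k + i := (memrow d s5 (2 * k + i))(0 := leverage d k w z i))
                \<and> reg s6 10 = leverage d k w z i \<and> reg s6 11 = w i
                \<and> reg s6 6 = reg s5 6 + w i * leverage d k w z i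
                \<and> reg s6 7 = reg s5 7 + w i * scatter_form d k w z (d - 1) (z i) (z i)"
            have e6: "env s6" by (rule env_frame[OF e5 conjunct1[OF s6]]) auto
            have p6: "idx s6 9 = i * d" using s6 p5 by (simp add: frame_def)
            have zero6: "reg s6 3 = 0" using e6 by (simp add: env_def)
            have rep6: "stores w z c s6" using rep5 s6 i by (simp add: stores_def)
            have lev6: "memrow d s6 (2 * k + l) 0 = leverage d k w z l" if "l < Suc i" for l
              using lev5[of l] s6 that by (cases "l = i") simp_all
            have max6: "reg s6 8 = max_leverage d k w z i" using s6 acc5 by (simp add: frame_def)
            define M where "M = max_leverage d k w z (Suc i)"
            have fr6: "frame {9,10,11,12,13,22,23,24} {6,7,8,9,10,11,12,22,23,24} s s6"
              using fr5 s6 by (simp add: frame_def)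
            have "runs (Cond (RLess 3 11) (Cond (RLess 8 10) (block [RAdd 8 10 3]) Skip) Skip) s6 4
              (\<lambda>s'. frame {} {8} s6 s' \<and> memrow d s' = memrow d s6 \<and> reg s' 8 = M)"
              by (intro runs_Cond[where T = 3] runs_Cond[where T = 2] runs_block runs_Skip)
                 (use s6 max6 zero6 in \<open>simp_all add: frame_def max_leverage_Suc M_def\<close>)
            then show "runs (Cond (RLess 3 11) (Cond (RLess 8 10) (block [RAdd 8 10 3]) Skip) Skip) s6 4
              (\<lambda>s'. env s' \<and> idx s' 9 = i * d \<and> J (Suc i) (s'\<lparr>idx := (idx s')(9 := Suc i * d)\<rparr>))"
            proof (rule runs_mono)
              fix s7 assume s7: "frame {} {8} s6 s7 \<and> memrow d s7 = memrow d s6 \<and> reg s7 8 = M"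
              have "env s7" by (rule env_frame[OF e6 conjunct1[OF s7]]) auto
              moreover have "idx s7 9 = i * d" using s7 p6 by (simp add: frame_def)
              moreover have "frame {9,10,11,12,13,22,23,24} {6,7,8,9,10,11,12,22,23,24} s (s7\<lparr>idx := (idx s7)(9 := Suc i * d)\<rparr>)"
                using fr6 s7 by (simp add: frame_def)
              moreover have "stores w z c (s7\<lparr>idx := (idx s7)(9 := Suc i * d)\<rparr>)"
                using rep6 s7 by (simp add: stores_def)
              moreover have "reg s7 6 = (\<Sum>i<Suc i. w i * leverage d k w z i)"
                "reg s7 7 = (\<Sum>i<Suc i. w i * scatter_form d k w z (d - 1) (z i) (z i))"
                using s7 s6 acc5 by (simp_all add: frame_def)
              moreover have "\<forall>l<Suc i. memrow d s7 (2 * k + l) 0 = leverage d k w z l"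
                using lev6 s7 by simp
              ultimately show "env s7 \<and> idx s7 9 = i * d \<and> J (Suc i) (s7\<lparr>idx := (idx s7)(9 := Suc i * d)\<rparr>)"
                using s7 unfolding J_def M_def by simp
            qed simp
          qed simp
        qed simp
      next
        have "d \<le> k * d * d" using mult_le_mono1[OF le_kd(1), of d] by simp
        then show "200 * (k * d * d) + (20 * d + 14) \<le> 220 * (k * d * d) + 14" by linarith
      qed
    next
      have "d \<le> k * d * d" using mult_le_mono1[OF le_kd(1), of d] by simp
      then show "20 * d + (220 * (k * d * d) + 14) \<le> 240 * (k * d * d) + 14" by linarith
    qed
  qed simp_all
  then show "runs (rows 9 ?body) s1 (290 * (k * k * d * d)) (\<lambda>s'. frame {9,10,11,12,13,22,23,24} {6,7,8,9,10,11,12,22,23,24} s s'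
    \<and> stores w z c s' \<and> (\<forall>l<k. memrow d s' (2 * k + l) 0 = leverage d k w z l)
    \<and> reg s' 6 = (\<Sum>i<k. w i * leverage d k w z i)
    \<and> reg s' 7 = (\<Sum>i<k. w i * scatter_form d k w z (d - 1) (z i) (z i))
    \<and> reg s' 8 = max_leverage d k w z k)"
  proof (rule runs_mono)
    have "k * (240 * (k * d * d) + 14 + 3) = 240 * (k * (k * d * d)) + 17 * k" by (simp add: algebra_simps)
    then show "k * (240 * (k * d * d) + 14 + 3) + 3 \<le> 290 * (k * k * d * d)"
      unfolding le_kkdd(5) using le_kkdd by linarith
  qed (simp add: J_def)
next
  show "4 + 290 * (k * k * d * d) \<le> 300 * (k * k * d * d)" using le_kkdd(1) by linarith
qed

lemma runs_update:
  assumes env: "env s" and stores: "stores w z c s"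
    and S: "reg s 5 = (\<Sum>i<k. w i)"
    and lev: "\<forall>l<k. memrow d s (2 * k + l) 0 = leverage d k w z l"
    and acc: "reg s 6 = (\<Sum>i<k. w i * leverage d k w z i)"
      "reg s 7 = (\<Sum>i<k. w i * scatter_form d k w z (d - 1) (z i) (z i))"
      "reg s 8 = max_leverage d k w z k"
  shows "runs update s (30 * k) (\<lambda>s'. env s' \<and> frame {9,10,12} {11,12} s s'
    \<and> stores (downweight d k R w z) z c s')"
  unfolding update_def
proof (rule runs_Seq)
  show "runs (block [RMul 11 4 5, RMul 11 11 7]) s 3 (\<lambda>s'. frame {} {11} s s' \<and> memrow d s' = memrow d s
      \<and> reg s' 11 = R * (\<Sum>i<k. w i) * (\<Sum>i<k. w i * scatter_form d k w z (d - 1) (z i) (z i)))"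
    by (rule runs_block) (use env S acc in \<open>simp_all add: frame_def env_def\<close>)
  fix s1 assume s1: "frame {} {11} s s1 \<and> memrow d s1 = memrow d s
      \<and> reg s1 11 = R * (\<Sum>i<k. w i) * (\<Sum>i<k. w i * scatter_form d k w z (d - 1) (z i) (z i))"
  have e1: "env s1" by (rule env_frame[OF env conjunct1[OF s1]]) auto
  have rep1: "stores w z c s1" using stores s1 by (simp add: stores_def)
  have acc1: "reg s1 6 = (\<Sum>i<k. w i * leverage d k w z i)" "reg s1 8 = max_leverage d k w z k"
    using s1 acc by (simp_all add: frame_def)
  have test: "holds (RLess 11 6) s1 \<longleftrightarrow> spread_out d k R w z"
    using s1 acc1 by (simp add: spread_out_def)
  have fr1: "frame {9,10,12} {11,12} s s1" using s1 by (simp add: frame_def)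
  define J where "J i s' \<longleftrightarrow> frame {9,10,12} {11,12} s s'
    \<and> (\<forall>l<k. memrow d s' (2 * k + l) 0 = leverage d k w z l)
    \<and> stores (\<lambda>l. if l < i then w l * (1 - leverage d k w z l / max_leverage d k w z k) else w l) z c s'" for i s'
  show "runs (Cond (RLess 11 6)
       (rows 9 (block [NAdd 10 9 4, RLoad 11 10, NAdd 12 10 4, RLoad 12 12, RDiv 12 12 8,
                       RSub 12 2 12, RMul 11 11 12, RStore 10 11])) Skip) s1 (20 * k)
    (\<lambda>s'. env s' \<and> frame {9,10,12} {11,12} s s' \<and> stores (downweight d k R w z) z c s')"
  proof (rule runs_Cond[where T = "k * (9 + 3) + 3"])
    assume "holds (RLess 11 6) s1"
    then have spread: "spread_out d k R w z" by (simp only: test)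
    show "runs (rows 9 (block [NAdd 10 9 4, RLoad 11 10, NAdd 12 10 4, RLoad 12 12, RDiv 12 12 8,
                       RSub 12 2 12, RMul 11 11 12, RStore 10 11])) s1 (k * (9 + 3) + 3)
      (\<lambda>s'. env s' \<and> frame {9,10,12} {11,12} s s' \<and> stores (downweight d k R w z) z c s')"
    proof (rule runs_mono[OF runs_rows[OF e1, where J = J and T = 9, OF _ _ _ order.refl]])
      show "J 0 (s1\<lparr>idx := (idx s1)(9 := 0)\<rparr>)"
        using s1 rep1 lev by (simp add: J_def frame_def stores_def)
      fix i s2 assume i: "i < k" and e2: "env s2" and p2: "idx s2 9 = i * d" and J2: "J i s2"
      have fr2: "frame {9,10,12} {11,12} s s2"
        and rep2: "stores (\<lambda>l. if l < i then w l * (1 - leverage d k w z l / max_leverage d k w z k) else w l) z c s2"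
        and lev2: "\<forall>l<k. memrow d s2 (2 * k + l) 0 = leverage d k w z l"
        using J2 by (simp_all add: J_def)
      have a1: "idx s2 9 + idx s2 4 = (k + i) * d" and a2: "(k + i) * d + idx s2 4 = (2 * k + i) * d"
        using e2 p2 by (simp_all add: env_def algebra_simps)
      have wi: "mem s2 ((k + i) * d) = w i"
        using rep2 i unfolding mem_head by (simp add: stores_def)
      have ti: "mem s2 ((2 * k + i) * d) = leverage d k w z i"
        using lev2 i unfolding mem_head by simp
      have one: "reg s2 2 = 1" using e2 by (simp add: env_def)
      have M: "reg s2 8 = max_leverage d k w z k" using fr2 acc by (simp add: frame_def)
      have "runs (block [NAdd 10 9 4, RLoad 11 10, NAdd 12 10 4, RLoad 12 12, RDiv 12 12 8,
                       RSub 12 2 12, RMul 11 11 12, RStore 10 11]) s2 9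
        (\<lambda>s'. frame {10,12} {11,12} s2 s' \<and> memrow d s' = (memrow d s2)(k + i := (memrow d s2 (k + i))
           (0 := w i * (1 - leverage d k w z i / max_leverage d k w z k))))"
        by (rule runs_block)
           (simp_all add: frame_def a1 a2 wi ti one M memrow_store_head[OF refl])
      then show "runs (block [NAdd 10 9 4, RLoad 11 10, NAdd 12 10 4, RLoad 12 12, RDiv 12 12 8,
                       RSub 12 2 12, RMul 11 11 12, RStore 10 11]) s2 9
        (\<lambda>s'. env s' \<and> idx s' 9 = i * d \<and> J (Suc i) (s'\<lparr>idx := (idx s')(9 := Suc i * d)\<rparr>))"
      proof (rule runs_mono)
        fix s3 assume s3: "frame {10,12} {11,12} s2 s3 \<and> memrow d s3 = (memrow d s2)(k + i := (memrow d s2 (k + i))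
           (0 := w i * (1 - leverage d k w z i / max_leverage d k w z k)))"
        have "env s3" by (rule env_frame[OF e2 conjunct1[OF s3]]) auto
        moreover have "idx s3 9 = i * d" using s3 p2 by (simp add: frame_def)
        moreover have "frame {9,10,12} {11,12} s (s3\<lparr>idx := (idx s3)(9 := Suc i * d)\<rparr>)"
          using fr2 s3 by (simp add: frame_def)
        moreover have "\<forall>l<k. memrow d (s3\<lparr>idx := (idx s3)(9 := Suc i * d)\<rparr>) (2 * k + l) 0 = leverage d k w z l"
          using lev2 s3 i by simp
        moreover have "stores (\<lambda>l. if l < Suc i then w l * (1 - leverage d k w z l / max_leverage d k w z k) else w l) z c
            (s3\<lparr>idx := (idx s3)(9 := Suc i * d)\<rparr>)"
          using rep2 s3 i by (simp add: stores_def less_Suc_eq)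
        ultimately show "env s3 \<and> idx s3 9 = i * d \<and> J (Suc i) (s3\<lparr>idx := (idx s3)(9 := Suc i * d)\<rparr>)"
          unfolding J_def by blast
      qed simp
    next
      show "env s' \<and> frame {9,10,12} {11,12} s s' \<and> stores (downweight d k R w z) z c s'"
        if "env s' \<and> J k s'" for s'
        using that spread by (simp add: J_def stores_def downweight_def)
    qed simp_all
  next
    assume "\<not> holds (RLess 11 6) s1"
    then have "\<not> spread_out d k R w z" using test by blast
    then show "runs Skip s1 (k * (9 + 3) + 3) (\<lambda>s'. env s' \<and> frame {9,10,12} {11,12} s s' \<and> stores (downweight d k R w z) z c s')"
      by (intro runs_Skip) (use e1 fr1 rep1 in \<open>simp_all add: downweight_def\<close>)
  next
    show "Suc (k * (9 + 3) + 3) \<le> 20 * k" using k by simp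
  qed
next
  show "3 + 20 * k \<le> 30 * k" using k by simp
qed

definition stores_triple :: "(nat \<Rightarrow> real) \<times> (nat \<Rightarrow> nat \<Rightarrow> real) \<times> (nat \<Rightarrow> real) \<Rightarrow> state \<Rightarrow> bool" where
  "stores_triple x s \<longleftrightarrow> stores (fst x) (fst (snd x)) (snd (snd x)) s"

lemma runs_iteration:
  assumes env: "env s" and stores: "stores_triple x s"
  shows "runs iteration s (600 * (k * k * d * d)) (\<lambda>s'. env s' \<and> idx s' 8 = idx s 8
    \<and> stores_triple (filter_step d k R x) s')"
proof -
  obtain w z c where x: "x = (w, z, c)" by (cases x)
  define z' where "z' = (\<lambda>i j. z i j - mean k w z j)"
  define c' where "c' = (\<lambda>j. c j + mean k w z j)"
  have result: "filter_step d k R x = (downweight d k R w z', z', c')"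
    by (simp add: x z'_def c'_def Let_def)
  have rep0: "stores w z c s" using stores by (simp add: stores_triple_def x)
  show ?thesis unfolding iteration_def
  proof (rule runs_Seq[OF runs_recentre[OF env rep0]])
    fix s1 assume s1: "frame {9,10,22,23,24} {5,11,12,22,23} s s1
      \<and> stores w (\<lambda>i j. z i j - mean k w z j) (\<lambda>j. c j + mean k w z j) s1 \<and> reg s1 5 = (\<Sum>i<k. w i)"
    have e1: "env s1" by (rule env_frame[OF env conjunct1[OF s1]]) auto
    have rep1: "stores w z' c' s1" using s1 by (simp add: z'_def c'_def)
    show "runs (Seq score update) s1 (400 * (k * k * d * d)) (\<lambda>s'. env s' \<and> idx s' 8 = idx s 8
      \<and> stores_triple (filter_step d k R x) s')"
    proof (rule runs_Seq[OF runs_score[OF e1 rep1]])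
      fix s2 assume s2: "frame {9,10,11,12,13,22,23,24} {6,7,8,9,10,11,12,22,23,24} s1 s2
        \<and> stores w z' c' s2 \<and> (\<forall>l<k. memrow d s2 (2 * k + l) 0 = leverage d k w z' l)
        \<and> reg s2 6 = (\<Sum>i<k. w i * leverage d k w z' i)
        \<and> reg s2 7 = (\<Sum>i<k. w i * scatter_form d k w z' (d - 1) (z' i) (z' i))
        \<and> reg s2 8 = max_leverage d k w z' k"
      have e2: "env s2" by (rule env_frame[OF e1 conjunct1[OF s2]]) auto
      have "reg s2 5 = (\<Sum>i<k. w i)" using s1 s2 by (simp add: frame_def)
      then have "runs update s2 (30 * k) (\<lambda>s'. env s' \<and> frame {9,10,12} {11,12} s2 s'
          \<and> stores (downweight d k R w z') z' c' s')"
        by (intro runs_update[OF e2]) (use s2 in simp_all)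
      then show "runs update s2 (30 * k) (\<lambda>s'. env s' \<and> idx s' 8 = idx s 8
        \<and> stores_triple (filter_step d k R x) s')"
        by (rule runs_mono)
           (use s1 s2 in \<open>simp_all add: frame_def stores_triple_def result\<close>)
    next
      show "300 * (k * k * d * d) + 30 * k \<le> 400 * (k * k * d * d)" using le_kkdd(3) by linarith
    qed
  next
    show "200 * (k * d) + 400 * (k * k * d * d) \<le> 600 * (k * k * d * d)" using le_kkdd(2) by linarith
  qed
qed

end

text \<open>The loop computes \<open>k d\<close> by repeated addition; real register 4 receives the threshold \<open>100 r\<^sup>2\<close>.\<close>

definition setup_registers :: program where
  "setup_registers = Seq (block [NConst 3 1, RCast 2 3, NConst 8 100, RCast 4 8, RMul 4 4 1, RMul 4 4 1, NConst 8 0])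
     (Seq (Loop (NLess 8 1) (block [NAdd 4 4 0, NAdd 8 8 3]))
       (block [NAdd 5 4 4, NAdd 5 5 4, NAdd 6 5 0, NAdd 7 6 0]))"

definition unit_weights :: program where
  "unit_weights = rows 9 (block [NAdd 10 9 4, RStore 10 2])"

definition iterations :: program where
  "iterations = Seq (block [NAdd 8 2 2]) (Loop (NLess 8 1) (Seq iteration (block [NAdd 8 8 3])))"

definition filter_program :: program where
  "filter_program = Seq setup_registers (Seq unit_weights (Seq iterations
     (Seq (block [NConst 9 0]) (axpy 9 5 3 2))))"

context ram begin

lemma runs_setup_registers:
  assumes "s = input_state d k C r Z" "R = 100 * r\<^sup>2"
  shows "runs setup_registers s (20 * k) (\<lambda>s'. env s' \<and> mem s' = mem s)"
  unfolding setup_registers_def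
proof (rule runs_Seq)
  define I where "I i s' \<longleftrightarrow> idx s' 0 = d \<and> idx s' 1 = k \<and> idx s' 2 = 0 \<and> idx s' 3 = 1 \<and> idx s' 4 = i * d
     \<and> idx s' 8 = i \<and> reg s' 2 = 1 \<and> reg s' 3 = 0 \<and> reg s' 4 = R \<and> mem s' = mem s" for i and s' :: state
  show "runs (block [NConst 3 1, RCast 2 3, NConst 8 100, RCast 4 8, RMul 4 4 1, RMul 4 4 1, NConst 8 0]) s 8 (I 0)"
    by (rule runs_block) (use assms in \<open>simp_all add: I_def input_state_def power2_eq_square\<close>)
  fix s1 assume s1: "I 0 s1"
  show "runs (Seq (Loop (NLess 8 1) (block [NAdd 4 4 0, NAdd 8 8 3]))
       (block [NAdd 5 4 4, NAdd 5 5 4, NAdd 6 5 0, NAdd 7 6 0])) s1 (12 * k) (\<lambda>s'. env s' \<and> mem s' = mem s)"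
  proof (rule runs_Seq)
    show "runs (Loop (NLess 8 1) (block [NAdd 4 4 0, NAdd 8 8 3])) s1 (k * (3 + 1) + 1) (I k)"
    proof (rule runs_Loop[where I = I and n = k and T = 3, OF s1 _ _ order.refl])
      fix i s2 assume i: "i < k" and s2: "I i s2"
      then have "holds (NLess 8 1) s2" by (simp add: I_def)
      moreover have "runs (block [NAdd 4 4 0, NAdd 8 8 3]) s2 3 (I (Suc i))"
        by (rule runs_block) (use s2 in \<open>simp_all add: I_def\<close>)
      ultimately show "holds (NLess 8 1) s2 \<and> runs (block [NAdd 4 4 0, NAdd 8 8 3]) s2 3 (I (Suc i))" ..
    qed (simp add: I_def)
    fix s2 assume s2: "I k s2"
    show "runs (block [NAdd 5 4 4, NAdd 5 5 4, NAdd 6 5 0, NAdd 7 6 0]) s2 5 (\<lambda>s'. env s' \<and> mem s' = mem s)"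
      by (rule runs_block) (use s2 in \<open>simp_all add: I_def env_def\<close>)
  next
    show "k * (3 + 1) + 1 + 5 \<le> 12 * k" using k by simp
  qed
next
  show "8 + 12 * k \<le> 20 * k" using k by simp
qed

lemma runs_unit_weights:
  assumes env: "env s"
    and Z: "\<And>i. i < k \<Longrightarrow> memrow d s i = y i" and 0: "memrow d s (3 * k) = (\<lambda>_. 0)"
  shows "runs unit_weights s (20 * k) (\<lambda>s'. env s' \<and> stores_triple (\<lambda>_. 1, y, \<lambda>_. 0) s')"
  unfolding unit_weights_def
proof (rule runs_mono)
  define J where "J i s' \<longleftrightarrow> (\<forall>l<k. memrow d s' l = y l) \<and> (\<forall>l<i. memrow d s' (k + l) 0 = 1)
     \<and> memrow d s' (3 * k) = (\<lambda>_. 0)" for i s'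
  show "runs (rows 9 (block [NAdd 10 9 4, RStore 10 2])) s (k * (3 + 3) + 3) (\<lambda>s'. env s' \<and> J k s')"
  proof (rule runs_rows[OF env, where J = J and T = 3, OF _ _ _ order.refl])
    show "J 0 (s\<lparr>idx := (idx s)(9 := 0)\<rparr>)" using Z 0 by (simp add: J_def)
    fix i s1 assume i: "i < k" and e1: "env s1" and p1: "idx s1 9 = i * d" and J1: "J i s1"
    have a: "idx s1 9 + idx s1 4 = (k + i) * d" and one: "reg s1 2 = 1"
      using e1 p1 by (simp_all add: env_def algebra_simps)
    have "runs (block [NAdd 10 9 4, RStore 10 2]) s1 3 (\<lambda>s'. frame {10} {} s1 s'
      \<and> memrow d s' = (memrow d s1)(k + i := (memrow d s1 (k + i))(0 := 1)))"
      by (rule runs_block) (simp_all add: frame_def a one memrow_store_head[OF refl])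
    then show "runs (block [NAdd 10 9 4, RStore 10 2]) s1 3
      (\<lambda>s'. env s' \<and> idx s' 9 = i * d \<and> J (Suc i) (s'\<lparr>idx := (idx s')(9 := Suc i * d)\<rparr>))"
    proof (rule runs_mono)
      fix s2 assume s2: "frame {10} {} s1 s2 \<and> memrow d s2 = (memrow d s1)(k + i := (memrow d s1 (k + i))(0 := 1))"
      have "env s2" by (rule env_frame[OF e1 conjunct1[OF s2]]) auto
      moreover have "idx s2 9 = i * d" using s2 p1 by (simp add: frame_def)
      moreover have "J (Suc i) (s2\<lparr>idx := (idx s2)(9 := Suc i * d)\<rparr>)"
        using s2 J1 i by (simp add: J_def less_Suc_eq)
      ultimately show "env s2 \<and> idx s2 9 = i * d \<and> J (Suc i) (s2\<lparr>idx := (idx s2)(9 := Suc i * d)\<rparr>)" by blast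
    qed simp
  qed simp
  show "env s' \<and> stores_triple (\<lambda>_. 1, y, \<lambda>_. 0) s'" if "env s' \<and> J k s'" for s'
    using that by (simp add: J_def stores_triple_def stores_def)
  show "k * (3 + 3) + 3 \<le> 20 * k" using k by simp
qed

lemma runs_iterations:
  assumes env: "env s" and x: "stores_triple x s"
  shows "runs iterations s (700 * (k * k * k * d * d))
    (\<lambda>s'. env s' \<and> stores_triple ((filter_step d k R ^^ k) x) s')"
  unfolding iterations_def
proof (rule runs_Seq)
  define I where "I n s' \<longleftrightarrow> env s' \<and> idx s' 8 = n \<and> stores_triple ((filter_step d k R ^^ n) x) s'" for n s'
  show "runs (block [NAdd 8 2 2]) s 2 (I 0)"
    by (rule runs_block) (use env x in \<open>simp_all add: I_def env_def stores_triple_def stores_def\<close>)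
  fix s1 assume s1: "I 0 s1"
  have "runs (Loop (NLess 8 1) (Seq iteration (block [NAdd 8 8 3]))) s1 (k * ((600 * (k * k * d * d) + 2) + 1) + 1) (I k)"
  proof (rule runs_Loop[where I = I and n = k, OF s1 _ _ order.refl])
    fix n s2 assume n: "n < k" and s2: "I n s2"
    then have e2: "env s2" and n2: "idx s2 8 = n" and x2: "stores_triple ((filter_step d k R ^^ n) x) s2"
      by (simp_all add: I_def)
    have "runs (Seq iteration (block [NAdd 8 8 3])) s2 (600 * (k * k * d * d) + 2) (I (Suc n))"
    proof (rule runs_Seq[OF runs_iteration[OF e2 x2]])
      fix s3 assume s3: "env s3 \<and> idx s3 8 = idx s2 8 \<and> stores_triple (filter_step d k R ((filter_step d k R ^^ n) x)) s3"
      show "runs (block [NAdd 8 8 3]) s3 2 (I (Suc n))"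
        by (rule runs_block) (use s3 n2 in \<open>simp_all add: I_def env_def stores_triple_def stores_def\<close>)
    qed simp
    moreover have "holds (NLess 8 1) s2" using n n2 e2 by (simp add: env_def)
    ultimately show "holds (NLess 8 1) s2 \<and> runs (Seq iteration (block [NAdd 8 8 3])) s2 (600 * (k * k * d * d) + 2) (I (Suc n))"
      by blast
  qed (simp add: I_def env_def)
  then show "runs (Loop (NLess 8 1) (Seq iteration (block [NAdd 8 8 3]))) s1 (k * ((600 * (k * k * d * d) + 2) + 1) + 1)
    (\<lambda>s'. env s' \<and> stores_triple ((filter_step d k R ^^ k) x) s')"
    by (rule runs_mono) (simp_all add: I_def)
next
  have "k * 1 \<le> k * (k * k * d * d)" using le_kkdd(1) by (rule mult_le_mono2)
  moreover have "k * ((600 * (k * k * d * d) + 2) + 1) = 600 * (k * (k * k * d * d)) + 3 * k" by (simp add: algebra_simps)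
  moreover have "k * (k * k * d * d) = k * k * k * d * d" by simp
  ultimately show "2 + (k * ((600 * (k * k * d * d) + 2) + 1) + 1) \<le> 700 * (k * k * k * d * d)"
    using k by linarith
qed

text \<open>The output is copied to row \<open>0\<close>, where the result of a program is read.\<close>

lemma runs_filter_program:
  assumes R: "R = 100 * r\<^sup>2"
  shows "runs filter_program (input_state d k C r Z) (1000 * (d * k) ^ 3)
    (\<lambda>s. \<forall>j<d. mem s j = snd (snd ((filter_step d k R ^^ k)
      (\<lambda>_. 1, \<lambda>i j. if j < d then Z i $ j else 0, \<lambda>_. 0))) j)"
proof -
  define s where "s = input_state d k C r Z"
  define y where "y = (\<lambda>i j. if j < d then Z i $ j else 0)"
  define x where "x = (filter_step d k R ^^ k) (\<lambda>_. 1, y, \<lambda>_. 0)"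
  define Q where "Q s' \<longleftrightarrow> (\<forall>j<d. mem s' j = snd (snd x) j)" for s' :: state
  have input: "memrow d s i = y i" if "i < k" for i
  proof
    fix j
    have "i * d + j < k * d" if "j < d"
    proof -
      have "i * d + j < Suc i * d" using that by simp
      also have "\<dots> \<le> k * d" using \<open>i < k\<close> by (intro mult_le_mono1) simp
      finally show ?thesis .
    qed
    then show "memrow d s i j = y i j"
      by (simp add: memrow_def y_def s_def input_state_def)
  qed
  have input0: "memrow d s (3 * k) = (\<lambda>_. 0)"
  proof
    fix j
    have "k * d \<le> 3 * k * d + j" by simp
    then show "memrow d s (3 * k) j = 0"
      by (simp add: memrow_def s_def input_state_def)
  qed
  have "runs filter_program s (20 * k + (20 * k + (700 * (k * k * k * d * d) + (2 + 20 * d)))) Q"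
    unfolding filter_program_def
  proof (rule runs_Seq[OF runs_setup_registers[OF s_def R] _ order.refl])
    fix s1 assume s1: "env s1 \<and> mem s1 = mem s"
    then have mem1: "memrow d s1 = memrow d s" by (simp add: memrow_def fun_eq_iff)
    show "runs (Seq unit_weights (Seq iterations (Seq (block [NConst 9 0]) (axpy 9 5 3 2)))) s1
      (20 * k + (700 * (k * k * k * d * d) + (2 + 20 * d))) Q"
    proof (rule runs_Seq[OF runs_unit_weights[where y = y] _ order.refl])
      show "env s1" using s1 by blast
      show "memrow d s1 i = y i" if "i < k" for i using input[OF that] mem1 by simp
      show "memrow d s1 (3 * k) = (\<lambda>_. 0)" using input0 mem1 by simp
      fix s2 assume s2: "env s2 \<and> stores_triple (\<lambda>_. 1, y, \<lambda>_. 0) s2"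
      show "runs (Seq iterations (Seq (block [NConst 9 0]) (axpy 9 5 3 2))) s2
        (700 * (k * k * k * d * d) + (2 + 20 * d)) Q"
      proof (rule runs_Seq[OF runs_iterations[OF conjunct1[OF s2] conjunct2[OF s2]] _ order.refl])
        fix s3 assume s3: "env s3 \<and> stores_triple ((filter_step d k R ^^ k) (\<lambda>_. 1, y, \<lambda>_. 0)) s3"
        then have out3: "memrow d s3 (3 * k) = snd (snd x)"
          by (simp add: stores_triple_def stores_def x_def)
        show "runs (Seq (block [NConst 9 0]) (axpy 9 5 3 2)) s3 (2 + 20 * d) Q"
        proof (rule runs_Seq[OF _ _ order.refl])
          show "runs (block [NConst 9 0]) s3 2 (\<lambda>s'. env s' \<and> idx s' 9 = 0 * d \<and> memrow d s' = memrow d s3)"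
            by (rule runs_block) (use s3 in \<open>simp_all add: env_def\<close>)
          fix s4 assume s4: "env s4 \<and> idx s4 9 = 0 * d \<and> memrow d s4 = memrow d s3"
          have "runs (axpy 9 5 3 2) s4 (20 * d) (\<lambda>s'. frame {22,23,24} {22,23} s4 s'
            \<and> memrow d s' = (memrow d s4)(0 := (\<lambda>j. reg s4 3 * memrow d s4 0 j + reg s4 2 * memrow d s4 (3 * k) j)))"
            by (rule runs_axpy) (use s4 in \<open>simp_all add: env_def\<close>)
          then show "runs (axpy 9 5 3 2) s4 (20 * d) Q"
          proof (rule runs_mono)
            fix s5 assume s5: "frame {22,23,24} {22,23} s4 s5
              \<and> memrow d s5 = (memrow d s4)(0 := (\<lambda>j. reg s4 3 * memrow d s4 0 j + reg s4 2 * memrow d s4 (3 * k) j))"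
            have "memrow d s5 0 = snd (snd x)" using s4 s5 out3 by (simp add: env_def)
            then show "Q s5" unfolding Q_def using mem_memrow[of _ d s5 0] by simp
          qed simp
        qed
      qed
    qed
  qed
  then show ?thesis unfolding s_def
  proof (rule runs_mono)
    have kkk: "k * 1 \<le> k * (k * k * d * d)" using le_kkdd(1) by (rule mult_le_mono2)
    have a: "k * k * k * d * d = k * (k * k * d * d)" by simp
    have b: "(d * k) ^ 3 = d * (k * k * k * d * d)" by (simp add: power3_eq_cube)
    have "k * k * k * d * d \<le> (d * k) ^ 3" unfolding b using mult_le_mono1[OF d, of "k * k * k * d * d"] by simp
    moreover have "d \<le> (d * k) ^ 3"
    proof -
      have "d * 1 \<le> d * (k * k * k * d * d)" using kkk k a by (intro mult_le_mono2) linarith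
      then show ?thesis by (simp only: b mult_1_right)
    qed
    ultimately show "20 * k + (20 * k + (700 * (k * k * k * d * d) + (2 + 20 * d))) \<le> 1000 * (d * k) ^ 3"
      using kkk a k by linarith
  qed (simp add: Q_def x_def y_def)
qed

end

theorem lemma4p1:
  shows "\<exists>K::real. K > 0 \<and>
    (\<exists>(P::program) (a::real) (q::nat).
      \<forall>(d::nat) (k::nat) (C::real) (r::real).
        d \<ge> 1 \<and> k \<ge> 1 \<and> C > 0 \<and> r > 0 \<longrightarrow>
        (\<forall>Z::nat \<Rightarrow> real vec. (\<forall>i<k. Z i \<in> carrier_vec d) \<longrightarrow>
          (\<exists>T s. exec P (input_state d k C r Z) T s \<and>
             real T \<le> a * (real d * real k * ln (C + 2)) ^ q \<and>
             (\<forall>\<mu> \<in> carrier_vec d.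
                certifiably_central d k Z r (1/100) \<mu> \<and>
                real (card {i. i < k \<and> vnorm (Z i - \<mu>) > C * r}) \<le> real k / 100 \<longrightarrow>
                vnorm (\<mu> - output_point d s) \<le> K * r))))"
proof (rule exI[of _ "21::real"], rule conjI, simp, rule exI[of _ filter_program],
    rule exI[of _ "1000 / ln 2 ^ 3 :: real"], rule exI[of _ "3::nat"], intro allI impI)
  fix d k :: nat and C r :: real and Z :: "nat \<Rightarrow> real vec"
  assume "d \<ge> 1 \<and> k \<ge> 1 \<and> C > 0 \<and> r > 0" and Z: "\<forall>i<k. Z i \<in> carrier_vec d"
  then have d: "1 \<le> d" and k: "1 \<le> k" and C: "0 < C" and r: "0 < r" by auto
  define y where "y = (\<lambda>i j. if j < d then Z i $ j else 0)"
  interpret ram d k "100 * r\<^sup>2" by unfold_locales (use d k in auto)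
  obtain T s where exec: "exec filter_program (input_state d k C r Z) T s" and T: "T \<le> 1000 * (d * k) ^ 3"
    and out: "\<And>j. j < d \<Longrightarrow> mem s j = snd (snd ((filter_step d k (100 * r\<^sup>2) ^^ k) (\<lambda>_. 1, y, \<lambda>_. 0))) j"
    using runs_filter_program[OF refl, of C Z] unfolding runs_def y_def by blast
  show "\<exists>T s. exec filter_program (input_state d k C r Z) T s \<and>
             real T \<le> 1000 / ln 2 ^ 3 * (real d * real k * ln (C + 2)) ^ 3 \<and>
             (\<forall>\<mu> \<in> carrier_vec d.
                certifiably_central d k Z r (1/100) \<mu> \<and>
                real (card {i. i < k \<and> vnorm (Z i - \<mu>) > C * r}) \<le> real k / 100 \<longrightarrow>
                vnorm (\<mu> - output_point d s) \<le> 21 * r)"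
  proof (intro exI[of _ T] exI[of _ s] conjI ballI impI)
    show "exec filter_program (input_state d k C r Z) T s" by (rule exec)
    have ln2: "0 < ln (2::real)" by simp
    have "real T \<le> 1000 * (real d * real k) ^ 3"
      using T by (metis of_nat_le_iff of_nat_mult of_nat_numeral of_nat_power)
    also have "\<dots> = 1000 / ln 2 ^ 3 * (real d * real k * ln 2) ^ 3"
      using ln2 by (simp add: power_mult_distrib)
    also have "\<dots> \<le> 1000 / ln 2 ^ 3 * (real d * real k * ln (C + 2)) ^ 3"
      using ln2 C by (intro mult_left_mono power_mono) auto
    finally show "real T \<le> 1000 / ln 2 ^ 3 * (real d * real k * ln (C + 2)) ^ 3" .
  next
    fix \<mu> assume \<mu>: "\<mu> \<in> carrier_vec d"
      and "certifiably_central d k Z r (1/100) \<mu> \<and>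
        real (card {i. i < k \<and> vnorm (Z i - \<mu>) > C * r}) \<le> real k / 100"
    then have central: "certifiably_central d k Z r (1/100) \<mu>" by simp
    obtain w z c where run: "(filter_step d k (100 * r\<^sup>2) ^^ k) (\<lambda>_. 1, y, \<lambda>_. 0) = (w, z, c)"
      by (metis prod_cases3)
    have "ip d (\<lambda>j. \<mu> $ j - c j) (\<lambda>j. \<mu> $ j - c j) \<le> (21 * r)\<^sup>2"
    proof (rule filter_finds_centre[OF d k r _ run])
      fix Q assume "psd_bilinear d Q" "psd_bilinear.trace d Q \<le> 1"
      then show "60 * card {i. i < k \<and> r\<^sup>2 \<le> Q (\<lambda>j. y i j - \<mu> $ j) (\<lambda>j. y i j - \<mu> $ j)} \<le> k"
        by (rule central_imp_few_far_points[OF central k r Z \<mu>]) (simp add: y_def)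
    qed
    moreover have "(\<mu> - output_point d s) \<bullet> (\<mu> - output_point d s) = ip d (\<lambda>j. \<mu> $ j - c j) (\<lambda>j. \<mu> $ j - c j)"
      using \<mu> out run by (simp add: scalar_prod_def ip_def output_point_def lessThan_atLeast0)
    ultimately have "vnorm (\<mu> - output_point d s) \<le> sqrt ((21 * r)\<^sup>2)"
      unfolding vnorm_def by simp
    then show "vnorm (\<mu> - output_point d s) \<le> 21 * r" unfolding real_sqrt_abs using r by simp
  qed
qed

end
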